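(* Let $R$ be a finitely generated standard graded algebra over a Noetherian commutative ring $R_0$ and let $M$ be a finitely generated graded $R$-module. Let $t$ be an integer with $t\ge d(M)$. If $M$ is weakly $t$-regular, then $M$ is $t$-regular.
   Context: Standard graded means $R=\bigoplus_{n\ge0}R_n$ is generated over $R_0$ by $R_1$; $R_+=\bigoplus_{n\ge1}R_n$. $H^i_{R_+}(M)$ is the $i$-th (graded) local cohomology module of $M$ with respect to $R_+$. $M$ is $t$-regular if $H^i_{R_+}(M)_{n-i+1}=0$ for all $i\ge0$ and all $n\ge t$. $M$ is weakly $t$-regular if $H^i_{R_+}(M)_{t-i+1}=0$ for all $i\ge 0$. $d(M)$ is the maximal degree of the homogeneous minimal generators of $M$, i.e. $d(M)=\max\{t\mid (M/R_+M)_t\ne0\}$ (with $d(0)=-\infty$). *)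

theory Defs
  imports "HOL-Algebra.Ring_Divisibility" "HOL-Algebra.Generated_Rings" "HOL-Algebra.Ideal_Product"
    "HOL-Algebra.Module" "HOL-Library.Extended_Real"
begin

section \<open>Graded rings and graded modules\<close>

record 'r graded_ring = "'r ring" +
  rcomp :: "nat \<Rightarrow> 'r set"

record ('r, 'm) graded_module = "('r, 'm) module" +
  mcomp :: "int \<Rightarrow> 'm set"

definition direct_sum_decomposition :: "('a, 'b) ring_scheme \<Rightarrow> ('i \<Rightarrow> 'a set) \<Rightarrow> bool" where
  "direct_sum_decomposition G C \<longleftrightarrow>
     (\<forall>n. additive_subgroup (C n) G) \<and>
     (\<forall>x \<in> carrier G. \<exists>!f. (\<forall>n. f n \<in> C n) \<and> finite {n. f n \<noteq> \<zero>\<^bsub>G\<^esub>} \<and>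
        x = finsum G f {n. f n \<noteq> \<zero>\<^bsub>G\<^esub>})"

locale graded_ring = cring R for R :: "'r graded_ring" (structure) +
  assumes decomposition: "direct_sum_decomposition R (rcomp R)"
    and mult_comp: "\<lbrakk>a \<in> rcomp R m; b \<in> rcomp R n\<rbrakk> \<Longrightarrow> a \<otimes> b \<in> rcomp R (m + n)"

locale graded_module = graded_ring R + module R M
  for R :: "'r graded_ring" (structure) and M :: "('r, 'm) graded_module" (structure) +
  assumes module_decomposition: "direct_sum_decomposition M (mcomp M)"
    and smult_comp: "\<lbrakk>a \<in> rcomp R m; x \<in> mcomp M n\<rbrakk> \<Longrightarrow> a \<odot>\<^bsub>M\<^esub> x \<in> mcomp M (int m + n)"

definition degree_zero_ring :: "'r graded_ring \<Rightarrow> 'r graded_ring" where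
  "degree_zero_ring R = R\<lparr>carrier := rcomp R 0\<rparr>"

definition standard_graded :: "'r graded_ring \<Rightarrow> bool" where
  "standard_graded R \<longleftrightarrow>
     graded_ring R \<and> generate_ring R (rcomp R 0 \<union> rcomp R 1) = carrier R"

definition finitely_generated_algebra :: "'r graded_ring \<Rightarrow> bool" where
  "finitely_generated_algebra R \<longleftrightarrow>
     (\<exists>S. finite S \<and> S \<subseteq> carrier R \<and> generate_ring R (rcomp R 0 \<union> S) = carrier R)"

definition irrelevant_ideal :: "'r graded_ring \<Rightarrow> 'r set" where
  "irrelevant_ideal R =
     {finsum R f A | f A. finite A \<and> A \<subseteq> {1..} \<and> (\<forall>n\<in>A. f n \<in> rcomp R n)}"

definition submodule_span :: "'r graded_ring \<Rightarrow> ('r, 'm) graded_module \<Rightarrow> 'm set \<Rightarrow> 'm set" where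
  "submodule_span R M S = \<Inter>{N. submodule N R M \<and> S \<subseteq> N}"

definition finitely_generated_module :: "'r graded_ring \<Rightarrow> ('r, 'm) graded_module \<Rightarrow> bool" where
  "finitely_generated_module R M \<longleftrightarrow>
     (\<exists>S. finite S \<and> S \<subseteq> carrier M \<and> submodule_span R M S = carrier M)"

definition ideal_smult :: "'r graded_ring \<Rightarrow> 'r set \<Rightarrow> ('r, 'm) graded_module \<Rightarrow> 'm set" where
  "ideal_smult R I M = submodule_span R M {a \<odot>\<^bsub>M\<^esub> x | a x. a \<in> I \<and> x \<in> carrier M}"

text \<open>The multiplication fields of a module record carry no information.\<close>

definition graded_quotient :: "('r, 'm) graded_module \<Rightarrow> 'm set \<Rightarrow> ('r, 'm set) graded_module" where
  "graded_quotient M N =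
     \<lparr>carrier = a_rcosets\<^bsub>M\<^esub> N, monoid.mult = undefined, one = undefined,
      zero = N, add = set_add M,
      smult = (\<lambda>a Y. \<Union>x\<in>Y. N +>\<^bsub>M\<^esub> (a \<odot>\<^bsub>M\<^esub> x)),
      mcomp = (\<lambda>n. (\<lambda>x. N +>\<^bsub>M\<^esub> x) ` mcomp M n)\<rparr>"

definition graded_restrict :: "('r, 'm) graded_module \<Rightarrow> 'm set \<Rightarrow> ('r, 'm) graded_module" where
  "graded_restrict M N = M\<lparr>carrier := N, mcomp := (\<lambda>n. N \<inter> mcomp M n)\<rparr>"

definition comp_vanishes :: "('r, 'm) graded_module \<Rightarrow> int \<Rightarrow> bool" where
  "comp_vanishes M n \<longleftrightarrow> mcomp M n = {\<zero>\<^bsub>M\<^esub>}"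

definition generator_degrees :: "'r graded_ring \<Rightarrow> ('r, 'm) graded_module \<Rightarrow> int set" where
  "generator_degrees R M =
     {n. \<not> comp_vanishes (graded_quotient M (ideal_smult R (irrelevant_ideal R) M)) n}"

definition max_generator_degree :: "'r graded_ring \<Rightarrow> ('r, 'm) graded_module \<Rightarrow> ereal" where
  "max_generator_degree R M =
     (if generator_degrees R M = {} then -\<infinity>
      else ereal (of_int (Max (generator_degrees R M))))"


section \<open>Graded injective resolutions\<close>

definition graded_hom ::
    "'r graded_ring \<Rightarrow> ('r, 'm) graded_module \<Rightarrow> ('r, 'n) graded_module \<Rightarrow> ('m \<Rightarrow> 'n) set" where
  "graded_hom R M N =
     {h \<in> hom (add_monoid M) (add_monoid N).
        (\<forall>a \<in> carrier R. \<forall>x \<in> carrier M. h (a \<odot>\<^bsub>M\<^esub> x) = a \<odot>\<^bsub>N\<^esub> h x) \<and>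
        (\<forall>n. h ` mcomp M n \<subseteq> mcomp N n)}"

text \<open>
  Injective objects of the category of graded \<open>R\<close>-modules and homomorphisms of degree 0.
  HOL cannot quantify over all carrier types, so the test modules \<open>N\<close>, \<open>P\<close> live in the carrier
  type of \<open>R\<close>. This loses nothing: all shifts of \<open>R\<close> and of its homogeneous ideals occur there,
  so by the graded Baer criterion an \<open>E\<close> satisfying this condition has the extension property
  for graded modules of arbitrary type.
\<close>

definition graded_injective :: "'r graded_ring \<Rightarrow> ('r, 'e) graded_module \<Rightarrow> bool" where
  "graded_injective R E \<longleftrightarrow>
     graded_module R E \<and>
     (\<forall>(N :: ('r, 'r) graded_module) (P :: ('r, 'r) graded_module).
        \<forall>j \<in> graded_hom R N P. \<forall>f \<in> graded_hom R N E.
          graded_module R N \<longrightarrow> graded_module R P \<longrightarrow> inj_on j (carrier N) \<longrightarrow>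
          (\<exists>g \<in> graded_hom R P E. \<forall>x \<in> carrier N. g (j x) = f x))"

text \<open>\<open>0 \<rightarrow> M \<rightarrow> E 0 \<rightarrow> E 1 \<rightarrow> \<dots>\<close> with augmentation \<open>\<epsilon>\<close> and differentials \<open>d i : E i \<rightarrow> E (i + 1)\<close>.\<close>

definition graded_injective_resolution ::
    "'r graded_ring \<Rightarrow> ('r, 'm) graded_module \<Rightarrow> ('m \<Rightarrow> 'e) \<Rightarrow>
     (nat \<Rightarrow> ('r, 'e) graded_module) \<Rightarrow> (nat \<Rightarrow> 'e \<Rightarrow> 'e) \<Rightarrow> bool" where
  "graded_injective_resolution R M \<epsilon> E d \<longleftrightarrow>
     graded_module R M \<and>
     (\<forall>i. graded_injective R (E i)) \<and>
     \<epsilon> \<in> graded_hom R M (E 0) \<and>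
     (\<forall>i. d i \<in> graded_hom R (E i) (E (Suc i))) \<and>
     inj_on \<epsilon> (carrier M) \<and>
     \<epsilon> ` carrier M = a_kernel (E 0) (E 1) (d 0) \<and>
     (\<forall>i. d i ` carrier (E i) = a_kernel (E (Suc i)) (E (Suc (Suc i))) (d (Suc i)))"


section \<open>Local cohomology with respect to the irrelevant ideal\<close>

definition ideal_power :: "'r graded_ring \<Rightarrow> 'r set \<Rightarrow> nat \<Rightarrow> 'r set" where
  "ideal_power R I k = ((ideal_prod R I) ^^ k) (carrier R)"

definition torsion :: "'r graded_ring \<Rightarrow> 'r set \<Rightarrow> ('r, 'm) graded_module \<Rightarrow> 'm set" where
  "torsion R I M =
     {x \<in> carrier M. \<exists>k. \<forall>a \<in> ideal_power R I k. a \<odot>\<^bsub>M\<^esub> x = \<zero>\<^bsub>M\<^esub>}"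

text \<open>
  The right derived functors of the torsion functor \<open>\<Gamma>\<close> for \<open>R\<^sub>+\<close>: if \<open>(E, d)\<close> is a graded injective
  resolution of \<open>M\<close>, then \<open>local_cohomology R E d i\<close> is the \<open>i\<close>-th cohomology module of the complex
  \<open>\<Gamma>(E 0) \<rightarrow> \<Gamma>(E 1) \<rightarrow> \<dots>\<close>, that is, the graded module \<open>H\<^sup>i(M)\<close>. The resolution is an explicit
  argument because its terms need a carrier type of their own.
\<close>

definition cocycles ::
    "'r graded_ring \<Rightarrow> (nat \<Rightarrow> ('r, 'e) graded_module) \<Rightarrow> (nat \<Rightarrow> 'e \<Rightarrow> 'e) \<Rightarrow> nat \<Rightarrow> 'e set" where
  "cocycles R E d i =
     torsion R (irrelevant_ideal R) (E i) \<inter> a_kernel (E i) (E (Suc i)) (d i)"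

fun coboundaries ::
    "'r graded_ring \<Rightarrow> (nat \<Rightarrow> ('r, 'e) graded_module) \<Rightarrow> (nat \<Rightarrow> 'e \<Rightarrow> 'e) \<Rightarrow> nat \<Rightarrow> 'e set" where
  "coboundaries R E d 0 = {\<zero>\<^bsub>E 0\<^esub>}"
| "coboundaries R E d (Suc i) = d i ` torsion R (irrelevant_ideal R) (E i)"

definition local_cohomology ::
    "'r graded_ring \<Rightarrow> (nat \<Rightarrow> ('r, 'e) graded_module) \<Rightarrow> (nat \<Rightarrow> 'e \<Rightarrow> 'e) \<Rightarrow>
     nat \<Rightarrow> ('r, 'e set) graded_module" where
  "local_cohomology R E d i =
     graded_quotient (graded_restrict (E i) (cocycles R E d i)) (coboundaries R E d i)"


section \<open>Regularity\<close>

text \<open>The argument \<open>H\<close> is the family of local cohomology modules of the module in question.\<close>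

definition t_regular :: "(nat \<Rightarrow> ('r, 'h) graded_module) \<Rightarrow> int \<Rightarrow> bool" where
  "t_regular H t \<longleftrightarrow> (\<forall>i. \<forall>n \<ge> t. comp_vanishes (H i) (n - int i + 1))"

definition weakly_t_regular :: "(nat \<Rightarrow> ('r, 'h) graded_module) \<Rightarrow> int \<Rightarrow> bool" where
  "weakly_t_regular H t \<longleftrightarrow> (\<forall>i. comp_vanishes (H i) (t - int i + 1))"

end

theory Submission
  imports Defs
begin

text \<open>
  Choose \<open>x\<^sub>0, \<dots>, x\<^bsub>r-1\<^esub>\<close> of degree 1 generating \<open>R\<^sub>+\<close> and compare the Koszul complexes on these
  elements over the injective resolution \<open>E\<close> of \<open>M\<close> and over its torsion subcomplex \<open>\<Gamma>(E)\<close>.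
  Over \<open>E\<close> the total complex computes the Koszul homology of \<open>M\<close>: it is acyclic in positive
  cohomological degrees, and in degree 0 its cohomology is \<open>M / R\<^sub>+M\<close>, which vanishes above \<open>d(M)\<close>.
  Filter \<open>E\<close> by the elements that are torsion with respect to \<open>x\<^sub>0, \<dots>, x\<^bsub>s-1\<^esub>\<close>. As \<open>R\<close> is Noetherian
  and \<open>E\<close> is injective, \<open>x\<^sub>s\<close> is bijective on the \<open>s\<close>-th quotient, which is therefore invisible to the
  Koszul complex; hence the total complex over \<open>\<Gamma>(E)\<close> is acyclic in the same degrees.
  Build that complex as an iterated cone. If \<open>H\<^sup>p(M)\<close> vanishes in degree \<open>n - p + 1\<close> for
  all \<open>p\<close>, this persists through the cones, and each cone map is injective on the \<open>p\<close>-th cohomology in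
  degree \<open>n - p + 2\<close>; so \<open>H\<^sup>p(M)\<close> vanishes in degree \<open>n - p + 2\<close> too. Induct on \<open>n\<close>.
\<close>

section \<open>Homogeneous components and shifted ideals\<close>

text \<open>A cone pairs position \<open>p\<close>, degree \<open>n\<close> with position
  \<open>p + 1\<close>, degree \<open>n - 1\<close>, so \<open>p + n\<close> is constant: this is
  why regularity is read along antidiagonals and why one antidiagonal yields the next. Cones extend
  towards negative positions only, so \<open>M\<close>, placed in position 0, meets the nonnegative
  positions in its cokernel alone; this is the single entry point of \<open>d(M)\<close>. The
  obstacle is the passage from \<open>E\<close> to its torsion part. Taking one generator at a time
  reduces it to dividing a single element \<open>e\<close> by \<open>x_s\<close>, by an
  \<open>e'\<close> that inherits every annihilator of \<open>e\<close>, since otherwise the torsion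
  conditions already imposed would be lost. Exact division is then too much to ask: if
  \<open>x_s e = 0\<close>, then also \<open>x_s e' = 0\<close>. It is enough to solve
  \<open>x_s^(m+1) e' = x_s^m e\<close>, because the defect \<open>e - x_s e'\<close> is torsion and
  dies in the quotient. Subcomplexes are families of subgroups of one ambient complex; the long
  exact sequences are element chases relative to a smaller family.\<close>

lemma additive_subgroupI':
  assumes "abelian_group G" "N \<subseteq> carrier G" "\<zero>\<^bsub>G\<^esub> \<in> N"
    "\<And>a b. a \<in> N \<Longrightarrow> b \<in> N \<Longrightarrow> a \<oplus>\<^bsub>G\<^esub> b \<in> N" "\<And>a. a \<in> N \<Longrightarrow> \<ominus>\<^bsub>G\<^esub> a \<in> N"
  shows "additive_subgroup N G"
proof -
  interpret abelian_group G by fact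
  show ?thesis using assms by (intro additive_subgroupI add.subgroupI) auto
qed

lemma abelian_group_homI':
  assumes "abelian_group G" "abelian_group H"
    and "\<And>a. a \<in> carrier G \<Longrightarrow> h a \<in> carrier H"
    and "\<And>a b. a \<in> carrier G \<Longrightarrow> b \<in> carrier G \<Longrightarrow> h (a \<oplus>\<^bsub>G\<^esub> b) = h a \<oplus>\<^bsub>H\<^esub> h b"
  shows "abelian_group_hom G H h"
  using assms
  by (intro abelian_group_homI group_hom.intro group_hom_axioms.intro abelian_group.a_group)
    (auto simp: hom_def)

lemma (in cring) ideal_of_closed:
  assumes "I \<subseteq> carrier R" "\<zero> \<in> I" "\<And>a b. a \<in> I \<Longrightarrow> b \<in> I \<Longrightarrow> a \<oplus> b \<in> I"
    and mult: "\<And>a c. a \<in> I \<Longrightarrow> c \<in> carrier R \<Longrightarrow> c \<otimes> a \<in> I"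
  shows "ideal I R"
proof (rule idealI)
  show "subgroup I (add_monoid R)"
  proof (rule add.subgroupI)
    fix a assume a: "a \<in> I"
    then have "\<ominus> a = (\<ominus> \<one>) \<otimes> a" using assms(1) by (auto simp: l_minus)
    then show "\<ominus> a \<in> I" using mult[OF a, of "\<ominus> \<one>"] by simp
  qed (use assms in auto)
  fix a c assume "a \<in> I" "c \<in> carrier R"
  then show "c \<otimes> a \<in> I" "a \<otimes> c \<in> I" using mult assms(1) m_comm[of a c] by auto
qed (rule ring_axioms)

lemma (in module) submoduleI':
  assumes "H \<subseteq> carrier M" "\<zero>\<^bsub>M\<^esub> \<in> H"
    and "\<And>a b. a \<in> H \<Longrightarrow> b \<in> H \<Longrightarrow> a \<oplus>\<^bsub>M\<^esub> b \<in> H"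
    and "\<And>a y. a \<in> carrier R \<Longrightarrow> y \<in> H \<Longrightarrow> a \<odot>\<^bsub>M\<^esub> y \<in> H"
  shows "submodule H R M"
proof (rule submoduleI)
  fix a assume a: "a \<in> H"
  then have "\<ominus>\<^bsub>M\<^esub> a = (\<ominus> \<one>) \<odot>\<^bsub>M\<^esub> a" using assms(1) by (auto simp: smult_l_minus)
  then show "\<ominus>\<^bsub>M\<^esub> a \<in> H" using assms(4)[of "\<ominus> \<one>" a] a by simp
qed (use assms in auto)

text \<open>The index type is arbitrary so that one theory of components serves the ring, graded by
  \<open>nat\<close>, and the modules, graded by \<open>int\<close>.\<close>

definition hcomp :: "('a, 'b) ring_scheme \<Rightarrow> ('i \<Rightarrow> 'a set) \<Rightarrow> 'i \<Rightarrow> 'a \<Rightarrow> 'a" where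
  "hcomp G C n x =
     (THE f. (\<forall>n. f n \<in> C n) \<and> finite {n. f n \<noteq> \<zero>\<^bsub>G\<^esub>} \<and> x = finsum G f {n. f n \<noteq> \<zero>\<^bsub>G\<^esub>}) n"

locale graded_group = abelian_group G for G :: "('a, 'b) ring_scheme" (structure) +
  fixes C :: "'i \<Rightarrow> 'a set"
  assumes decomp: "direct_sum_decomposition G C"
begin

lemma comp_subgroup: "additive_subgroup (C n) G"
  using decomp by (auto simp: direct_sum_decomposition_def)

lemma comp_carrier: "x \<in> C n \<Longrightarrow> x \<in> carrier G"
  using additive_subgroup.a_subset[OF comp_subgroup] by blast

lemma comp_zero: "\<zero> \<in> C n"
  using additive_subgroup.zero_closed[OF comp_subgroup] .

lemma comp_add: "x \<in> C n \<Longrightarrow> y \<in> C n \<Longrightarrow> x \<oplus> y \<in> C n"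
  using additive_subgroup.a_closed[OF comp_subgroup] .

lemma comp_minus: "x \<in> C n \<Longrightarrow> \<ominus> x \<in> C n"
  using additive_subgroup.a_inv_closed[OF comp_subgroup] .

lemma hcomp_ex1:
  "x \<in> carrier G \<Longrightarrow> \<exists>!f. (\<forall>n. f n \<in> C n) \<and> finite {n. f n \<noteq> \<zero>} \<and> x = finsum G f {n. f n \<noteq> \<zero>}"
  using decomp by (auto simp: direct_sum_decomposition_def)

lemma
  assumes "x \<in> carrier G"
  shows hcomp_in: "hcomp G C n x \<in> C n"
    and hcomp_finite: "finite {n. hcomp G C n x \<noteq> \<zero>}"
    and hcomp_finsum: "x = finsum G (\<lambda>n. hcomp G C n x) {n. hcomp G C n x \<noteq> \<zero>}"
  using theI'[OF hcomp_ex1[OF assms]] by (auto simp: hcomp_def)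

lemma hcomp_carrier: "x \<in> carrier G \<Longrightarrow> hcomp G C n x \<in> carrier G"
  using hcomp_in comp_carrier by blast

lemma hcomp_unique:
  assumes f: "\<And>n. f n \<in> C n" "finite {n. f n \<noteq> \<zero>}" and x: "x = finsum G f {n. f n \<noteq> \<zero>}"
  shows "hcomp G C n x = f n"
proof -
  have c: "x \<in> carrier G"
    unfolding x by (rule finsum_closed) (use f comp_carrier in auto)
  show ?thesis
    unfolding hcomp_def using the1_equality[OF hcomp_ex1[OF c], of f] assms by auto
qed

text \<open>Any finite index set containing the support will do, which saves computing supports
  exactly.\<close>

lemma hcomp_unique':
  assumes f: "\<And>n. f n \<in> C n" and A: "finite A" "\<And>n. n \<notin> A \<Longrightarrow> f n = \<zero>" and x: "x = finsum G f A"
  shows "hcomp G C n x = f n"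
proof (rule hcomp_unique)
  have sub: "{n. f n \<noteq> \<zero>} \<subseteq> A" using A by auto
  then show "finite {n. f n \<noteq> \<zero>}" using A finite_subset by blast
  show "x = finsum G f {n. f n \<noteq> \<zero>}"
    unfolding x by (rule add.finprod_mono_neutral_cong_right) (use A sub f comp_carrier in blast)+
qed (use f in auto)

lemma hcomp_homogeneous:
  assumes "x \<in> C m"
  shows "hcomp G C n x = (if n = m then x else \<zero>)"
proof (rule hcomp_unique'[where A = "{m}"])
  show "x = finsum G (\<lambda>n. if n = m then x else \<zero>) {m}"
    using comp_carrier[OF assms] by (subst finsum_insert) auto
qed (use assms comp_zero in auto)

lemma hcomp_add:
  assumes x: "x \<in> carrier G" and y: "y \<in> carrier G"
  shows "hcomp G C n (x \<oplus> y) = hcomp G C n x \<oplus> hcomp G C n y"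
proof -
  let ?A = "{n. hcomp G C n x \<noteq> \<zero>} \<union> {n. hcomp G C n y \<noteq> \<zero>}"
  have fin: "finite ?A" using hcomp_finite x y by auto
  have ext: "z = finsum G (\<lambda>n. hcomp G C n z) ?A" if "z \<in> {x, y}" for z
    using that x y
    by (subst hcomp_finsum, blast, intro add.finprod_mono_neutral_cong_left)
      (use fin hcomp_carrier in auto)
  show ?thesis
  proof (rule hcomp_unique'[where A = ?A])
    show "x \<oplus> y = (\<Oplus>n\<in>?A. hcomp G C n x \<oplus> hcomp G C n y)"
      using ext[of x] ext[of y] hcomp_carrier x y by (subst finsum_addf) auto
  qed (use fin x y hcomp_in comp_add in auto)
qed

text \<open>An element is the finite sum of its components, so claims stable under addition reduce
  to homogeneous elements.\<close>

lemma homogeneous_induct [consumes 1, case_names zero homogeneous add]: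
  assumes x: "x \<in> carrier G"
    and zero: "P \<zero>"
    and hom: "\<And>n y. y \<in> C n \<Longrightarrow> P y"
    and add: "\<And>y z. \<lbrakk>y \<in> carrier G; z \<in> carrier G; P y; P z\<rbrakk> \<Longrightarrow> P (y \<oplus> z)"
  shows "P x"
proof -
  have "P (finsum G (\<lambda>n. hcomp G C n x) A)" if "finite A" for A
    using that
  proof induction
    case empty
    then show ?case using zero by simp
  next
    case (insert a A)
    then show ?case
      using hom[OF hcomp_in[OF x]] hcomp_carrier[OF x] add by (subst finsum_insert) auto
  qed
  then show ?thesis using hcomp_finsum[OF x] hcomp_finite[OF x] by metis
qed

lemma hcomp_zero: "hcomp G C n \<zero> = \<zero>"
  using hcomp_homogeneous[OF comp_zero, of n n] by simp

end

text \<open>The reindexing \<open>\<sigma>\<close> covers maps that shift degrees or pass from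
  \<open>nat\<close> to \<open>int\<close> degrees, such as multiplication by a homogeneous ring
  element and the orbit map of a homogeneous module element. Injectivity of \<open>\<sigma>\<close>
  keeps different components from being merged.\<close>

lemma hcomp_hom:
  assumes G: "graded_group G C" and H: "graded_group H D"
    and h: "h \<in> hom (add_monoid G) (add_monoid H)"
    and deg: "\<And>n. h ` C n \<subseteq> D (\<sigma> n)" and \<sigma>: "inj \<sigma>"
    and x: "x \<in> carrier G"
  shows "hcomp H D (\<sigma> n) (h x) = h (hcomp G C n x)"
proof -
  interpret G: graded_group G C by fact
  interpret H: graded_group H D by fact
  interpret abelian_group_hom G H h
    by (intro abelian_group_homI group_hom.intro group_hom_axioms.intro G.a_group H.a_group
        G.abelian_group_axioms H.abelian_group_axioms h)
  show ?thesis
    using x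
  proof (induction rule: G.homogeneous_induct)
    case zero
    then show ?case by (simp add: G.hcomp_zero H.hcomp_zero)
  next
    case (homogeneous m y)
    then have "h y \<in> D (\<sigma> m)" using deg by blast
    then show ?case
      using homogeneous \<sigma> by (simp add: H.hcomp_homogeneous G.hcomp_homogeneous inj_eq)
  next
    case (add y z)
    then show ?case by (simp add: G.hcomp_add H.hcomp_add G.hcomp_carrier)
  qed
qed

text \<open>Complements \<open>hcomp_hom\<close> outside the range of \<open>\<sigma>\<close>: with
  \<open>nat\<close> degrees, multiplication by an element of degree \<open>m\<close> never reaches
  a degree below \<open>m\<close>.\<close>

lemma hcomp_hom_zero:
  assumes G: "graded_group G C" and H: "graded_group H D"
    and h: "h \<in> hom (add_monoid G) (add_monoid H)"
    and deg: "\<And>n. h ` C n \<subseteq> D (\<sigma> n)" and \<sigma>: "m \<notin> range \<sigma>"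
    and x: "x \<in> carrier G"
  shows "hcomp H D m (h x) = \<zero>\<^bsub>H\<^esub>"
proof -
  interpret G: graded_group G C by fact
  interpret H: graded_group H D by fact
  interpret abelian_group_hom G H h
    by (intro abelian_group_homI group_hom.intro group_hom_axioms.intro G.a_group H.a_group
        G.abelian_group_axioms H.abelian_group_axioms h)
  show ?thesis
    using x
  proof (induction rule: G.homogeneous_induct)
    case zero
    then show ?case by (simp add: H.hcomp_zero)
  next
    case (homogeneous k y)
    then have "h y \<in> D (\<sigma> k)" using deg by blast
    then show ?case
      using homogeneous \<sigma> by (auto simp: H.hcomp_homogeneous)
  next
    case (add y z)
    then show ?case by (simp add: H.hcomp_add)
  qed
qed

sublocale graded_ring \<subseteq> rg: graded_group R "rcomp R"
  by unfold_locales (rule decomposition)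

sublocale graded_module \<subseteq> mg: graded_group M "mcomp M"
  by unfold_locales (rule module_decomposition)

text \<open>The ideal placed so that its degree 0 part sits in degree \<open>k\<close>, usually
  written I(-k). It lives in the carrier type of \<open>R\<close> and is thus an admissible test
  object in \<open>graded_injective\<close>; the proof tests injectivity on no others.\<close>

definition shifted_ideal :: "'r graded_ring \<Rightarrow> 'r set \<Rightarrow> int \<Rightarrow> ('r, 'r) graded_module" where
  "shifted_ideal R I k =
     \<lparr>carrier = I, monoid.mult = undefined, one = undefined, zero = \<zero>\<^bsub>R\<^esub>, add = add R,
      smult = monoid.mult R,
      mcomp = (\<lambda>l. if k \<le> l then I \<inter> rcomp R (nat (l - k)) else {\<zero>\<^bsub>R\<^esub>})\<rparr>"

context graded_ring begin

lemma abelian_group_ideal: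
  assumes "ideal I R"
  shows "abelian_group (shifted_ideal R I k)"
proof -
  interpret ideal I R by fact
  show ?thesis
  proof (rule abelian_groupI)
    fix x assume "x \<in> carrier (shifted_ideal R I k)"
    then show "\<exists>y\<in>carrier (shifted_ideal R I k). y \<oplus>\<^bsub>shifted_ideal R I k\<^esub> x = \<zero>\<^bsub>shifted_ideal R I k\<^esub>"
      by (intro bexI[of _ "\<ominus> x"]) (auto simp: shifted_ideal_def a_Hcarr l_neg)
  qed (auto simp: shifted_ideal_def a_assoc a_Hcarr intro: a_comm)
qed

lemma minus_shifted_ideal:
  assumes I: "ideal I R" and a: "a \<in> I"
  shows "\<ominus>\<^bsub>shifted_ideal R I k\<^esub> a = \<ominus> a"
proof -
  interpret ideal I R by fact
  interpret S: abelian_group "shifted_ideal R I k" by (rule abelian_group_ideal[OF I])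
  show ?thesis
    by (rule S.minus_equality) (use a in \<open>auto simp: shifted_ideal_def a_Hcarr l_neg\<close>)
qed

text \<open>\<open>finsum\<close> depends on the carrier, so shrinking it from \<open>R\<close> to
  \<open>I\<close> calls for a transfer although the addition is the same.\<close>

lemma finsum_shifted_ideal:
  assumes I: "ideal I R" and f: "f \<in> A \<rightarrow> I"
  shows "finsum (shifted_ideal R I k) f A = finsum R f A"
proof -
  interpret ideal I R by fact
  interpret S: abelian_group "shifted_ideal R I k" by (rule abelian_group_ideal[OF I])
  have z: "\<zero>\<^bsub>shifted_ideal R I k\<^esub> = \<zero>" by (simp add: shifted_ideal_def)
  show ?thesis
  proof (cases "finite A")
    case True
    then show ?thesis using f
    proof induction
      case empty
      then show ?case using z by simp
    next
      case (insert a A)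
      then have "f \<in> A \<rightarrow> I" "f a \<in> I" by auto
      with insert have "finsum (shifted_ideal R I k) f (insert a A)
          = f a \<oplus>\<^bsub>shifted_ideal R I k\<^esub> finsum (shifted_ideal R I k) f A"
        by (intro S.finsum_insert) (auto simp: shifted_ideal_def)
      also have "\<dots> = f a \<oplus> finsum R f A" using insert by (simp add: shifted_ideal_def)
      also have "\<dots> = finsum R f (insert a A)"
        using insert a_Hcarr by (intro finsum_insert[symmetric]) (auto simp: Pi_iff)
      finally show ?case .
    qed
  next
    case False
    then show ?thesis using z by (simp add: finsum_infinite S.finsum_infinite)
  qed
qed

text \<open>A homogeneous ideal inherits the decomposition of \<open>R\<close>, with degree
  \<open>n\<close> of \<open>R\<close> matched to degree \<open>n + k\<close>; below
  \<open>k\<close> there is only zero.\<close>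

lemma graded_module_shifted_ideal:
  assumes I: "ideal I R" and hI: "\<And>a n. a \<in> I \<Longrightarrow> hcomp R (rcomp R) n a \<in> I"
  shows "graded_module R (shifted_ideal R I k)"
proof -
  interpret ideal I R by fact
  let ?S = "shifted_ideal R I k"
  interpret S: abelian_group ?S by (rule abelian_group_ideal[OF I])
  have carr: "carrier ?S = I" "\<zero>\<^bsub>?S\<^esub> = \<zero>" "add ?S = add R" "smult ?S = monoid.mult R"
    by (simp_all add: shifted_ideal_def)
  have C1: "mcomp ?S l = I \<inter> rcomp R (nat (l - k))" if "k \<le> l" for l
    using that by (simp add: shifted_ideal_def)
  have C2: "mcomp ?S l = {\<zero>}" if "\<not> k \<le> l" for l
    using that by (simp add: shifted_ideal_def)
  have sub: "additive_subgroup (mcomp ?S l) ?S" for l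
  proof (rule additive_subgroupI, rule S.add.subgroupI)
    show "mcomp ?S l \<subseteq> carrier ?S" using C1[of l] C2[of l] carr by (cases "k \<le> l") auto
    have "\<zero> \<in> mcomp ?S l" using C1[of l] C2[of l] rg.comp_zero by (cases "k \<le> l") auto
    then show "mcomp ?S l \<noteq> {}" by auto
    show "\<ominus>\<^bsub>?S\<^esub> a \<in> mcomp ?S l" if "a \<in> mcomp ?S l" for a
    proof -
      have "a \<in> I" using that C1 C2 by (cases "k \<le> l") auto
      then have "\<ominus>\<^bsub>?S\<^esub> a = \<ominus> a" by (rule minus_shifted_ideal[OF I])
      then show ?thesis using that C1 C2 rg.comp_minus by (cases "k \<le> l") auto
    qed
    show "a \<oplus>\<^bsub>?S\<^esub> b \<in> mcomp ?S l" if "a \<in> mcomp ?S l" "b \<in> mcomp ?S l" for a b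
      using that C1[of l] C2[of l] rg.comp_add carr(3) by (cases "k \<le> l") auto
  qed
  have decomp: "direct_sum_decomposition ?S (mcomp ?S)"
    unfolding direct_sum_decomposition_def carr
  proof (intro conjI allI ballI sub)
    fix x assume x: "x \<in> I"
    then have xR: "x \<in> carrier R" by (rule a_Hcarr)
    let ?h = "\<lambda>n. hcomp R (rcomp R) n x"
    let ?f = "\<lambda>l. if k \<le> l then ?h (nat (l - k)) else \<zero>"
    have supp: "{l. ?f l \<noteq> \<zero>} = (\<lambda>n. int n + k) ` {n. ?h n \<noteq> \<zero>}"
    proof (intro subset_antisym subsetI)
      fix l assume "l \<in> {l. ?f l \<noteq> \<zero>}"
      then show "l \<in> (\<lambda>n. int n + k) ` {n. ?h n \<noteq> \<zero>}"
        by (intro image_eqI[of _ _ "nat (l - k)"]) (auto split: if_splits)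
    qed auto
    show "\<exists>!f. (\<forall>n. f n \<in> mcomp ?S n) \<and> finite {n. f n \<noteq> \<zero>} \<and> x = finsum ?S f {n. f n \<noteq> \<zero>}"
    proof (rule ex1I[of _ ?f], intro conjI allI)
      show "?f l \<in> mcomp ?S l" for l
        using C1 C2 hI[OF x] rg.hcomp_in[OF xR] by auto
      show "finite {l. ?f l \<noteq> \<zero>}" unfolding supp using rg.hcomp_finite[OF xR] by auto
      have "finsum ?S ?f {l. ?f l \<noteq> \<zero>} = finsum R ?f {l. ?f l \<noteq> \<zero>}"
        by (rule finsum_shifted_ideal[OF I]) (use hI[OF x] in auto)
      also have "\<dots> = finsum R (\<lambda>n. ?f (int n + k)) {n. ?h n \<noteq> \<zero>}"
        unfolding supp by (rule finsum_reindex) (use rg.hcomp_carrier[OF xR] in \<open>auto simp: inj_on_def\<close>)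
      also have "\<dots> = x" using rg.hcomp_finsum[OF xR] by simp
      finally show "x = finsum ?S ?f {l. ?f l \<noteq> \<zero>}" by simp
    next
      \<comment> \<open>Uniqueness is imported from \<open>R\<close>: reindexing a second
        decomposition by \<open>n + k\<close> gives a decomposition of \<open>x\<close> over
        \<open>R\<close>.\<close>
      fix f assume f: "(\<forall>n. f n \<in> mcomp ?S n) \<and> finite {n. f n \<noteq> \<zero>} \<and> x = finsum ?S f {n. f n \<noteq> \<zero>}"
      have f0: "f l = \<zero>" if "\<not> k \<le> l" for l using f C2[OF that] by auto
      have f1: "f l \<in> I \<inter> rcomp R (nat (l - k))" if "k \<le> l" for l using f C1[OF that] by auto
      have fI: "f l \<in> I" for l using f0[of l] f1[of l] by (cases "k \<le> l") auto
      let ?g = "\<lambda>n. f (int n + k)"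
      have suppf: "{l. f l \<noteq> \<zero>} = (\<lambda>n. int n + k) ` {n. ?g n \<noteq> \<zero>}"
      proof (intro subset_antisym subsetI)
        fix l assume "l \<in> {l. f l \<noteq> \<zero>}"
        then show "l \<in> (\<lambda>n. int n + k) ` {n. ?g n \<noteq> \<zero>}"
          using f0[of l] by (intro image_eqI[of _ _ "nat (l - k)"]) (cases "k \<le> l"; auto)+
      qed auto
      have "finsum ?S f {l. f l \<noteq> \<zero>} = finsum R f {l. f l \<noteq> \<zero>}"
        by (rule finsum_shifted_ideal[OF I]) (use fI in auto)
      also have "\<dots> = finsum R ?g {n. ?g n \<noteq> \<zero>}"
        unfolding suppf by (rule finsum_reindex) (use fI a_Hcarr in \<open>auto simp: inj_on_def\<close>)
      finally have xg: "x = finsum R ?g {n. ?g n \<noteq> \<zero>}" using f by simp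
      have "finite ((\<lambda>n. int n + k) ` {n. ?g n \<noteq> \<zero>})" using f suppf by simp
      then have "finite {n. ?g n \<noteq> \<zero>}" by (rule finite_imageD) (auto simp: inj_on_def)
      then have hg: "?h n = ?g n" for n
        by (intro rg.hcomp_unique xg) (use f1[of "int n + k" for n] in auto)
      show "f = ?f"
      proof
        fix l show "f l = ?f l" using f0[of l] hg[of "nat (l - k)"] by auto
      qed
    qed
  qed
  show ?thesis
  proof (intro graded_module.intro graded_module_axioms.intro decomp graded_ring_axioms
      moduleI cring_axioms S.abelian_group_axioms)
    fix a m x n assume a: "a \<in> rcomp R m" and x: "x \<in> mcomp ?S n"
    then have aR: "a \<in> carrier R" using rg.comp_carrier by blast
    show "a \<odot>\<^bsub>?S\<^esub> x \<in> mcomp ?S (int m + n)"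
    proof (cases "k \<le> n")
      case True
      then have "nat (int m + n - k) = m + nat (n - k)" by simp
      then show ?thesis
        using True x C1[of n] C1[of "int m + n"] mult_comp[OF a] I_l_closed[OF _ aR] by (simp add: carr)
    next
      case False
      then have "a \<odot>\<^bsub>?S\<^esub> x = \<zero>" using x C2 aR by (simp add: carr)
      then show ?thesis
        using C1[of "int m + n"] C2[of "int m + n"] rg.comp_zero by (cases "k \<le> int m + n") auto
    qed
  qed (auto simp: carr I_l_closed a_Hcarr l_distr r_distr m_assoc)
qed

end

section \<open>Hilbert basis theorem for ascending chains\<close>

text \<open>Ideals relative to a subset \<open>A\<close>, with the operations of the ambient
  \<open>R\<close>: the subring can grow while the record stays fixed. Closure under negatives comes
  from -1 in \<open>A\<close> when \<open>A\<close> is a subring.\<close>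

definition ideal_in :: "('a, 'b) ring_scheme \<Rightarrow> 'a set \<Rightarrow> 'a set \<Rightarrow> bool" where
  "ideal_in R A I \<longleftrightarrow> I \<subseteq> A \<and> \<zero>\<^bsub>R\<^esub> \<in> I \<and> (\<forall>x\<in>I. \<forall>y\<in>I. x \<oplus>\<^bsub>R\<^esub> y \<in> I) \<and> (\<forall>a\<in>A. \<forall>x\<in>I. a \<otimes>\<^bsub>R\<^esub> x \<in> I)"

definition ideal_acc :: "('a, 'b) ring_scheme \<Rightarrow> 'a set \<Rightarrow> bool" where
  "ideal_acc R A \<longleftrightarrow> (\<forall>f. (\<forall>n. ideal_in R A (f n)) \<longrightarrow> (\<forall>n. f n \<subseteq> f (Suc n)) \<longrightarrow> (\<exists>N. \<forall>n\<ge>N. f n = f N))"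

text \<open>Representations need not be unique: \<open>A[x]\<close> is the subring generated by \<open>A\<close> and \<open>x\<close>, not a
  polynomial ring. The leading coefficient argument only ever needs some representation.\<close>

fun polys_below :: "('a, 'b) ring_scheme \<Rightarrow> 'a set \<Rightarrow> 'a \<Rightarrow> nat \<Rightarrow> 'a set" where
  "polys_below R A x 0 = {\<zero>\<^bsub>R\<^esub>}"
| "polys_below R A x (Suc n) = {(a \<otimes>\<^bsub>R\<^esub> (x [^]\<^bsub>R\<^esub> n)) \<oplus>\<^bsub>R\<^esub> g | a g. a \<in> A \<and> g \<in> polys_below R A x n}"

declare polys_below.simps(2) [simp del]

lemma polys_SucI:
  "a \<in> A \<Longrightarrow> g \<in> polys_below R A x n \<Longrightarrow> f = a \<otimes>\<^bsub>R\<^esub> (x [^]\<^bsub>R\<^esub> n) \<oplus>\<^bsub>R\<^esub> g \<Longrightarrow> f \<in> polys_below R A x (Suc n)"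
  by (auto simp: polys_below.simps)

lemma polys_SucE:
  assumes "f \<in> polys_below R A x (Suc n)"
  obtains a g where "a \<in> A" "g \<in> polys_below R A x n" "f = a \<otimes>\<^bsub>R\<^esub> (x [^]\<^bsub>R\<^esub> n) \<oplus>\<^bsub>R\<^esub> g"
  using assms by (auto simp: polys_below.simps)

lemma ideal_accD:
  assumes "ideal_acc R A" "\<And>n. ideal_in R A (f n)" "\<And>n. f n \<subseteq> f (Suc n)"
  shows "\<exists>N. \<forall>n\<ge>N. f n = f N"
  using assms unfolding ideal_acc_def by blast

lemma ideal_inD:
  assumes "ideal_in R A I"
  shows "x \<in> I \<Longrightarrow> x \<in> A" "\<zero>\<^bsub>R\<^esub> \<in> I" "x \<in> I \<Longrightarrow> y \<in> I \<Longrightarrow> x \<oplus>\<^bsub>R\<^esub> y \<in> I"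
    "a \<in> A \<Longrightarrow> x \<in> I \<Longrightarrow> a \<otimes>\<^bsub>R\<^esub> x \<in> I"
  using assms by (auto simp: ideal_in_def)

context cring begin

context
  fixes A x assumes A: "subring A R" and x: "x \<in> carrier R"
begin

lemma subring_carr: "a \<in> A \<Longrightarrow> a \<in> carrier R"
  using subringE(1)[OF A] by blast

lemma polys_carrier: "g \<in> polys_below R A x n \<Longrightarrow> g \<in> carrier R"
  by (induction n arbitrary: g) (auto simp: subring_carr x elim!: polys_SucE)

lemma polys_zero: "\<zero> \<in> polys_below R A x n"
proof (induction n)
  case (Suc n)
  have "\<zero> = \<zero> \<otimes> x [^] n \<oplus> \<zero>" using x by simp
  then show ?case using Suc subringE(2)[OF A] by (blast intro: polys_SucI)
qed simp

lemma polys_add: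
  "g \<in> polys_below R A x n \<Longrightarrow> h \<in> polys_below R A x n \<Longrightarrow> g \<oplus> h \<in> polys_below R A x n"
proof (induction n arbitrary: g h)
  case 0
  then show ?case by simp
next
  case (Suc n)
  then obtain a g' b h' where gh: "a \<in> A" "g' \<in> polys_below R A x n" "g = a \<otimes> x [^] n \<oplus> g'"
      "b \<in> A" "h' \<in> polys_below R A x n" "h = b \<otimes> x [^] n \<oplus> h'"
    by (elim polys_SucE)
  then have "g \<oplus> h = (a \<oplus> b) \<otimes> x [^] n \<oplus> (g' \<oplus> h')"
    using x subring_carr polys_carrier by (simp add: l_distr a_ac)
  then show ?case using Suc.IH gh subringE(7)[OF A] by (blast intro: polys_SucI)
qed

lemma polys_smult:
  "a \<in> A \<Longrightarrow> g \<in> polys_below R A x n \<Longrightarrow> a \<otimes> g \<in> polys_below R A x n"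
proof (induction n arbitrary: g)
  case 0
  then show ?case using subring_carr by simp
next
  case (Suc n)
  then obtain b g' where g: "b \<in> A" "g' \<in> polys_below R A x n" "g = b \<otimes> x [^] n \<oplus> g'"
    by (elim polys_SucE)
  then have "a \<otimes> g = (a \<otimes> b) \<otimes> x [^] n \<oplus> (a \<otimes> g')"
    using x subring_carr polys_carrier Suc.prems by (simp add: r_distr m_assoc)
  then show ?case using Suc g subringE(6)[OF A] by (blast intro: polys_SucI)
qed

lemma polys_Suc: "g \<in> polys_below R A x n \<Longrightarrow> g \<in> polys_below R A x (Suc n)"
proof -
  assume g: "g \<in> polys_below R A x n"
  then have "g = \<zero> \<otimes> x [^] n \<oplus> g" using x polys_carrier by simp
  then show ?thesis using g subringE(2)[OF A] by (blast intro: polys_SucI)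
qed

lemma polys_mono: "m \<le> n \<Longrightarrow> polys_below R A x m \<subseteq> polys_below R A x n"
  by (rule lift_Suc_mono_le[of "polys_below R A x"]) (use polys_Suc in blast)+

lemma polys_x: "g \<in> polys_below R A x n \<Longrightarrow> x \<otimes> g \<in> polys_below R A x (Suc n)"
proof (induction n arbitrary: g)
  case 0
  then show ?case using x polys_zero[of "Suc 0"] by simp
next
  case (Suc n)
  then obtain b g' where g: "b \<in> A" "g' \<in> polys_below R A x n" "g = b \<otimes> x [^] n \<oplus> g'"
    by (elim polys_SucE)
  then have "x \<otimes> g = b \<otimes> x [^] (Suc n) \<oplus> x \<otimes> g'"
    using x subring_carr polys_carrier by (simp add: r_distr m_assoc m_lcomm m_comm)
  then show ?case using Suc.IH[OF g(2)] g(1) by (blast intro: polys_SucI)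
qed

lemma polys_x_pow: "g \<in> polys_below R A x n \<Longrightarrow> x [^] k \<otimes> g \<in> polys_below R A x (k + n)"
proof (induction k)
  case 0
  then show ?case using polys_carrier by simp
next
  case (Suc k)
  have "x [^] Suc k \<otimes> g = x \<otimes> (x [^] k \<otimes> g)"
    using x polys_carrier[OF Suc.prems] by (simp add: m_assoc m_lcomm)
  then show ?case using polys_x Suc by simp
qed

lemma polys_mult:
  "g \<in> polys_below R A x m \<Longrightarrow> h \<in> polys_below R A x n \<Longrightarrow> g \<otimes> h \<in> polys_below R A x (m + n)"
proof (induction m arbitrary: g)
  case 0
  then show ?case using polys_carrier polys_zero by simp
next
  case (Suc m)
  then obtain b g' where g: "b \<in> A" "g' \<in> polys_below R A x m" "g = b \<otimes> x [^] m \<oplus> g'"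
    by (elim polys_SucE)
  then have "g \<otimes> h = b \<otimes> (x [^] m \<otimes> h) \<oplus> g' \<otimes> h"
    using x subring_carr polys_carrier Suc.prems by (simp add: l_distr m_assoc)
  moreover have "b \<otimes> (x [^] m \<otimes> h) \<oplus> g' \<otimes> h \<in> polys_below R A x (m + n)"
    using g Suc polys_x_pow polys_smult polys_add by blast
  ultimately show ?case using polys_Suc by simp
qed

lemma polys_base: "A \<subseteq> polys_below R A x (Suc 0)"
proof
  fix a assume "a \<in> A"
  then show "a \<in> polys_below R A x (Suc 0)"
    using subring_carr by (intro polys_SucI[of a _ \<zero>]) auto
qed

lemma minus_one_smult: "g \<in> carrier R \<Longrightarrow> \<ominus> g = (\<ominus> \<one>) \<otimes> g"
  by (simp add: l_minus)

lemma subring_Union_polys: "subring (\<Union>n. polys_below R A x n) R"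
proof (rule subringI)
  show "(\<Union>n. polys_below R A x n) \<subseteq> carrier R" using polys_carrier by auto
  show "\<one> \<in> (\<Union>n. polys_below R A x n)" using polys_base subringE(3)[OF A] by blast
next
  fix h assume "h \<in> (\<Union>n. polys_below R A x n)"
  then obtain n where h: "h \<in> polys_below R A x n" by blast
  have "\<ominus> \<one> \<in> A" using subringE(3,5)[OF A] by blast
  then show "\<ominus> h \<in> (\<Union>n. polys_below R A x n)"
    using polys_smult h minus_one_smult[OF polys_carrier[OF h]] by auto
next
  fix h1 h2 assume "h1 \<in> (\<Union>n. polys_below R A x n)" "h2 \<in> (\<Union>n. polys_below R A x n)"
  then obtain m n where h: "h1 \<in> polys_below R A x m" "h2 \<in> polys_below R A x n" by blast
  then show "h1 \<otimes> h2 \<in> (\<Union>n. polys_below R A x n)" using polys_mult by blast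
  have "h1 \<in> polys_below R A x (max m n)" "h2 \<in> polys_below R A x (max m n)"
    using h polys_mono[of m "max m n"] polys_mono[of n "max m n"] by auto
  then show "h1 \<oplus> h2 \<in> (\<Union>n. polys_below R A x n)" using polys_add by blast
qed

lemma Union_polys_contains: "insert x A \<subseteq> (\<Union>n. polys_below R A x n)"
proof -
  have "\<one> \<in> polys_below R A x (Suc 0)" using polys_base subringE(3)[OF A] by blast
  from polys_x[OF this] have "x \<in> polys_below R A x (Suc (Suc 0))" using x by simp
  then show ?thesis using polys_base by blast
qed

text \<open>Elements have no well-defined degree, so the top coefficient of every admissible
  representation counts, zero included.\<close>

definition lead_coeffs :: "'a set \<Rightarrow> nat \<Rightarrow> 'a set" where
  "lead_coeffs I n = {a \<in> A. \<exists>g \<in> polys_below R A x n. a \<otimes> x [^] n \<oplus> g \<in> I}"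

lemma lead_coeffs_ideal:
  assumes I: "ideal_in R (\<Union>n. polys_below R A x n) I"
  shows "ideal_in R A (lead_coeffs I n)"
  unfolding ideal_in_def
proof (intro conjI ballI)
  show "lead_coeffs I n \<subseteq> A" by (auto simp: lead_coeffs_def)
  have "\<zero> \<otimes> x [^] n \<oplus> \<zero> \<in> I" using x ideal_inD(2)[OF I] by simp
  then show "\<zero> \<in> lead_coeffs I n"
    using polys_zero subringE(2)[OF A] by (auto simp: lead_coeffs_def)
next
  fix a b assume "a \<in> lead_coeffs I n" "b \<in> lead_coeffs I n"
  then obtain g h where gh: "a \<in> A" "b \<in> A" "g \<in> polys_below R A x n" "h \<in> polys_below R A x n"
      "a \<otimes> x [^] n \<oplus> g \<in> I" "b \<otimes> x [^] n \<oplus> h \<in> I"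
    by (auto simp: lead_coeffs_def)
  have "(a \<oplus> b) \<otimes> x [^] n \<oplus> (g \<oplus> h) = (a \<otimes> x [^] n \<oplus> g) \<oplus> (b \<otimes> x [^] n \<oplus> h)"
    using gh x subring_carr polys_carrier by (simp add: l_distr a_ac)
  then have "(a \<oplus> b) \<otimes> x [^] n \<oplus> (g \<oplus> h) \<in> I" using ideal_inD(3)[OF I] gh by simp
  then show "a \<oplus> b \<in> lead_coeffs I n"
    using gh polys_add subringE(7)[OF A] by (auto simp: lead_coeffs_def)
next
  fix c a assume c: "c \<in> A" and "a \<in> lead_coeffs I n"
  then obtain g where g: "a \<in> A" "g \<in> polys_below R A x n" "a \<otimes> x [^] n \<oplus> g \<in> I"
    by (auto simp: lead_coeffs_def)
  have "(c \<otimes> a) \<otimes> x [^] n \<oplus> c \<otimes> g = c \<otimes> (a \<otimes> x [^] n \<oplus> g)"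
    using c g x subring_carr polys_carrier by (simp add: r_distr m_assoc)
  then have "(c \<otimes> a) \<otimes> x [^] n \<oplus> c \<otimes> g \<in> I"
    using ideal_inD(4)[OF I _ g(3), of c] c Union_polys_contains by auto
  then show "c \<otimes> a \<in> lead_coeffs I n"
    using c g polys_smult subringE(6)[OF A] by (auto simp: lead_coeffs_def)
qed

lemma lead_coeffs_mono: "I \<subseteq> J \<Longrightarrow> lead_coeffs I n \<subseteq> lead_coeffs J n"
  by (auto simp: lead_coeffs_def)

text \<open>Multiplication by \<open>x\<close> keeps the leading coefficient and raises the degree
  bound by one.\<close>

lemma lead_coeffs_Suc:
  assumes I: "ideal_in R (\<Union>n. polys_below R A x n) I"
  shows "lead_coeffs I n \<subseteq> lead_coeffs I (Suc n)"
proof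
  fix a assume "a \<in> lead_coeffs I n"
  then obtain g where g: "a \<in> A" "g \<in> polys_below R A x n" "a \<otimes> x [^] n \<oplus> g \<in> I"
    by (auto simp: lead_coeffs_def)
  have "a \<otimes> x [^] Suc n \<oplus> x \<otimes> g = x \<otimes> (a \<otimes> x [^] n \<oplus> g)"
    using g x subring_carr polys_carrier by (simp add: r_distr m_assoc m_lcomm m_comm)
  moreover have "x \<otimes> (a \<otimes> x [^] n \<oplus> g) \<in> I"
    using ideal_inD(4)[OF I _ g(3)] Union_polys_contains by blast
  ultimately have "a \<otimes> x [^] Suc n \<oplus> x \<otimes> g \<in> I" by simp
  then show "a \<in> lead_coeffs I (Suc n)"
    using g polys_x[OF g(2)] unfolding lead_coeffs_def by blast
qed

text \<open>Strip leading terms: from \<open>f\<close> in \<open>J\<close> subtract an element of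
  \<open>I\<close> with the same top coefficient. The difference lies in \<open>J\<close> and has a
  smaller degree bound, so induction puts it in \<open>I\<close>.\<close>

lemma lead_coeffs_eq_imp:
  assumes I: "ideal_in R (\<Union>n. polys_below R A x n) I" and J: "ideal_in R (\<Union>n. polys_below R A x n) J"
    and IJ: "I \<subseteq> J" and eq: "\<And>n. lead_coeffs J n \<subseteq> lead_coeffs I n"
  shows "I = J"
proof -
  have "f \<in> J \<Longrightarrow> f \<in> polys_below R A x n \<Longrightarrow> f \<in> I" for f n
  proof (induction n arbitrary: f)
    case 0
    then show ?case using ideal_inD(2)[OF I] by simp
  next
    case (Suc n)
    then obtain a g where f: "a \<in> A" "g \<in> polys_below R A x n" "f = a \<otimes> x [^] n \<oplus> g" by (elim polys_SucE)
    then have "a \<in> lead_coeffs J n" using Suc by (auto simp: lead_coeffs_def)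
    then obtain h where h: "h \<in> polys_below R A x n" "a \<otimes> x [^] n \<oplus> h \<in> I"
      using eq by (auto simp: lead_coeffs_def)
    have m: "\<ominus> \<one> \<in> A" using subringE(3,5)[OF A] by blast
    have aR: "a \<in> carrier R" "g \<in> carrier R" "h \<in> carrier R" "x [^] n \<in> carrier R"
      using f h x subring_carr polys_carrier by auto
    have e: "g \<oplus> (\<ominus> \<one>) \<otimes> h = f \<oplus> (\<ominus> \<one>) \<otimes> (a \<otimes> x [^] n \<oplus> h)"
      unfolding f(3) using aR by algebra
    have "(\<ominus> \<one>) \<otimes> (a \<otimes> x [^] n \<oplus> h) \<in> J"
      using ideal_inD(4)[OF J, of "\<ominus> \<one>" "a \<otimes> x [^] n \<oplus> h"] h IJ m Union_polys_contains by blast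
    then have "g \<oplus> (\<ominus> \<one>) \<otimes> h \<in> J" unfolding e by (rule ideal_inD(3)[OF J Suc.prems(1)])
    moreover have "g \<oplus> (\<ominus> \<one>) \<otimes> h \<in> polys_below R A x n"
      using f h m polys_add polys_smult by blast
    ultimately have "g \<oplus> (\<ominus> \<one>) \<otimes> h \<in> I" using Suc.IH by blast
    then have "(g \<oplus> (\<ominus> \<one>) \<otimes> h) \<oplus> (a \<otimes> x [^] n \<oplus> h) \<in> I" using h ideal_inD(3)[OF I] by blast
    moreover have "(g \<oplus> (\<ominus> \<one>) \<otimes> h) \<oplus> (a \<otimes> x [^] n \<oplus> h) = f"
      unfolding f(3) using aR by algebra
    ultimately show ?case by simp
  qed
  then show ?thesis using IJ ideal_inD(1)[OF J] by blast
qed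

text \<open>The ideals of leading coefficients grow both in the chain index \<open>k\<close> and in
  the degree \<open>n\<close>. Stability of the diagonal from \<open>K\<close> on settles all
  degrees \<open>n \<ge> K\<close>; the finitely many degrees below \<open>K\<close> are settled one
  at a time.\<close>

theorem hilbert_basis:
  assumes acc: "ideal_acc R A"
  shows "ideal_acc R (\<Union>n. polys_below R A x n)"
  unfolding ideal_acc_def
proof (intro allI impI)
  fix I assume I: "\<forall>k. ideal_in R (\<Union>n. polys_below R A x n) (I k)" and inc: "\<forall>k. I k \<subseteq> I (Suc k)"
  let ?L = "\<lambda>k n. lead_coeffs (I k) n"
  have Imono: "I k \<subseteq> I k'" if "k \<le> k'" for k k'
    using that inc by (metis lift_Suc_mono_le)
  have Lmono: "?L k n \<subseteq> ?L k' n'" if "k \<le> k'" "n \<le> n'" for k k' n n'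
  proof -
    have "?L k n \<subseteq> ?L k' n" using Imono that lead_coeffs_mono by blast
    also have "\<dots> \<subseteq> ?L k' n'"
      using that I lead_coeffs_Suc by (metis lift_Suc_mono_le)
    finally show ?thesis .
  qed
  obtain K where K: "\<And>k. k \<ge> K \<Longrightarrow> ?L k k = ?L K K"
    using ideal_accD[OF acc, of "\<lambda>k. ?L k k"] I lead_coeffs_ideal Lmono by (metis le_Suc_eq order_refl)
  have "\<exists>N. \<forall>k\<ge>N. ?L k n = ?L N n" for n
    using ideal_accD[OF acc, of "\<lambda>k. ?L k n"] I lead_coeffs_ideal Lmono by (metis le_Suc_eq order_refl)
  then obtain N where N: "\<And>n k. k \<ge> N n \<Longrightarrow> ?L k n = ?L (N n) n" by metis
  define K' where "K' = Max (insert K (N ` {..<K}))"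
  have K': "K \<le> K'" "n < K \<Longrightarrow> N n \<le> K'" for n by (auto simp: K'_def)
  show "\<exists>N. \<forall>k\<ge>N. I k = I N"
  proof (intro exI[of _ K'] allI impI)
    fix k assume k: "K' \<le> k"
    have "?L k n \<subseteq> ?L K' n" for n
    proof (cases "n < K")
      case True
      then show ?thesis using N[of n k] N[of n K'] K'(2)[of n] k by simp
    next
      case False
      \<comment> \<open>For \<open>n \<ge> K\<close> the ideals are squeezed between
        \<open>?L K K\<close> and a later diagonal term, which equals it.\<close>
      have "?L k n \<subseteq> ?L (max k n) (max k n)" by (rule Lmono) auto
      also have "\<dots> = ?L K K" using False by (intro K) auto
      also have "\<dots> \<subseteq> ?L K' n" using False K' by (intro Lmono) auto
      finally show ?thesis .
    qed
    then show "I k = I K'"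
      using lead_coeffs_eq_imp[of "I K'" "I k"] I Imono[OF k] by blast
  qed
qed

end

text \<open>The generators are adjoined one at a time, each time by the basis theorem; the last
  subring contains a generating set and is therefore all of \<open>R\<close>.\<close>

lemma ideal_acc_generate:
  assumes A: "subring A R" "ideal_acc R A" and S: "finite S" "S \<subseteq> carrier R"
    and gen: "generate_ring R (A \<union> S) = carrier R"
  shows "ideal_acc R (carrier R)"
proof -
  have "\<exists>B. subring B R \<and> A \<union> S \<subseteq> B \<and> ideal_acc R B"
    using S
  proof induction
    case empty
    then show ?case using A by auto
  next
    case (insert x S)
    then obtain B where B: "subring B R" "A \<union> S \<subseteq> B" "ideal_acc R B" by auto
    have x: "x \<in> carrier R" using insert by auto
    show ?case
      using subring_Union_polys[OF B(1) x] Union_polys_contains[OF B(1) x]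
        hilbert_basis[OF B(1) x B(3)] B(2) by blast
  qed
  then obtain B where B: "subring B R" "A \<union> S \<subseteq> B" "ideal_acc R B" by auto
  have "A \<union> S \<subseteq> carrier R" using S subringE(1)[OF A(1)] by auto
  then have "generate_ring R (A \<union> S) \<subseteq> B" by (rule generate_ring_min_subring1) (use B in auto)
  then have "B = carrier R" using gen subringE(1)[OF B(1)] by auto
  then show ?thesis using B by simp
qed

end

text \<open>An ascending sequence is a chain of ideals, so its union is one of its members, and from
  that member on the sequence is constant.\<close>

lemma noetherian_imp_ideal_acc:
  fixes R (structure)
  assumes R: "cring R" and A: "subring A R" and N: "noetherian_ring (R\<lparr>carrier := A\<rparr>)"
  shows "ideal_acc R A"
  unfolding ideal_acc_def
proof (intro allI impI)
  interpret cring R by fact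
  interpret N: noetherian_ring "R\<lparr>carrier := A\<rparr>" by fact
  fix f assume f: "\<forall>n. ideal_in R A (f n)" and inc: "\<forall>n. f n \<subseteq> f (Suc n)"
  have id: "ideal (f n) (R\<lparr>carrier := A\<rparr>)" for n
  proof (rule idealI)
    have I: "ideal_in R A (f n)" using f by simp
    show "ring (R\<lparr>carrier := A\<rparr>)" by (rule N.ring_axioms)
    show "subgroup (f n) (add_monoid (R\<lparr>carrier := A\<rparr>))"
    proof (rule N.add.subgroupI)
      fix a assume a: "a \<in> f n"
      have "\<ominus>\<^bsub>R\<lparr>carrier := A\<rparr>\<^esub> a = \<ominus>\<^bsub>R\<lparr>carrier := A\<rparr>\<^esub> (\<one> \<otimes> a)"
        using ideal_inD(1)[OF I a] subringE(1)[OF A] by auto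
      also have "\<dots> = (\<ominus>\<^bsub>R\<lparr>carrier := A\<rparr>\<^esub> \<one>) \<otimes> a"
        using N.l_minus[of \<one> a] ideal_inD(1)[OF I a] subringE(3)[OF A] by simp
      finally show "\<ominus>\<^bsub>R\<lparr>carrier := A\<rparr>\<^esub> a \<in> f n"
        using ideal_inD(4)[OF I _ a, of "\<ominus>\<^bsub>R\<lparr>carrier := A\<rparr>\<^esub> \<one>"] N.a_inv_closed[of \<one>] subringE(3)[OF A]
        by simp
    qed (use ideal_inD[OF I] in auto)
    fix a y assume "a \<in> f n" "y \<in> carrier (R\<lparr>carrier := A\<rparr>)"
    then show "y \<otimes>\<^bsub>R\<lparr>carrier := A\<rparr>\<^esub> a \<in> f n" "a \<otimes>\<^bsub>R\<lparr>carrier := A\<rparr>\<^esub> y \<in> f n"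
      using ideal_inD[OF I] subringE(1)[OF A] m_comm[of a y] by (auto simp: subset_iff)
  qed
  have mono: "f m \<subseteq> f n" if "m \<le> n" for m n
    using that inc by (metis lift_Suc_mono_le)
  have "f m \<subseteq> f n \<or> f n \<subseteq> f m" for m n using mono[of m n] mono[of n m] by linarith
  then have "subset.chain {I. ideal I (R\<lparr>carrier := A\<rparr>)} (range f)"
    using id unfolding pred_on.chain_def by blast
  from N.ideal_chain_is_trivial[OF _ this] obtain N where N: "\<Union> (range f) = f N" by auto
  show "\<exists>N. \<forall>n\<ge>N. f n = f N"
  proof (intro exI[of _ N] allI impI)
    fix n assume "N \<le> n"
    then show "f n = f N" using mono[of N n] N by auto
  qed
qed

section \<open>Division in graded injective modules\<close>

lemma (in graded_ring) mult_hom: "a \<in> carrier R \<Longrightarrow> (\<otimes>) a \<in> hom (add_monoid R) (add_monoid R)"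
  by (auto simp: hom_def r_distr)

lemma (in graded_ring) hcomp_mult:
  assumes a: "a \<in> rcomp R m" and b: "b \<in> carrier R"
  shows "hcomp R (rcomp R) (m + i) (a \<otimes> b) = a \<otimes> hcomp R (rcomp R) i b"
    and "i < m \<Longrightarrow> hcomp R (rcomp R) i (a \<otimes> b) = \<zero>"
proof -
  have deg: "(\<otimes>) a ` rcomp R j \<subseteq> rcomp R (m + j)" for j using mult_comp[OF a] by auto
  note h = rg.graded_group_axioms rg.graded_group_axioms mult_hom[OF rg.comp_carrier[OF a]]
  show "hcomp R (rcomp R) (m + i) (a \<otimes> b) = a \<otimes> hcomp R (rcomp R) i b"
    by (rule hcomp_hom[OF h deg _ b]) (auto simp: inj_def)
  show "hcomp R (rcomp R) i (a \<otimes> b) = \<zero>" if "i < m"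
    by (rule hcomp_hom_zero[OF h deg _ b]) (use that in auto)
qed

text \<open>Comparing the parts of degree \<open>m\<close> in \<open>a \<otimes> \<one> = a\<close>,
  for \<open>a\<close> homogeneous of degree \<open>m\<close>, shows that the degree 0 part of 1 is
  itself an identity.\<close>

lemma (in graded_ring) one_degree_zero: "\<one> \<in> rcomp R 0"
proof -
  let ?e = "hcomp R (rcomp R) 0 \<one>"
  have e: "?e \<in> carrier R" by (rule rg.hcomp_carrier) simp
  have "a \<otimes> ?e = a" if "a \<in> carrier R" for a
    using that
  proof (induction rule: rg.homogeneous_induct)
    case (homogeneous m a)
    have "a \<otimes> ?e = hcomp R (rcomp R) (m + 0) (a \<otimes> \<one>)"
      using hcomp_mult(1)[OF homogeneous, of \<one> 0] by simp
    also have "\<dots> = a"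
      using rg.hcomp_homogeneous[OF homogeneous, of m] rg.comp_carrier[OF homogeneous] by simp
    finally show ?case .
  qed (use e in \<open>auto simp: l_distr\<close>)
  from this[of \<one>] have "?e = \<one>" using e by simp
  then show ?thesis using rg.hcomp_in[of \<one> 0] by simp
qed

lemma (in graded_ring) pow_degree:
  assumes "x \<in> rcomp R 1"
  shows "x [^] k \<in> rcomp R k"
proof (induction k)
  case (Suc k)
  then show ?case using mult_comp[OF Suc assms] by simp
qed (simp add: one_degree_zero)

lemma (in graded_module) smult_hom_left: "e \<in> carrier M \<Longrightarrow> (\<lambda>a. a \<odot>\<^bsub>M\<^esub> e) \<in> hom (add_monoid R) (add_monoid M)"
  by (auto simp: hom_def smult_l_distr)

lemma (in graded_module) smult_hom_right: "a \<in> carrier R \<Longrightarrow> (\<lambda>y. a \<odot>\<^bsub>M\<^esub> y) \<in> hom (add_monoid M) (add_monoid M)"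
  by (auto simp: hom_def smult_r_distr)

lemma (in graded_module) hcomp_smult:
  assumes a: "a \<in> rcomp R m" and y: "y \<in> carrier M"
  shows "hcomp M (mcomp M) (int m + i) (a \<odot>\<^bsub>M\<^esub> y) = a \<odot>\<^bsub>M\<^esub> hcomp M (mcomp M) i y"
  by (rule hcomp_hom[OF mg.graded_group_axioms mg.graded_group_axioms
        smult_hom_right[OF rg.comp_carrier[OF a]] _ _ y])
    (use smult_comp[OF a] in \<open>auto simp: inj_def\<close>)

lemma (in graded_module) hcomp_smult_homogeneous:
  assumes a: "a \<in> carrier R" and y: "y \<in> mcomp M n"
  shows "hcomp M (mcomp M) (int i + n) (a \<odot>\<^bsub>M\<^esub> y) = hcomp R (rcomp R) i a \<odot>\<^bsub>M\<^esub> y"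
  by (rule hcomp_hom[OF rg.graded_group_axioms mg.graded_group_axioms
        smult_hom_left[OF mg.comp_carrier[OF y]] _ _ a, where \<sigma> = "\<lambda>i. int i + n"])
    (use smult_comp[OF _ y] in \<open>auto simp: inj_def\<close>)

text \<open>
  Choose \<open>m\<close> with \<open>(Ann e : x^m) = (Ann e : x^(m+1))\<close>. Then \<open>j + x^(m+1) r \<mapsto> x^m r e\<close> is well defined
  on the ideal \<open>Ann e + x^(m+1) R\<close>, and \<open>e'\<close> is the image of \<open>1\<close> under an extension of this map to \<open>R\<close>.
\<close>

lemma injective_divide:
  assumes "graded_ring R" and acc: "ideal_acc R (carrier R)" and inj: "graded_injective R E"
    and x: "x \<in> rcomp R 1" and e: "e \<in> mcomp E n"
  shows "\<exists>e' \<in> mcomp E (n - 1). \<exists>m. (x [^]\<^bsub>R\<^esub> Suc m) \<odot>\<^bsub>E\<^esub> e' = (x [^]\<^bsub>R\<^esub> (m::nat)) \<odot>\<^bsub>E\<^esub> e \<and>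
     (\<forall>a \<in> carrier R. a \<odot>\<^bsub>E\<^esub> e = \<zero>\<^bsub>E\<^esub> \<longrightarrow> a \<odot>\<^bsub>E\<^esub> e' = \<zero>\<^bsub>E\<^esub>)"
proof -
  interpret graded_ring R by fact
  interpret E: graded_module R E using inj by (simp add: graded_injective_def)
  have eE: "e \<in> carrier E" using e by (rule E.mg.comp_carrier)
  have xR: "x \<in> carrier R" using x by (rule rg.comp_carrier)
  \<comment> \<open>\<open>J m\<close> is (Ann e : x^m); in particular \<open>J 0\<close> is Ann
    e.\<close>
  define J where "J m = {r \<in> carrier R. (x [^]\<^bsub>R\<^esub> m \<otimes>\<^bsub>R\<^esub> r) \<odot>\<^bsub>E\<^esub> e = \<zero>\<^bsub>E\<^esub>}" for m :: nat
  have J: "ideal_in R (carrier R) (J m)" for m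
    unfolding ideal_in_def
  proof (intro conjI ballI)
    fix a r assume "a \<in> carrier R" "r \<in> J m"
    moreover from this have "x [^]\<^bsub>R\<^esub> m \<otimes>\<^bsub>R\<^esub> (a \<otimes>\<^bsub>R\<^esub> r) = a \<otimes>\<^bsub>R\<^esub> (x [^]\<^bsub>R\<^esub> m \<otimes>\<^bsub>R\<^esub> r)"
      using xR by (simp add: J_def m_lcomm)
    ultimately show "a \<otimes>\<^bsub>R\<^esub> r \<in> J m" using xR eE by (simp add: J_def E.smult_assoc1)
  qed (use xR eE in \<open>auto simp: J_def r_distr E.smult_l_distr\<close>)
  have Jinc: "J m \<subseteq> J (Suc m)" for m
  proof
    fix r assume r: "r \<in> J m"
    then have "x [^]\<^bsub>R\<^esub> Suc m \<otimes>\<^bsub>R\<^esub> r = x \<otimes>\<^bsub>R\<^esub> (x [^]\<^bsub>R\<^esub> m \<otimes>\<^bsub>R\<^esub> r)"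
      using xR by (simp add: J_def m_ac)
    then show "r \<in> J (Suc m)" using r xR eE by (simp add: J_def E.smult_assoc1 del: nat_pow_Suc)
  qed
  obtain m where "\<forall>k\<ge>m. J k = J m" using ideal_accD[of R "carrier R" J, OF acc J Jinc] by blast
  then have m: "J (Suc m) = J m" by (meson le_SucI order_refl)
  let ?xm = "x [^]\<^bsub>R\<^esub> m" and ?xs = "x [^]\<^bsub>R\<^esub> Suc m"
  have xm: "?xm \<in> rcomp R m" "?xs \<in> rcomp R (Suc m)" using pow_degree[OF x] by blast+
  have xmR: "?xm \<in> carrier R" "?xs \<in> carrier R" using xR by auto
  define N where "N = {j \<oplus>\<^bsub>R\<^esub> ?xs \<otimes>\<^bsub>R\<^esub> r | j r. j \<in> J 0 \<and> r \<in> carrier R}"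
  have J0: "j \<in> J 0 \<longleftrightarrow> j \<in> carrier R \<and> j \<odot>\<^bsub>E\<^esub> e = \<zero>\<^bsub>E\<^esub>" for j by (auto simp: J_def)
  have J0R: "j \<in> carrier R" if "j \<in> J 0" for j using that J0 by blast
  have NI: "j \<oplus>\<^bsub>R\<^esub> ?xs \<otimes>\<^bsub>R\<^esub> r \<in> N" if "j \<in> J 0" "r \<in> carrier R" for j r
    using that unfolding N_def by blast
  have idN: "ideal N R"
  proof (rule idealI)
    show "ring R" by (rule ring_axioms)
    show "subgroup N (add_monoid R)"
    proof (rule add.subgroupI)
      show "N \<subseteq> carrier R" using J0R xmR unfolding N_def by auto
      show "N \<noteq> {}" using NI[of "\<zero>\<^bsub>R\<^esub>" "\<zero>\<^bsub>R\<^esub>"] ideal_inD(2)[OF J] by blast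
    next
      fix a assume "a \<in> N"
      then obtain j r where a: "a = j \<oplus>\<^bsub>R\<^esub> ?xs \<otimes>\<^bsub>R\<^esub> r" "j \<in> J 0" "r \<in> carrier R" unfolding N_def by blast
      have "\<ominus>\<^bsub>R\<^esub> a = \<ominus>\<^bsub>R\<^esub> j \<oplus>\<^bsub>R\<^esub> ?xs \<otimes>\<^bsub>R\<^esub> (\<ominus>\<^bsub>R\<^esub> r)"
        using a J0R xmR by (simp add: minus_add r_minus del: nat_pow_Suc)
      moreover have "\<ominus>\<^bsub>R\<^esub> j \<in> J 0" using a eE by (simp add: J0 E.smult_l_minus)
      ultimately show "\<ominus>\<^bsub>R\<^esub> a \<in> N" using NI a by simp
    next
      fix a b assume "a \<in> N" "b \<in> N"
      then obtain j r j' r' where a: "a = j \<oplus>\<^bsub>R\<^esub> ?xs \<otimes>\<^bsub>R\<^esub> r" "j \<in> J 0" "r \<in> carrier R"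
        and b: "b = j' \<oplus>\<^bsub>R\<^esub> ?xs \<otimes>\<^bsub>R\<^esub> r'" "j' \<in> J 0" "r' \<in> carrier R" unfolding N_def by blast
      have "a \<oplus>\<^bsub>R\<^esub> b = (j \<oplus>\<^bsub>R\<^esub> j') \<oplus>\<^bsub>R\<^esub> ?xs \<otimes>\<^bsub>R\<^esub> (r \<oplus>\<^bsub>R\<^esub> r')"
        using a b J0R xmR by (simp add: r_distr a_ac del: nat_pow_Suc)
      then show "a \<oplus>\<^bsub>R\<^esub> b \<in> N" using NI a b ideal_inD(3)[OF J] by simp
    qed
    fix a c assume "a \<in> N" and c: "c \<in> carrier R"
    then obtain j r where a: "a = j \<oplus>\<^bsub>R\<^esub> ?xs \<otimes>\<^bsub>R\<^esub> r" "j \<in> J 0" "r \<in> carrier R" unfolding N_def by blast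
    have "c \<otimes>\<^bsub>R\<^esub> a = c \<otimes>\<^bsub>R\<^esub> j \<oplus>\<^bsub>R\<^esub> ?xs \<otimes>\<^bsub>R\<^esub> (c \<otimes>\<^bsub>R\<^esub> r)"
      using a c J0R xmR by (simp add: r_distr m_lcomm del: nat_pow_Suc)
    then show "c \<otimes>\<^bsub>R\<^esub> a \<in> N" using NI a c ideal_inD(4)[OF J c] by simp
    moreover have "a \<in> carrier R" using a J0R xmR by simp
    ultimately show "a \<otimes>\<^bsub>R\<^esub> c \<in> N" using c by (simp add: m_comm)
  qed
  have hJ: "hcomp R (rcomp R) i j \<in> J 0" if "j \<in> J 0" for i j
  proof -
    have "hcomp R (rcomp R) i j \<odot>\<^bsub>E\<^esub> e = \<zero>\<^bsub>E\<^esub>"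
      using E.hcomp_smult_homogeneous[OF J0R[OF that] e, of i] that by (simp add: J0 E.mg.hcomp_zero)
    then show ?thesis using that J0R rg.hcomp_carrier by (simp add: J0)
  qed
  \<comment> \<open>A component of \<open>j + x^(m+1) r\<close> has the same form with
    \<open>r'\<close> homogeneous, and \<open>r' = 0\<close> below degree \<open>m + 1\<close>. This
    makes \<open>N\<close> a homogeneous ideal and shows that the map on it preserves
    degrees.\<close>
  have hN: "\<exists>j'\<in>J 0. \<exists>r'\<in>carrier R. hcomp R (rcomp R) i (j \<oplus>\<^bsub>R\<^esub> ?xs \<otimes>\<^bsub>R\<^esub> r) = j' \<oplus>\<^bsub>R\<^esub> ?xs \<otimes>\<^bsub>R\<^esub> r' \<and>
      (?xm \<otimes>\<^bsub>R\<^esub> r') \<odot>\<^bsub>E\<^esub> e \<in> mcomp E (int i + (n - 1))" if j: "j \<in> J 0" and r: "r \<in> carrier R" for i j r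
  proof (cases "i < Suc m")
    case True
    have "hcomp R (rcomp R) i (j \<oplus>\<^bsub>R\<^esub> ?xs \<otimes>\<^bsub>R\<^esub> r) = hcomp R (rcomp R) i j \<oplus>\<^bsub>R\<^esub> ?xs \<otimes>\<^bsub>R\<^esub> \<zero>\<^bsub>R\<^esub>"
      using True j r J0R xmR hcomp_mult(2)[OF xm(2) r True]
      by (simp add: rg.hcomp_add del: nat_pow_Suc)
    then show ?thesis using hJ[OF j] xmR eE E.mg.comp_zero
      by (intro bexI[of _ "hcomp R (rcomp R) i j"] bexI[of _ "\<zero>\<^bsub>R\<^esub>"]) (auto simp del: nat_pow_Suc)
  next
    case False
    then obtain k where k: "i = Suc m + k" using le_Suc_ex[of "Suc m" i] by auto
    let ?r = "hcomp R (rcomp R) k r"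
    have "hcomp R (rcomp R) i (j \<oplus>\<^bsub>R\<^esub> ?xs \<otimes>\<^bsub>R\<^esub> r) = hcomp R (rcomp R) i j \<oplus>\<^bsub>R\<^esub> ?xs \<otimes>\<^bsub>R\<^esub> ?r"
      using k j r J0R xmR hcomp_mult(1)[OF xm(2) r, of k]
      by (simp add: rg.hcomp_add del: nat_pow_Suc)
    moreover have "(?xm \<otimes>\<^bsub>R\<^esub> ?r) \<odot>\<^bsub>E\<^esub> e \<in> mcomp E (int (m + k) + n)"
      by (intro E.smult_comp mult_comp xm rg.hcomp_in r e)
    then have "(?xm \<otimes>\<^bsub>R\<^esub> ?r) \<odot>\<^bsub>E\<^esub> e \<in> mcomp E (int i + (n - 1))" by (simp add: k algebra_simps)
    ultimately show ?thesis using hJ[OF j] rg.hcomp_carrier[OF r] by blast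
  qed
  define f where "f a = (THE y. \<exists>j\<in>J 0. \<exists>r\<in>carrier R. a = j \<oplus>\<^bsub>R\<^esub> ?xs \<otimes>\<^bsub>R\<^esub> r \<and> y = (?xm \<otimes>\<^bsub>R\<^esub> r) \<odot>\<^bsub>E\<^esub> e)" for a
  have f: "f (j \<oplus>\<^bsub>R\<^esub> ?xs \<otimes>\<^bsub>R\<^esub> r) = (?xm \<otimes>\<^bsub>R\<^esub> r) \<odot>\<^bsub>E\<^esub> e" if j: "j \<in> J 0" and r: "r \<in> carrier R" for j r
    unfolding f_def
  proof (rule the_equality)
    show "\<exists>j'\<in>J 0. \<exists>r'\<in>carrier R. j \<oplus>\<^bsub>R\<^esub> ?xs \<otimes>\<^bsub>R\<^esub> r = j' \<oplus>\<^bsub>R\<^esub> ?xs \<otimes>\<^bsub>R\<^esub> r' \<and>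
        (?xm \<otimes>\<^bsub>R\<^esub> r) \<odot>\<^bsub>E\<^esub> e = (?xm \<otimes>\<^bsub>R\<^esub> r') \<odot>\<^bsub>E\<^esub> e" using j r by blast
    fix y assume "\<exists>j'\<in>J 0. \<exists>r'\<in>carrier R. j \<oplus>\<^bsub>R\<^esub> ?xs \<otimes>\<^bsub>R\<^esub> r = j' \<oplus>\<^bsub>R\<^esub> ?xs \<otimes>\<^bsub>R\<^esub> r' \<and> y = (?xm \<otimes>\<^bsub>R\<^esub> r') \<odot>\<^bsub>E\<^esub> e"
    then obtain j' r' where j': "j' \<in> J 0" "r' \<in> carrier R"
      and eq: "j \<oplus>\<^bsub>R\<^esub> ?xs \<otimes>\<^bsub>R\<^esub> r = j' \<oplus>\<^bsub>R\<^esub> ?xs \<otimes>\<^bsub>R\<^esub> r'" and y: "y = (?xm \<otimes>\<^bsub>R\<^esub> r') \<odot>\<^bsub>E\<^esub> e" by blast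
    have cl: "j \<in> carrier R" "j' \<in> carrier R" "?xs \<otimes>\<^bsub>R\<^esub> r \<in> carrier R" "?xs \<otimes>\<^bsub>R\<^esub> r' \<in> carrier R"
      using J0R j j' r xmR by auto
    have "(j \<oplus>\<^bsub>R\<^esub> ?xs \<otimes>\<^bsub>R\<^esub> r) \<odot>\<^bsub>E\<^esub> e = (j' \<oplus>\<^bsub>R\<^esub> ?xs \<otimes>\<^bsub>R\<^esub> r') \<odot>\<^bsub>E\<^esub> e" using eq by simp
    then have "(?xs \<otimes>\<^bsub>R\<^esub> r) \<odot>\<^bsub>E\<^esub> e = (?xs \<otimes>\<^bsub>R\<^esub> r') \<odot>\<^bsub>E\<^esub> e"
      using cl j j' eE by (simp add: E.smult_l_distr J0 del: nat_pow_Suc)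
    then have "(?xs \<otimes>\<^bsub>R\<^esub> (r \<oplus>\<^bsub>R\<^esub> \<ominus>\<^bsub>R\<^esub> r')) \<odot>\<^bsub>E\<^esub> e = \<zero>\<^bsub>E\<^esub>"
      using xmR r j' eE by (simp add: r_distr r_minus E.smult_l_distr E.smult_l_minus E.M.r_neg del: nat_pow_Suc)
    then have "r \<oplus>\<^bsub>R\<^esub> \<ominus>\<^bsub>R\<^esub> r' \<in> J (Suc m)" using r j' by (simp add: J_def del: nat_pow_Suc)
    \<comment> \<open>The choice of \<open>m\<close> is used here: (Ann e : x^(m+1)) is no larger
      than (Ann e : x^m).\<close>
    then have "(?xm \<otimes>\<^bsub>R\<^esub> (r \<oplus>\<^bsub>R\<^esub> \<ominus>\<^bsub>R\<^esub> r')) \<odot>\<^bsub>E\<^esub> e = \<zero>\<^bsub>E\<^esub>" unfolding m by (simp add: J_def)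
    then have "(?xm \<otimes>\<^bsub>R\<^esub> r) \<odot>\<^bsub>E\<^esub> e \<oplus>\<^bsub>E\<^esub> \<ominus>\<^bsub>E\<^esub> ((?xm \<otimes>\<^bsub>R\<^esub> r') \<odot>\<^bsub>E\<^esub> e) = \<zero>\<^bsub>E\<^esub>"
      using xmR r j' eE by (simp add: r_distr r_minus E.smult_l_distr E.smult_l_minus)
    then show "y = (?xm \<otimes>\<^bsub>R\<^esub> r) \<odot>\<^bsub>E\<^esub> e"
      unfolding y using xmR r j' eE E.M.minus_equality[of "(?xm \<otimes>\<^bsub>R\<^esub> r) \<odot>\<^bsub>E\<^esub> e" "\<ominus>\<^bsub>E\<^esub> ((?xm \<otimes>\<^bsub>R\<^esub> r') \<odot>\<^bsub>E\<^esub> e)"]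
      by simp
  qed
  \<comment> \<open>The shift puts 1 in degree \<open>n - 1\<close>, so that \<open>x^(m+1)\<close>
    sits in degree \<open>n + m\<close>, the degree of \<open>x^m e\<close>.\<close>
  let ?N = "shifted_ideal R N (n - 1)" and ?P = "shifted_ideal R (carrier R) (n - 1)"
  have gN: "graded_module R ?N"
  proof (rule graded_module_shifted_ideal[OF idN])
    fix a i assume "a \<in> N"
    then obtain j r where a: "a = j \<oplus>\<^bsub>R\<^esub> ?xs \<otimes>\<^bsub>R\<^esub> r" "j \<in> J 0" "r \<in> carrier R" unfolding N_def by blast
    then show "hcomp R (rcomp R) i a \<in> N" using hN[OF a(2,3), of i] NI by auto
  qed
  have gP: "graded_module R ?P"
    by (rule graded_module_shifted_ideal[OF oneideal]) (rule rg.hcomp_carrier)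
  have NR: "N \<subseteq> carrier R" using J0R xmR unfolding N_def by auto
  have incl: "(\<lambda>a. a) \<in> graded_hom R ?N ?P"
    using NR by (auto simp: graded_hom_def shifted_ideal_def hom_def)
  have fhom: "f \<in> graded_hom R ?N E"
    unfolding graded_hom_def
  proof (intro CollectI conjI ballI allI)
    show "f \<in> hom (add_monoid ?N) (add_monoid E)"
    proof (rule homI)
      fix a b assume "a \<in> carrier (add_monoid ?N)" "b \<in> carrier (add_monoid ?N)"
      then have "a \<in> N" "b \<in> N" by (simp_all add: shifted_ideal_def)
      then obtain j r j' r' where a: "a = j \<oplus>\<^bsub>R\<^esub> ?xs \<otimes>\<^bsub>R\<^esub> r" "j \<in> J 0" "r \<in> carrier R"
        and b: "b = j' \<oplus>\<^bsub>R\<^esub> ?xs \<otimes>\<^bsub>R\<^esub> r'" "j' \<in> J 0" "r' \<in> carrier R" unfolding N_def by blast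
      have "a \<oplus>\<^bsub>R\<^esub> b = (j \<oplus>\<^bsub>R\<^esub> j') \<oplus>\<^bsub>R\<^esub> ?xs \<otimes>\<^bsub>R\<^esub> (r \<oplus>\<^bsub>R\<^esub> r')"
        using a b J0R xmR by (simp add: r_distr a_ac del: nat_pow_Suc)
      then have "f (a \<oplus>\<^bsub>R\<^esub> b) = (?xm \<otimes>\<^bsub>R\<^esub> (r \<oplus>\<^bsub>R\<^esub> r')) \<odot>\<^bsub>E\<^esub> e"
        using f a b ideal_inD(3)[OF J] by simp
      then have "f (a \<oplus>\<^bsub>R\<^esub> b) = f a \<oplus>\<^bsub>E\<^esub> f b"
        using a b f xmR eE by (simp add: r_distr E.smult_l_distr)
      then show "f (a \<otimes>\<^bsub>add_monoid ?N\<^esub> b) = f a \<otimes>\<^bsub>add_monoid E\<^esub> f b" by (simp add: shifted_ideal_def)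
      show "f a \<in> carrier (add_monoid E)" using a f xmR eE by simp
    qed
  next
    fix c a assume c: "c \<in> carrier R" and "a \<in> carrier ?N"
    then have "a \<in> N" by (simp add: shifted_ideal_def)
    then obtain j r where a: "a = j \<oplus>\<^bsub>R\<^esub> ?xs \<otimes>\<^bsub>R\<^esub> r" "j \<in> J 0" "r \<in> carrier R" unfolding N_def by blast
    have "c \<otimes>\<^bsub>R\<^esub> a = c \<otimes>\<^bsub>R\<^esub> j \<oplus>\<^bsub>R\<^esub> ?xs \<otimes>\<^bsub>R\<^esub> (c \<otimes>\<^bsub>R\<^esub> r)"
      using a c J0R xmR by (simp add: r_distr m_lcomm del: nat_pow_Suc)
    then have "f (c \<otimes>\<^bsub>R\<^esub> a) = (?xm \<otimes>\<^bsub>R\<^esub> (c \<otimes>\<^bsub>R\<^esub> r)) \<odot>\<^bsub>E\<^esub> e" using f a c ideal_inD(4)[OF J c] by simp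
    also have "?xm \<otimes>\<^bsub>R\<^esub> (c \<otimes>\<^bsub>R\<^esub> r) = c \<otimes>\<^bsub>R\<^esub> (?xm \<otimes>\<^bsub>R\<^esub> r)" using c a xmR by (simp add: m_lcomm)
    finally have "f (c \<otimes>\<^bsub>R\<^esub> a) = c \<odot>\<^bsub>E\<^esub> f a" using f a c xmR eE by (simp add: E.smult_assoc1)
    then show "f (c \<odot>\<^bsub>?N\<^esub> a) = c \<odot>\<^bsub>E\<^esub> f a" by (simp add: shifted_ideal_def)
  next
    fix l
    have f0: "f \<zero>\<^bsub>R\<^esub> = \<zero>\<^bsub>E\<^esub>"
      using f[of "\<zero>\<^bsub>R\<^esub>" "\<zero>\<^bsub>R\<^esub>"] ideal_inD(2)[OF J] xmR eE by (simp del: nat_pow_Suc)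
    show "f ` mcomp ?N l \<subseteq> mcomp E l"
    proof (cases "n - 1 \<le> l")
      case True
      define i where "i = nat (l - (n - 1))"
      have l: "l = int i + (n - 1)" using True by (simp add: i_def)
      show ?thesis
      proof
        fix y assume "y \<in> f ` mcomp ?N l"
        then obtain a where y: "y = f a" and aN: "a \<in> N" and ai: "a \<in> rcomp R i"
          using True by (auto simp: shifted_ideal_def i_def)
        obtain j r where a: "a = j \<oplus>\<^bsub>R\<^esub> ?xs \<otimes>\<^bsub>R\<^esub> r" "j \<in> J 0" "r \<in> carrier R"
          using aN unfolding N_def by blast
        obtain j' r' where "j' \<in> J 0" "r' \<in> carrier R" "hcomp R (rcomp R) i a = j' \<oplus>\<^bsub>R\<^esub> ?xs \<otimes>\<^bsub>R\<^esub> r'"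
          "(?xm \<otimes>\<^bsub>R\<^esub> r') \<odot>\<^bsub>E\<^esub> e \<in> mcomp E l"
          using hN[OF a(2,3), of i] a(1) l by auto
        then show "y \<in> mcomp E l" using f rg.hcomp_homogeneous[OF ai, of i] y by auto
      qed
    next
      case False
      then show ?thesis using f0 E.mg.comp_zero by (simp add: shifted_ideal_def)
    qed
  qed
  obtain g where g: "g \<in> graded_hom R ?P E" and gf: "\<And>a. a \<in> N \<Longrightarrow> g a = f a"
    using inj gN gP incl fhom unfolding graded_injective_def
    by (force simp: shifted_ideal_def[of R N] inj_on_def)
  have glin: "g a = a \<odot>\<^bsub>E\<^esub> g \<one>\<^bsub>R\<^esub>" if "a \<in> carrier R" for a
  proof -
    have "\<forall>a\<in>carrier R. \<forall>y\<in>carrier R. g (a \<otimes>\<^bsub>R\<^esub> y) = a \<odot>\<^bsub>E\<^esub> g y"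
      using g by (simp add: graded_hom_def shifted_ideal_def)
    from this[rule_format, OF that one_closed] show ?thesis using that by simp
  qed
  have "\<one>\<^bsub>R\<^esub> \<in> mcomp ?P (n - 1)" using one_degree_zero by (simp add: shifted_ideal_def)
  then have g1: "g \<one>\<^bsub>R\<^esub> \<in> mcomp E (n - 1)" using g unfolding graded_hom_def by blast
  have z0: "\<zero>\<^bsub>R\<^esub> \<in> J 0" using ideal_inD(2)[OF J] .
  have xsN: "\<zero>\<^bsub>R\<^esub> \<oplus>\<^bsub>R\<^esub> ?xs \<otimes>\<^bsub>R\<^esub> \<one>\<^bsub>R\<^esub> = ?xs" using xmR by (simp del: nat_pow_Suc)
  have "?xs \<odot>\<^bsub>E\<^esub> g \<one>\<^bsub>R\<^esub> = g ?xs" by (rule glin[OF xmR(2), symmetric])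
  also have "\<dots> = f ?xs" using gf[of ?xs] NI[OF z0 one_closed] unfolding xsN by simp
  also have "\<dots> = ?xm \<odot>\<^bsub>E\<^esub> e" using f[OF z0 one_closed] xmR unfolding xsN by simp
  finally have 1: "?xs \<odot>\<^bsub>E\<^esub> g \<one>\<^bsub>R\<^esub> = ?xm \<odot>\<^bsub>E\<^esub> e" .
  \<comment> \<open>Ann e was included in \<open>N\<close> for this clause: the map vanishes there,
    so its extension sends \<open>a\<close> to 0.\<close>
  have 2: "a \<odot>\<^bsub>E\<^esub> g \<one>\<^bsub>R\<^esub> = \<zero>\<^bsub>E\<^esub>" if a: "a \<in> carrier R" "a \<odot>\<^bsub>E\<^esub> e = \<zero>\<^bsub>E\<^esub>" for a
  proof -
    have aJ: "a \<in> J 0" using a by (simp add: J0)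
    have e: "a \<oplus>\<^bsub>R\<^esub> ?xs \<otimes>\<^bsub>R\<^esub> \<zero>\<^bsub>R\<^esub> = a" using a xmR by (simp del: nat_pow_Suc)
    have "g a = f a" using gf NI[OF aJ zero_closed] unfolding e by simp
    also have "\<dots> = \<zero>\<^bsub>E\<^esub>" using f[OF aJ zero_closed] xmR eE unfolding e by simp
    finally show ?thesis using glin[OF a(1)] by simp
  qed
  show ?thesis using g1 1 2 by blast
qed

section \<open>Cones and Koszul complexes\<close>

text \<open>Iterated cones need pairs of arbitrary nesting depth within a single type.\<close>

datatype 'a cone_tree = Leaf (leaf: 'a) | Node (left_part: "'a cone_tree") (right_part: "'a cone_tree")

text \<open>Only the position \<open>p\<close> belongs to the complex. The internal degree enters
  through families \<open>C p n\<close> of subgroups, so that several subcomplexes can be compared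
  inside one ambient complex.\<close>

record 'a op_complex =
  grp :: "int \<Rightarrow> 'a ring"
  diff :: "int \<Rightarrow> 'a \<Rightarrow> 'a"
  oper :: "nat \<Rightarrow> int \<Rightarrow> 'a \<Rightarrow> 'a"

locale op_complex =
  fixes X :: "'a op_complex"
  assumes d_hom: "abelian_group_hom (grp X p) (grp X (p + 1)) (diff X p)"
    and x_hom: "abelian_group_hom (grp X p) (grp X p) (oper X i p)"
    and diff_diff: "a \<in> carrier (grp X p) \<Longrightarrow> diff X (p + 1) (diff X p a) = \<zero>\<^bsub>grp X (p + 2)\<^esub>"
    and diff_oper: "a \<in> carrier (grp X p) \<Longrightarrow> diff X p (oper X i p a) = oper X i (p + 1) (diff X p a)"
    and oper_oper: "a \<in> carrier (grp X p) \<Longrightarrow> oper X i p (oper X j p a) = oper X j p (oper X i p a)"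
begin

lemma grp: "abelian_group (grp X p)"
  using d_hom abelian_group_hom.axioms(1) by blast

sublocale G: abelian_group "grp X p" for p by (rule grp)

lemmas d_add [simp] = abelian_group_hom.hom_add[OF d_hom]
  and d_closed [simp] = abelian_group_hom.hom_closed[OF d_hom]
  and d_zero [simp] = abelian_group_hom.hom_zero[OF d_hom]
  and d_minus [simp] = abelian_group_hom.hom_a_inv[OF d_hom]
  and x_add [simp] = abelian_group_hom.hom_add[OF x_hom]
  and x_closed [simp] = abelian_group_hom.hom_closed[OF x_hom]
  and x_zero [simp] = abelian_group_hom.hom_zero[OF x_hom]
  and x_minus [simp] = abelian_group_hom.hom_a_inv[OF x_hom]

lemma d_closed2 [simp]: "a \<in> carrier (grp X (p + 1)) \<Longrightarrow> diff X (p + 1) a \<in> carrier (grp X (p + 2))"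
  using d_closed[of a "p + 1"] by (simp add: add.assoc)

lemma d_minus2 [simp]:
  "a \<in> carrier (grp X (p + 1)) \<Longrightarrow> diff X (p + 1) (\<ominus>\<^bsub>grp X (p + 1)\<^esub> a) = \<ominus>\<^bsub>grp X (p + 2)\<^esub> diff X (p + 1) a"
  using d_minus[of a "p + 1"] by (simp add: add.assoc)

end

text \<open>The mapping cone of the operator \<open>x_k\<close>, seen as a map from a copy of
  \<open>X\<close> shifted by one internal degree; \<open>b\<close> is the entry from that copy. The
  sign on its differential makes the composite of two differentials vanish.\<close>

definition cone :: "nat \<Rightarrow> 'a cone_tree op_complex \<Rightarrow> 'a cone_tree op_complex" where
  "cone k X = \<lparr>
     grp = (\<lambda>p. \<lparr>carrier = {Node a b | a b. a \<in> carrier (grp X p) \<and> b \<in> carrier (grp X (p + 1))},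
                monoid.mult = undefined, one = undefined,
                zero = Node \<zero>\<^bsub>grp X p\<^esub> \<zero>\<^bsub>grp X (p + 1)\<^esub>,
                add = (\<lambda>u v. Node (left_part u \<oplus>\<^bsub>grp X p\<^esub> left_part v) (right_part u \<oplus>\<^bsub>grp X (p + 1)\<^esub> right_part v))\<rparr>),
     diff = (\<lambda>p u. Node (diff X p (left_part u) \<oplus>\<^bsub>grp X (p + 1)\<^esub> oper X k (p + 1) (right_part u))
                    (\<ominus>\<^bsub>grp X (p + 2)\<^esub> diff X (p + 1) (right_part u))),
     oper = (\<lambda>i p u. Node (oper X i p (left_part u)) (oper X i (p + 1) (right_part u)))\<rparr>"

lemma cone_simps:
  "carrier (grp (cone k X) p) = {Node a b | a b. a \<in> carrier (grp X p) \<and> b \<in> carrier (grp X (p + 1))}"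
  "\<zero>\<^bsub>grp (cone k X) p\<^esub> = Node \<zero>\<^bsub>grp X p\<^esub> \<zero>\<^bsub>grp X (p + 1)\<^esub>"
  "Node a b \<oplus>\<^bsub>grp (cone k X) p\<^esub> Node a' b' = Node (a \<oplus>\<^bsub>grp X p\<^esub> a') (b \<oplus>\<^bsub>grp X (p + 1)\<^esub> b')"
  "diff (cone k X) p (Node a b) =
     Node (diff X p a \<oplus>\<^bsub>grp X (p + 1)\<^esub> oper X k (p + 1) b) (\<ominus>\<^bsub>grp X (p + 2)\<^esub> diff X (p + 1) b)"
  "oper (cone k X) i p (Node a b) = Node (oper X i p a) (oper X i (p + 1) b)"
  by (simp_all add: cone_def)

lemma abelian_group_cone:
  assumes "op_complex X"
  shows "abelian_group (grp (cone k X) p)"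
proof -
  interpret op_complex X by fact
  show ?thesis
  proof (rule abelian_groupI)
    fix u assume "u \<in> carrier (grp (cone k X) p)"
    then obtain a b where u: "u = Node a b" "a \<in> carrier (grp X p)" "b \<in> carrier (grp X (p + 1))"
      by (auto simp: cone_simps)
    show "\<exists>v\<in>carrier (grp (cone k X) p). v \<oplus>\<^bsub>grp (cone k X) p\<^esub> u = \<zero>\<^bsub>grp (cone k X) p\<^esub>"
      by (rule bexI[of _ "Node (\<ominus>\<^bsub>grp X p\<^esub> a) (\<ominus>\<^bsub>grp X (p + 1)\<^esub> b)"])
        (auto simp: cone_simps u G.l_neg)
  qed (auto simp: cone_simps G.a_assoc intro: G.a_comm)
qed

text \<open>In the square of the differential the mixed terms \<open>d x_k b\<close> and
  \<open>- x_k d b\<close> cancel. The operators act componentwise and commute with the new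
  differential because they commute with \<open>d\<close> and with \<open>x_k\<close>.\<close>

lemma op_complex_cone:
  assumes "op_complex X"
  shows "op_complex (cone k X)"
proof -
  interpret op_complex X by fact
  note ab = abelian_group_cone[OF assms]
  show ?thesis
  proof (rule op_complex.intro)
    fix p
    show "abelian_group_hom (grp (cone k X) p) (grp (cone k X) (p + 1)) (diff (cone k X) p)"
    proof (rule abelian_group_homI'[OF ab ab])
      fix u v assume "u \<in> carrier (grp (cone k X) p)" "v \<in> carrier (grp (cone k X) p)"
      then obtain a b a' b' where u: "u = Node a b" "a \<in> carrier (grp X p)" "b \<in> carrier (grp X (p + 1))"
        and v: "v = Node a' b'" "a' \<in> carrier (grp X p)" "b' \<in> carrier (grp X (p + 1))"
        by (auto simp: cone_simps)
      show "diff (cone k X) p (u \<oplus>\<^bsub>grp (cone k X) p\<^esub> v) =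
          diff (cone k X) p u \<oplus>\<^bsub>grp (cone k X) (p + 1)\<^esub> diff (cone k X) p v"
        using u v d_add[of b "p + 1" b'] by (simp add: cone_simps G.a_ac G.minus_add add.assoc)
    qed (auto simp: cone_simps add.assoc)
    fix i
    show "abelian_group_hom (grp (cone k X) p) (grp (cone k X) p) (oper (cone k X) i p)"
      by (rule abelian_group_homI'[OF ab ab]) (auto simp: cone_simps)
    fix u assume "u \<in> carrier (grp (cone k X) p)"
    then obtain a b where u: "u = Node a b" "a \<in> carrier (grp X p)" "b \<in> carrier (grp X (p + 1))"
      by (auto simp: cone_simps)
    have e: "p + 1 + 2 = p + 3" "p + 2 + 1 = p + 3" "1 + (p + 1) = p + 2" "p + 1 + 1 = p + 2" by auto
    have d2: "diff X (p + 2) c \<in> carrier (grp X (p + 3))" if "c \<in> carrier (grp X (p + 2))" for c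
      using d_closed[OF that] e by simp
    have dm: "diff X (p + 2) (\<ominus>\<^bsub>grp X (p + 2)\<^esub> c) = \<ominus>\<^bsub>grp X (p + 3)\<^esub> diff X (p + 2) c"
      if "c \<in> carrier (grp X (p + 2))" for c
      using d_minus[OF that] e by simp
    have da: "diff X (p + 1) (a \<oplus>\<^bsub>grp X (p + 1)\<^esub> c) = diff X (p + 1) a \<oplus>\<^bsub>grp X (p + 2)\<^esub> diff X (p + 1) c"
      if "a \<in> carrier (grp X (p + 1))" "c \<in> carrier (grp X (p + 1))" for a c
      using d_add[OF that] e by simp
    have ddb: "diff X (p + 2) (diff X (p + 1) b) = \<zero>\<^bsub>grp X (p + 3)\<^esub>"
      using diff_diff[OF u(3)] e by simp
    have dxb: "diff X (p + 1) (oper X k (p + 1) b) = oper X k (p + 2) (diff X (p + 1) b)"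
      using diff_oper[OF u(3)] e by simp
    show "diff (cone k X) (p + 1) (diff (cone k X) p u) = \<zero>\<^bsub>grp (cone k X) (p + 2)\<^esub>"
      using u by (simp add: cone_simps e diff_diff da dm d2 ddb dxb G.r_neg)
    show "diff (cone k X) p (oper (cone k X) i p u) = oper (cone k X) i (p + 1) (diff (cone k X) p u)"
      using u diff_oper[OF u(3)] by (simp add: cone_simps e diff_oper oper_oper[of b "p + 1" k i])
    fix j
    show "oper (cone k X) i p (oper (cone k X) j p u) = oper (cone k X) j p (oper (cone k X) i p u)"
      using u by (simp add: cone_simps oper_oper[of _ _ i j])
  qed
qed

text \<open>Operators raise the internal degree by one, so \<open>b\<close> is taken one degree
  lower and the cone differential preserves degree.\<close>

definition cone_car :: "(int \<Rightarrow> int \<Rightarrow> 'a cone_tree set) \<Rightarrow> int \<Rightarrow> int \<Rightarrow> 'a cone_tree set" where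
  "cone_car C p n = {Node a b | a b. a \<in> C p n \<and> b \<in> C (p + 1) (n - 1)}"

definition op_subcomplex :: "'a op_complex \<Rightarrow> (int \<Rightarrow> int \<Rightarrow> 'a set) \<Rightarrow> bool" where
  "op_subcomplex X C \<longleftrightarrow> (\<forall>p n. additive_subgroup (C p n) (grp X p) \<and>
     diff X p ` C p n \<subseteq> C (p + 1) n \<and> (\<forall>i. oper X i p ` C p n \<subseteq> C p (n + 1)))"

locale complex_with_sub = op_complex X for X :: "'a op_complex" +
  fixes C :: "int \<Rightarrow> int \<Rightarrow> 'a set"
  assumes sub: "op_subcomplex X C"
begin

lemma sub_group: "additive_subgroup (C p n) (grp X p)"
  using sub by (simp add: op_subcomplex_def)

lemma carr: "a \<in> C p n \<Longrightarrow> a \<in> carrier (grp X p)"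
  using additive_subgroup.a_subset[OF sub_group] by blast

lemmas C_zero [simp] = additive_subgroup.zero_closed[OF sub_group]
  and C_add [simp] = additive_subgroup.a_closed[OF sub_group]
  and C_minus [simp] = additive_subgroup.a_inv_closed[OF sub_group]

lemma C_d [simp]: "a \<in> C p n \<Longrightarrow> diff X p a \<in> C (p + 1) n"
  using sub by (auto simp: op_subcomplex_def)

lemma C_d' [simp]: "a \<in> C (p - 1) n \<Longrightarrow> diff X (p - 1) a \<in> C p n"
  using C_d[of a "p - 1"] by simp

lemma C_d2 [simp]: "a \<in> C (p + 1) n \<Longrightarrow> diff X (p + 1) a \<in> C (p + 2) n"
  using C_d[of a "p + 1"] by (simp add: add.assoc)

lemma C_x [simp]: "a \<in> C p n \<Longrightarrow> oper X i p a \<in> C p (n + 1)"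
  using sub unfolding op_subcomplex_def by blast

lemma C_x' [simp]: "a \<in> C p (n - 1) \<Longrightarrow> oper X i p a \<in> C p n"
  using C_x[of a p "n - 1"] by simp

end

lemma complex_with_subI: "op_complex X \<Longrightarrow> op_subcomplex X C \<Longrightarrow> complex_with_sub X C"
  by (simp add: complex_with_sub_def complex_with_sub_axioms_def)

lemma op_subcomplex_cone:
  assumes "op_complex X" "op_subcomplex X C"
  shows "op_subcomplex (cone k X) (cone_car C)"
proof -
  interpret complex_with_sub X C using assms by (rule complex_with_subI)
  interpret K: op_complex "cone k X" using assms(1) by (rule op_complex_cone)
  have m: "\<ominus>\<^bsub>grp (cone k X) p\<^esub> Node a b = Node (\<ominus>\<^bsub>grp X p\<^esub> a) (\<ominus>\<^bsub>grp X (p + 1)\<^esub> b)"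
    if "a \<in> carrier (grp X p)" "b \<in> carrier (grp X (p + 1))" for a b p
    by (rule K.G.minus_equality) (use that in \<open>auto simp: cone_simps G.l_neg\<close>)
  show ?thesis
    unfolding op_subcomplex_def
  proof (intro allI conjI)
    fix p n
    show "additive_subgroup (cone_car C p n) (grp (cone k X) p)"
    proof (rule additive_subgroupI'[OF K.grp])
      show "\<ominus>\<^bsub>grp (cone k X) p\<^esub> u \<in> cone_car C p n" if "u \<in> cone_car C p n" for u
        using that carr m by (auto simp: cone_car_def)
    qed (use carr in \<open>auto simp: cone_car_def cone_simps\<close>)
    have e: "p + 1 + 1 = p + 2" by simp
    show "diff (cone k X) p ` cone_car C p n \<subseteq> cone_car C (p + 1) n"
      by (auto simp: cone_car_def cone_simps e)
    show "oper (cone k X) i p ` cone_car C p n \<subseteq> cone_car C p (n + 1)" for i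
    proof -
      have "oper X i (p + 1) b \<in> C (p + 1) n" if "b \<in> C (p + 1) (n - 1)" for b
        using that by simp
      then show ?thesis by (auto simp: cone_car_def cone_simps)
    qed
  qed
qed

text \<open>Acyclicity of the quotient complex \<open>C / C'\<close>, stated without forming the quotient.\<close>

definition rel_acyclic :: "'a op_complex \<Rightarrow> (int \<Rightarrow> int \<Rightarrow> 'a set) \<Rightarrow> (int \<Rightarrow> int \<Rightarrow> 'a set) \<Rightarrow> int \<Rightarrow> int \<Rightarrow> bool" where
  "rel_acyclic X C C' p n \<longleftrightarrow> (\<forall>a \<in> C p n. diff X p a \<in> C' (p + 1) n \<longrightarrow>
     (\<exists>b \<in> C (p - 1) n. \<exists>c \<in> C' p n. a = diff X (p - 1) b \<oplus>\<^bsub>grp X p\<^esub> c))"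

text \<open>Ordinary acyclicity is treated as acyclicity relative to zero, so the relative cone
  lemma covers both.\<close>

definition zero_car :: "'a op_complex \<Rightarrow> int \<Rightarrow> int \<Rightarrow> 'a set" where
  "zero_car X p n = {\<zero>\<^bsub>grp X p\<^esub>}"

abbreviation acyclic_at where "acyclic_at X C \<equiv> rel_acyclic X C (zero_car X)"

lemma op_subcomplex_zero: "op_complex X \<Longrightarrow> op_subcomplex X (zero_car X)"
proof -
  assume "op_complex X"
  then interpret op_complex X .
  show ?thesis
    by (auto simp: op_subcomplex_def zero_car_def intro!: additive_subgroupI'[OF grp])
qed

lemma cone_zero_car: "cone_car (zero_car X) = zero_car (cone k X)"
  by (intro ext) (auto simp: cone_car_def zero_car_def cone_simps)

lemma (in complex_with_sub) acyclic_at_iff: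
  "acyclic_at X C p n \<longleftrightarrow>
     (\<forall>a \<in> C p n. diff X p a = \<zero>\<^bsub>grp X (p + 1)\<^esub> \<longrightarrow> (\<exists>b \<in> C (p - 1) n. a = diff X (p - 1) b))"
  using carr[OF C_d'] by (auto simp: rel_acyclic_def zero_car_def)

text \<open>The quotient of the cones is an extension of the part at \<open>(p + 1, n - 1)\<close>
  by the part at \<open>(p, n)\<close>. The second entry is solved first; correcting the first entry
  by the operator applied to that solution turns it into a relative cocycle.\<close>

lemma rel_acyclic_cone:
  assumes X: "op_complex X" and C: "op_subcomplex X C" and C': "op_subcomplex X C'" and le: "\<And>p n. C' p n \<subseteq> C p n"
    and ac: "rel_acyclic X C C' p n" "rel_acyclic X C C' (p + 1) (n - 1)"
  shows "rel_acyclic (cone k X) (cone_car C) (cone_car C') p n"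
  unfolding rel_acyclic_def
proof (intro ballI impI)
  interpret C: complex_with_sub X C using X C by (rule complex_with_subI)
  interpret C': complex_with_sub X C' using X C' by (rule complex_with_subI)
  let ?G = "grp X p" and ?G1 = "grp X (p + 1)"
  have e: "p + 1 + 1 = p + 2" by simp
  fix u assume "u \<in> cone_car C p n" and du: "diff (cone k X) p u \<in> cone_car C' (p + 1) n"
  then obtain a b where u: "u = Node a b" and a: "a \<in> C p n" and b: "b \<in> C (p + 1) (n - 1)"
    by (auto simp: cone_car_def)
  from du have dab: "diff X p a \<oplus>\<^bsub>?G1\<^esub> oper X k (p + 1) b \<in> C' (p + 1) n"
    and ndb: "\<ominus>\<^bsub>grp X (p + 2)\<^esub> diff X (p + 1) b \<in> C' (p + 2) (n - 1)"
    by (auto simp: u cone_simps cone_car_def e)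
  have "diff X (p + 1) b \<in> C' (p + 2) (n - 1)"
    using C'.C_minus[OF ndb] C.carr[OF C.C_d2[OF b]] by simp
  then obtain b' c2 where b': "b' \<in> C p (n - 1)" and c2: "c2 \<in> C' (p + 1) (n - 1)"
    and b_eq: "b = diff X p b' \<oplus>\<^bsub>?G1\<^esub> c2"
    using ac(2) b by (auto simp: rel_acyclic_def e)
  note cr = C.carr[OF a] C.carr[OF b] C.carr[OF b'] C'.carr[OF c2]
  define a1 where "a1 = a \<oplus>\<^bsub>?G\<^esub> oper X k p b'"
  have a1: "a1 \<in> C p n" using a b' by (simp add: a1_def)
  have xb: "oper X k (p + 1) b = diff X p (oper X k p b') \<oplus>\<^bsub>?G1\<^esub> oper X k (p + 1) c2"
    using cr by (simp add: b_eq C.diff_oper)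
  have "diff X p a1 = (diff X p a \<oplus>\<^bsub>?G1\<^esub> oper X k (p + 1) b) \<oplus>\<^bsub>?G1\<^esub> (\<ominus>\<^bsub>?G1\<^esub> oper X k (p + 1) c2)"
    using cr by (simp add: a1_def xb C.G.a_assoc C.G.r_neg)
  then have "diff X p a1 \<in> C' (p + 1) n" using dab c2 by simp
  then obtain a' c1 where a': "a' \<in> C (p - 1) n" and c1: "c1 \<in> C' p n"
    and a1_eq: "a1 = diff X (p - 1) a' \<oplus>\<^bsub>?G\<^esub> c1"
    using ac(1) a1 by (auto simp: rel_acyclic_def)
  note cr = cr C.carr[OF C.C_d'[OF a']] C'.carr[OF c1]
  have "a = a1 \<oplus>\<^bsub>?G\<^esub> (\<ominus>\<^bsub>?G\<^esub> oper X k p b')"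
    using cr by (simp add: a1_def C.G.a_assoc C.G.r_neg)
  then have a_eq: "a = (diff X (p - 1) a' \<oplus>\<^bsub>?G\<^esub> (\<ominus>\<^bsub>?G\<^esub> oper X k p b')) \<oplus>\<^bsub>?G\<^esub> c1"
    using cr by (simp add: a1_eq C.G.a_ac)
  \<comment> \<open>The witness carries \<open>b'\<close> with a minus sign to cancel the sign in
    the cone differential.\<close>
  have "u = diff (cone k X) (p - 1) (Node a' (\<ominus>\<^bsub>?G\<^esub> b')) \<oplus>\<^bsub>grp (cone k X) p\<^esub> Node c1 c2"
    using cr a_eq b_eq by (simp add: u cone_simps add.commute[of 1 p])
  moreover have "Node a' (\<ominus>\<^bsub>?G\<^esub> b') \<in> cone_car C (p - 1) n"
    using a' b' by (simp add: cone_car_def)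
  moreover have "Node c1 c2 \<in> cone_car C' p n" using c1 c2 by (simp add: cone_car_def)
  ultimately show "\<exists>v \<in> cone_car C (p - 1) n. \<exists>c \<in> cone_car C' p n.
      u = diff (cone k X) (p - 1) v \<oplus>\<^bsub>grp (cone k X) p\<^esub> c" by blast
qed

lemma acyclic_cone:
  assumes X: "op_complex X" and C: "op_subcomplex X C"
    and ac: "acyclic_at X C p n" "acyclic_at X C (p + 1) (n - 1)"
  shows "acyclic_at (cone k X) (cone_car C) p n"
proof -
  interpret C: complex_with_sub X C using X C by (rule complex_with_subI)
  show ?thesis
    using rel_acyclic_cone[OF X C op_subcomplex_zero[OF X] _ ac, of k] by (simp add: cone_zero_car[of X k] zero_car_def[of X])
qed

text \<open>In the exact sequence H^p(X) in degree \<open>n - 1\<close>, H^p(X) in degree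
  \<open>n\<close>, H^p(cone) in degree \<open>n\<close>, the first map is multiplication by
  \<open>x_k\<close>. Vanishing of the first term makes the second map injective.\<close>

lemma acyclic_of_cone:
  assumes X: "op_complex X" and C: "op_subcomplex X C"
    and ac: "acyclic_at (cone k X) (cone_car C) p n" "acyclic_at X C p (n - 1)"
  shows "acyclic_at X C p n"
proof -
  interpret C: complex_with_sub X C using X C by (rule complex_with_subI)
  interpret K: complex_with_sub "cone k X" "cone_car C"
    by (rule complex_with_subI[OF op_complex_cone[OF X] op_subcomplex_cone[OF X C]])
  have e: "p - 1 + 2 = p + 1" by simp
  show ?thesis
    unfolding C.acyclic_at_iff
  proof (intro ballI impI)
    fix z assume z: "z \<in> C p n" and dz: "diff X p z = \<zero>\<^bsub>grp X (p + 1)\<^esub>"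
    have "Node z \<zero>\<^bsub>grp X (p + 1)\<^esub> \<in> cone_car C p n" using z by (simp add: cone_car_def)
    moreover have "diff X (p + 1) \<zero>\<^bsub>grp X (p + 1)\<^esub> = \<zero>\<^bsub>grp X (p + 2)\<^esub>"
      using C.d_zero[of "p + 1"] by (simp add: add.assoc)
    then have "diff (cone k X) p (Node z \<zero>\<^bsub>grp X (p + 1)\<^esub>) = \<zero>\<^bsub>grp (cone k X) (p + 1)\<^esub>"
      by (simp add: cone_simps dz add.assoc)
    ultimately obtain v where "v \<in> cone_car C (p - 1) n"
      and v: "Node z \<zero>\<^bsub>grp X (p + 1)\<^esub> = diff (cone k X) (p - 1) v"
      using ac(1) unfolding K.acyclic_at_iff by blast
    then obtain a b where ab: "v = Node a b" "a \<in> C (p - 1) n" "b \<in> C p (n - 1)"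
      by (auto simp: cone_car_def)
    \<comment> \<open>A primitive of \<open>(z, 0)\<close> gives \<open>z = d a + x_k b\<close> with
      \<open>b\<close> a cocycle one degree lower. Writing \<open>b\<close> as a boundary turns
      \<open>x_k b\<close> into one.\<close>
    from v have z_eq: "z = diff X (p - 1) a \<oplus>\<^bsub>grp X p\<^esub> oper X k p b"
      and db: "\<zero>\<^bsub>grp X (p + 1)\<^esub> = \<ominus>\<^bsub>grp X (p + 1)\<^esub> diff X p b"
      by (simp_all add: ab cone_simps e)
    have "diff X p b = \<ominus>\<^bsub>grp X (p + 1)\<^esub> (\<ominus>\<^bsub>grp X (p + 1)\<^esub> diff X p b)"
      using C.carr[OF ab(3)] by simp
    also have "\<dots> = \<zero>\<^bsub>grp X (p + 1)\<^esub>" by (simp add: db[symmetric])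
    finally obtain c where c: "c \<in> C (p - 1) (n - 1)" "b = diff X (p - 1) c"
      using ac(2) ab(3) unfolding C.acyclic_at_iff by blast
    have "z = diff X (p - 1) (a \<oplus>\<^bsub>grp X (p - 1)\<^esub> oper X k (p - 1) c)"
      using C.carr[OF ab(2)] C.carr[OF c(1)] C.diff_oper[of c "p - 1"] C.d_add[of a "p - 1"]
      by (simp add: z_eq c(2))
    then show "\<exists>y \<in> C (p - 1) n. z = diff X (p - 1) y"
      by (rule bexI) (use ab(2) c(1) in simp)
  qed
qed

text \<open>The operator acts bijectively on \<open>C / C'\<close>.\<close>

definition op_bij :: "'a op_complex \<Rightarrow> (int \<Rightarrow> int \<Rightarrow> 'a set) \<Rightarrow> (int \<Rightarrow> int \<Rightarrow> 'a set) \<Rightarrow> nat \<Rightarrow> bool" where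
  "op_bij X C C' k \<longleftrightarrow> (\<forall>p n. (\<forall>a \<in> C p n. oper X k p a \<in> C' p (n + 1) \<longrightarrow> a \<in> C' p n) \<and>
     (\<forall>a \<in> C p n. \<exists>b \<in> C p (n - 1). \<exists>c \<in> C' p n. a = oper X k p b \<oplus>\<^bsub>grp X p\<^esub> c))"

lemma op_bij_cone:
  assumes "op_bij X C C' k"
  shows "op_bij (cone j X) (cone_car C) (cone_car C') k"
  unfolding op_bij_def
proof (intro allI conjI ballI impI)
  fix p n u assume u: "u \<in> cone_car C p n"
  then obtain a b where ab: "u = Node a b" "a \<in> C p n" "b \<in> C (p + 1) (n - 1)"
    by (auto simp: cone_car_def)
  show "u \<in> cone_car C' p n" if "oper (cone j X) k p u \<in> cone_car C' p (n + 1)"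
  proof -
    from that have "oper X k p a \<in> C' p (n + 1)" "oper X k (p + 1) b \<in> C' (p + 1) (n - 1 + 1)"
      by (auto simp: ab cone_simps cone_car_def)
    then have "a \<in> C' p n" "b \<in> C' (p + 1) (n - 1)" using assms ab unfolding op_bij_def by blast+
    then show ?thesis by (simp add: ab cone_car_def)
  qed
  obtain b1 c1 where 1: "b1 \<in> C p (n - 1)" "c1 \<in> C' p n" "a = oper X k p b1 \<oplus>\<^bsub>grp X p\<^esub> c1"
    using assms ab unfolding op_bij_def by blast
  obtain b2 c2 where 2: "b2 \<in> C (p + 1) (n - 1 - 1)" "c2 \<in> C' (p + 1) (n - 1)"
    "b = oper X k (p + 1) b2 \<oplus>\<^bsub>grp X (p + 1)\<^esub> c2"
    using assms ab unfolding op_bij_def by blast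
  have "Node b1 b2 \<in> cone_car C p (n - 1)" "Node c1 c2 \<in> cone_car C' p n"
    "u = oper (cone j X) k p (Node b1 b2) \<oplus>\<^bsub>grp (cone j X) p\<^esub> Node c1 c2"
    using 1 2 by (simp_all add: cone_car_def cone_simps ab)
  then show "\<exists>b \<in> cone_car C p (n - 1). \<exists>c \<in> cone_car C' p n.
      u = oper (cone j X) k p b \<oplus>\<^bsub>grp (cone j X) p\<^esub> c" by blast
qed

text \<open>The cone of an isomorphism is acyclic. Surjectivity gives \<open>a = x_k y\<close>
  modulo \<open>C'\<close>; the cocycle condition puts \<open>x_k (b + d y)\<close> into
  \<open>C'\<close>, injectivity gives \<open>b = - d y\<close> modulo \<open>C'\<close>, and so
  \<open>(0, y)\<close> is a primitive.\<close>

lemma rel_acyclic_cone_op_bij: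
  assumes X: "op_complex X" and C: "op_subcomplex X C" and C': "op_subcomplex X C'" and le: "\<And>p n. C' p n \<subseteq> C p n"
    and bij: "op_bij X C C' k"
  shows "rel_acyclic (cone k X) (cone_car C) (cone_car C') p n"
  unfolding rel_acyclic_def
proof (intro ballI impI)
  interpret C: complex_with_sub X C using X C by (rule complex_with_subI)
  interpret C': complex_with_sub X C' using X C' by (rule complex_with_subI)
  let ?G = "grp X p" and ?G1 = "grp X (p + 1)"
  have e: "p + 1 + 1 = p + 2" by simp
  fix u assume "u \<in> cone_car C p n" and du: "diff (cone k X) p u \<in> cone_car C' (p + 1) n"
  then obtain a b where u: "u = Node a b" and a: "a \<in> C p n" and b: "b \<in> C (p + 1) (n - 1)"
    by (auto simp: cone_car_def)
  from du have dab: "diff X p a \<oplus>\<^bsub>?G1\<^esub> oper X k (p + 1) b \<in> C' (p + 1) n"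
    by (auto simp: u cone_simps cone_car_def e)
  obtain y c1 where y: "y \<in> C p (n - 1)" and c1: "c1 \<in> C' p n" and a_eq: "a = oper X k p y \<oplus>\<^bsub>?G\<^esub> c1"
    using bij a unfolding op_bij_def by blast
  define c2 where "c2 = b \<oplus>\<^bsub>?G1\<^esub> diff X p y"
  have c2C: "c2 \<in> C (p + 1) (n - 1)" using b y by (simp add: c2_def)
  note cr = C.carr[OF a] C.carr[OF b] C.carr[OF y] C'.carr[OF c1]
  have "oper X k (p + 1) c2 = (diff X p a \<oplus>\<^bsub>?G1\<^esub> oper X k (p + 1) b) \<oplus>\<^bsub>?G1\<^esub> (\<ominus>\<^bsub>?G1\<^esub> diff X p c1)"
  proof -
    have "(diff X p a \<oplus>\<^bsub>?G1\<^esub> oper X k (p + 1) b) \<oplus>\<^bsub>?G1\<^esub> (\<ominus>\<^bsub>?G1\<^esub> diff X p c1) =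
        oper X k (p + 1) c2 \<oplus>\<^bsub>?G1\<^esub> (diff X p c1 \<oplus>\<^bsub>?G1\<^esub> (\<ominus>\<^bsub>?G1\<^esub> diff X p c1))"
      using cr by (simp add: c2_def a_eq C.diff_oper C.G.a_ac)
    then show ?thesis using cr by (simp add: c2_def C.G.r_neg)
  qed
  then have "oper X k (p + 1) c2 \<in> C' (p + 1) (n - 1 + 1)" using dab c1 by simp
  then have c2: "c2 \<in> C' (p + 1) (n - 1)" using bij c2C unfolding op_bij_def by blast
  have b_eq: "b = \<ominus>\<^bsub>?G1\<^esub> diff X p y \<oplus>\<^bsub>?G1\<^esub> c2"
    using cr by (simp add: c2_def C.G.a_lcomm[of "\<ominus>\<^bsub>?G1\<^esub> diff X p y"] C.G.l_neg)
  have "u = diff (cone k X) (p - 1) (Node \<zero>\<^bsub>grp X (p - 1)\<^esub> y) \<oplus>\<^bsub>grp (cone k X) p\<^esub> Node c1 c2"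
    using cr a_eq b_eq C.d_zero[of "p - 1"] by (simp add: u cone_simps add.commute[of 1 p])
  moreover have "Node \<zero>\<^bsub>grp X (p - 1)\<^esub> y \<in> cone_car C (p - 1) n"
    using y by (simp add: cone_car_def)
  moreover have "Node c1 c2 \<in> cone_car C' p n" using c1 c2 by (simp add: cone_car_def)
  ultimately show "\<exists>v \<in> cone_car C (p - 1) n. \<exists>c \<in> cone_car C' p n.
      u = diff (cone k X) (p - 1) v \<oplus>\<^bsub>grp (cone k X) p\<^esub> c" by blast
qed

text \<open>This is the segment H^(p-1)(C / C') -> H^p(C') -> H^p(C) of the long exact sequence,
  which explains the position \<open>p - 1\<close>.\<close>

lemma acyclic_sub:
  assumes X: "op_complex X" and C: "op_subcomplex X C" and C': "op_subcomplex X C'" and le: "\<And>p n. C' p n \<subseteq> C p n"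
    and rel: "rel_acyclic X C C' (p - 1) n" and ac: "acyclic_at X C p n"
  shows "acyclic_at X C' p n"
proof -
  interpret C: complex_with_sub X C using X C by (rule complex_with_subI)
  interpret C': complex_with_sub X C' using X C' by (rule complex_with_subI)
  show ?thesis
    unfolding C'.acyclic_at_iff
  proof (intro ballI impI)
    fix z assume z: "z \<in> C' p n" "diff X p z = \<zero>\<^bsub>grp X (p + 1)\<^esub>"
    then obtain y where y: "y \<in> C (p - 1) n" "z = diff X (p - 1) y"
      using ac le unfolding C.acyclic_at_iff by blast
    have "diff X (p - 1) y \<in> C' (p - 1 + 1) n" using z y by simp
    then obtain b c where b: "b \<in> C (p - 1 - 1) n" and c: "c \<in> C' (p - 1) n"
      and y_eq: "y = diff X (p - 1 - 1) b \<oplus>\<^bsub>grp X (p - 1)\<^esub> c"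
      using rel y(1) unfolding rel_acyclic_def by blast
    have "diff X (p - 1) (diff X (p - 1 - 1) b) = \<zero>\<^bsub>grp X p\<^esub>"
      using C.diff_diff[of b "p - 2"] C.carr[OF b] by simp
    then have "z = diff X (p - 1) c"
      using C.carr[OF C.C_d'[OF b]] C'.carr[OF c] C'.carr[OF z(1)] C.d_add[of _ "p - 1"] C.d_closed[of c "p - 1"]
      by (simp add: y(2) y_eq)
    then show "\<exists>y \<in> C' (p - 1) n. z = diff X (p - 1) y" using c by blast
  qed
qed

text \<open>This is the segment H^p(C') -> H^p(C) -> H^p(C / C') of the long exact sequence.\<close>

lemma acyclic_super:
  assumes X: "op_complex X" and C: "op_subcomplex X C" and C': "op_subcomplex X C'" and le: "\<And>p n. C' p n \<subseteq> C p n"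
    and rel: "rel_acyclic X C C' p n" and ac: "acyclic_at X C' p n"
  shows "acyclic_at X C p n"
proof -
  interpret C: complex_with_sub X C using X C by (rule complex_with_subI)
  interpret C': complex_with_sub X C' using X C' by (rule complex_with_subI)
  show ?thesis
    unfolding C.acyclic_at_iff
  proof (intro ballI impI)
    fix z assume z: "z \<in> C p n" "diff X p z = \<zero>\<^bsub>grp X (p + 1)\<^esub>"
    then obtain b c where b: "b \<in> C (p - 1) n" and c: "c \<in> C' p n"
      and z_eq: "z = diff X (p - 1) b \<oplus>\<^bsub>grp X p\<^esub> c"
      using rel unfolding rel_acyclic_def by fastforce
    have "diff X p (diff X (p - 1) b) = \<zero>\<^bsub>grp X (p + 1)\<^esub>"
      using C.diff_diff[of b "p - 1"] C.carr[OF b] by (simp add: add.commute[of 1 p])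
    then have "diff X p c = \<zero>\<^bsub>grp X (p + 1)\<^esub>"
      using z(2) C.carr[OF C.C_d'[OF b]] C'.carr[OF c] by (simp add: z_eq)
    then obtain y where y: "y \<in> C' (p - 1) n" "c = diff X (p - 1) y"
      using ac c unfolding C'.acyclic_at_iff by blast
    have "z = diff X (p - 1) (b \<oplus>\<^bsub>grp X (p - 1)\<^esub> y)"
      using C.carr[OF b] C'.carr[OF y(1)] C.d_add[of b "p - 1"] by (simp add: z_eq y(2))
    moreover have "y \<in> C (p - 1) n" using y(1) le by blast
    ultimately show "\<exists>y \<in> C (p - 1) n. z = diff X (p - 1) y" using C.C_add[OF b] by blast
  qed
qed

section \<open>Koszul complexes as iterated cones\<close>

fun koszul :: "nat \<Rightarrow> 'a cone_tree op_complex \<Rightarrow> 'a cone_tree op_complex" where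
  "koszul 0 X = X"
| "koszul (Suc s) X = cone s (koszul s X)"

fun koszul_car :: "nat \<Rightarrow> (int \<Rightarrow> int \<Rightarrow> 'a cone_tree set) \<Rightarrow> int \<Rightarrow> int \<Rightarrow> 'a cone_tree set" where
  "koszul_car 0 C = C"
| "koszul_car (Suc s) C = cone_car (koszul_car s C)"

lemma op_complex_koszul: "op_complex X \<Longrightarrow> op_complex (koszul s X)"
  by (induction s) (auto intro: op_complex_cone)

lemma op_subcomplex_koszul: "op_complex X \<Longrightarrow> op_subcomplex X C \<Longrightarrow> op_subcomplex (koszul s X) (koszul_car s C)"
  by (induction s) (auto intro: op_subcomplex_cone op_complex_koszul)

lemma koszul_car_mono: "(\<And>p n. C' p n \<subseteq> C p n) \<Longrightarrow> koszul_car s C' p n \<subseteq> koszul_car s C p n"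
proof (induction s arbitrary: p n)
  case (Suc s)
  then show ?case unfolding koszul_car.simps cone_car_def by blast
qed auto

text \<open>A cone over an acyclic quotient is an extension of two acyclic pieces, so it is enough
  to reach acyclicity at some stage \<open>m\<close>.\<close>

lemma rel_acyclic_koszul:
  assumes X: "op_complex X" and C: "op_subcomplex X C" and C': "op_subcomplex X C'" and le: "\<And>p n. C' p n \<subseteq> C p n"
    and rel: "\<And>p n. rel_acyclic (koszul m X) (koszul_car m C) (koszul_car m C') p n" and "m \<le> s"
  shows "rel_acyclic (koszul s X) (koszul_car s C) (koszul_car s C') p n"
  using \<open>m \<le> s\<close>
proof (induction s arbitrary: p n rule: dec_induct)
  case base
  then show ?case by (rule rel)
next
  case (step s)
  show ?case
    unfolding koszul.simps koszul_car.simps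
    by (intro rel_acyclic_cone op_complex_koszul op_subcomplex_koszul X C C' koszul_car_mono le step.IH)
qed

lemma op_bij_koszul: "op_bij X C C' k \<Longrightarrow> op_bij (koszul s X) (koszul_car s C) (koszul_car s C') k"
  by (induction s) (auto intro: op_bij_cone)

text \<open>The first \<open>k\<close> cones keep \<open>x_k\<close> bijective on
  \<open>C / C'\<close>, the next one is the cone of this bijection and kills the quotient, and the
  remaining ones keep it acyclic.\<close>

lemma acyclic_koszul_sub:
  assumes X: "op_complex X" and C: "op_subcomplex X C" and C': "op_subcomplex X C'" and le: "\<And>p n. C' p n \<subseteq> C p n"
    and bij: "op_bij X C C' k" and k: "k < s"
    and ac: "acyclic_at (koszul s X) (koszul_car s C) p n"
  shows "acyclic_at (koszul s X) (koszul_car s C') p n"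
proof (rule acyclic_sub[OF _ _ _ _ _ ac])
  show "rel_acyclic (koszul s X) (koszul_car s C) (koszul_car s C') (p - 1) n"
  proof (rule rel_acyclic_koszul[OF X C C' le])
    show "rel_acyclic (koszul (Suc k) X) (koszul_car (Suc k) C) (koszul_car (Suc k) C') p n" for p n
      unfolding koszul.simps koszul_car.simps
      by (intro rel_acyclic_cone_op_bij op_complex_koszul op_subcomplex_koszul X C C' koszul_car_mono le op_bij_koszul bij)
  qed (use k in auto)
qed (intro op_complex_koszul op_subcomplex_koszul X C C' koszul_car_mono le)+

text \<open>Two neighbouring antidiagonals interact: vanishing on the lower one climbs from
  \<open>X\<close> through all cones, and with its help vanishing on the upper one descends from the
  full Koszul complex back to \<open>X\<close>.\<close>

lemma acyclic_of_koszul: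
  assumes X: "op_complex X" and C: "op_subcomplex X C"
    and low: "\<And>p. p \<ge> 0 \<Longrightarrow> acyclic_at X C p (t - p)"
    and kz: "\<And>p. p \<ge> 0 \<Longrightarrow> acyclic_at (koszul s X) (koszul_car s C) p (t + 1 - p)"
    and p: "p \<ge> 0"
  shows "acyclic_at X C p (t + 1 - p)"
proof -
  have low': "acyclic_at (koszul j X) (koszul_car j C) p (t - p)" if "p \<ge> 0" for j p
    using that
  proof (induction j arbitrary: p)
    case (Suc j)
    \<comment> \<open>The cone at position \<open>p\<close> involves position \<open>p + 1\<close>
      one degree lower, a point of the same antidiagonal; positions only increase, so the range
      \<open>p \<ge> 0\<close> is never left.\<close>
    have "acyclic_at (koszul j X) (koszul_car j C) (p + 1) (t - p - 1)"
      using Suc.IH[of "p + 1"] Suc.prems by (simp add: diff_diff_eq)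
    then show ?case
      using Suc.IH[of p] Suc.prems
      by (simp add: acyclic_cone op_complex_koszul op_subcomplex_koszul X C)
  qed (use low in auto)
  have "j \<le> s \<Longrightarrow> acyclic_at (koszul j X) (koszul_car j C) p (t + 1 - p)" for j
  proof (induction j rule: inc_induct)
    case base
    then show ?case using kz[OF p] .
  next
    case (step j)
    have "acyclic_at (koszul j X) (koszul_car j C) p (t + 1 - p - 1)"
      using low'[OF p, of j] by simp
    with step.IH show ?case
      unfolding koszul.simps koszul_car.simps
      by (rule acyclic_of_cone[OF op_complex_koszul[OF X] op_subcomplex_koszul[OF X C]])
  qed
  from this[of 0] show ?thesis by simp
qed

section \<open>Generators of the irrelevant ideal\<close>

context graded_ring begin

abbreviation "rc \<equiv> hcomp R (rcomp R)"

text \<open>Components of degree 2 and above cannot contribute to degrees 0 and 1 of a product. The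
  two formulas make conditions on \<open>rc 0\<close> and \<open>rc 1\<close> stable under
  multiplication.\<close>

lemma hcomp_mult_0_1:
  assumes a: "a \<in> carrier R" and b: "b \<in> carrier R"
  shows "rc 0 (a \<otimes> b) = rc 0 a \<otimes> rc 0 b \<and> rc 1 (a \<otimes> b) = rc 0 a \<otimes> rc 1 b \<oplus> rc 1 a \<otimes> rc 0 b"
  using a
proof (induction rule: rg.homogeneous_induct)
  case zero
  then show ?case using b rg.hcomp_carrier by (simp add: rg.hcomp_zero)
next
  case (homogeneous m a)
  have aR: "a \<in> carrier R" using homogeneous by (rule rg.comp_carrier)
  note h = rg.hcomp_homogeneous[OF homogeneous]
  consider "m = 0" | "m = 1" | "1 < m" by linarith
  then show ?case
  proof cases
    case 1
    then show ?thesis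
      using hcomp_mult(1)[OF homogeneous b, of 0] hcomp_mult(1)[OF homogeneous b, of 1] h aR b rg.hcomp_carrier
      by simp
  next
    case 2
    then show ?thesis
      using hcomp_mult(1)[OF homogeneous b, of 0] hcomp_mult(2)[OF homogeneous b, of 0] h aR b rg.hcomp_carrier
      by simp
  next
    case 3
    then show ?thesis
      using hcomp_mult(2)[OF homogeneous b] h aR b rg.hcomp_carrier by simp
  qed
next
  case (add y z)
  then show ?case
    using b rg.hcomp_carrier by (simp add: rg.hcomp_add l_distr a_ac)
qed

lemma rcomp0_subring: "subring (rcomp R 0) R"
proof (rule subringI)
  show "rcomp R 0 \<subseteq> carrier R" using rg.comp_carrier by blast
  show "h1 \<otimes> h2 \<in> rcomp R 0" if "h1 \<in> rcomp R 0" "h2 \<in> rcomp R 0" for h1 h2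
    using mult_comp[OF that] by simp
qed (auto intro: one_degree_zero rg.comp_minus rg.comp_add)

lemma rc_minus: "a \<in> carrier R \<Longrightarrow> rc n (\<ominus> a) = \<ominus> rc n a"
proof -
  assume a: "a \<in> carrier R"
  have "rc n (\<ominus> a) \<oplus> rc n a = \<zero>"
    using a rg.hcomp_add[of "\<ominus> a" a n] by (simp add: l_neg rg.hcomp_zero)
  then show ?thesis using a rg.hcomp_carrier by (metis a_inv_closed minus_equality)
qed

lemma irrelevant_hcomp_zero:
  assumes "a \<in> irrelevant_ideal R"
  shows "a \<in> carrier R" "rc 0 a = \<zero>"
proof -
  obtain f A where a: "a = finsum R f A" "finite A" "A \<subseteq> {1..}" "\<forall>n\<in>A. f n \<in> rcomp R n"
    using assms unfolding irrelevant_ideal_def by blast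
  then show "a \<in> carrier R" using rg.comp_carrier by (auto intro!: finsum_closed)
  have "rc 0 a = (if 0 \<in> A then f 0 else \<zero>)"
  proof (rule rg.hcomp_unique'[where A = A])
    show "a = finsum R (\<lambda>n. if n \<in> A then f n else \<zero>) A"
      unfolding a(1) using a rg.comp_carrier by (intro finsum_cong') auto
  qed (use a rg.comp_zero in auto)
  then show "rc 0 a = \<zero>" using a by auto
qed

lemma homogeneous_in_irrelevant:
  assumes "a \<in> rcomp R n" "n \<ge> 1"
  shows "a \<in> irrelevant_ideal R"
proof -
  have "a = finsum R (\<lambda>_. a) {n}" using rg.comp_carrier[OF assms(1)] by simp
  then show ?thesis using assms unfolding irrelevant_ideal_def by blast
qed

end

text \<open>The given algebra generators may be inhomogeneous, but their degree 1 parts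
  \<open>T\<close> suffice. Elements whose degree 1 part lies in \<open>R_0[T]\<close> form a
  subring containing \<open>R_0\<close> and the generators; hence \<open>R_1\<close> lies in
  \<open>R_0[T]\<close>, which is then all of \<open>R\<close> by standard grading. Similarly, for
  an ideal \<open>I\<close> containing \<open>T\<close>, the elements congruent to their degree 0
  part modulo \<open>I\<close> form a subring, so it is all of \<open>R\<close>.\<close>

lemma degree_one_generators:
  assumes st: "standard_graded R" and fg: "finitely_generated_algebra R"
  obtains S where "finite S" "S \<subseteq> rcomp R 1" "generate_ring R (rcomp R 0 \<union> S) = carrier R"
    "\<And>I. ideal I R \<Longrightarrow> S \<subseteq> I \<Longrightarrow> irrelevant_ideal R \<subseteq> I"
proof -
  interpret graded_ring R using st by (simp add: standard_graded_def)
  obtain S where S: "finite S" "S \<subseteq> carrier R" "generate_ring R (rcomp R 0 \<union> S) = carrier R"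
    using fg unfolding finitely_generated_algebra_def by blast
  have R01: "generate_ring R (rcomp R 0 \<union> rcomp R 1) = carrier R"
    using st by (simp add: standard_graded_def)
  define T where "T = rc 1 ` S"
  have T1: "T \<subseteq> rcomp R 1" using S rg.hcomp_in unfolding T_def by auto
  have TR: "rcomp R 0 \<union> T \<subseteq> carrier R" using T1 rg.comp_carrier by blast
  define B where "B = generate_ring R (rcomp R 0 \<union> T)"
  have B: "subring B R" unfolding B_def using TR by (rule generate_ring_is_subring)
  have B0: "rcomp R 0 \<union> T \<subseteq> B" unfolding B_def by (auto intro: generate_ring.incl)
  have "subring {a \<in> carrier R. rc 1 a \<in> B} R"
  proof (rule subringI)
    show "\<one>\<^bsub>R\<^esub> \<in> {a \<in> carrier R. rc 1 a \<in> B}"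
      using rg.hcomp_homogeneous[OF one_degree_zero, of 1] subringE(2)[OF B] by simp
    fix a b assume a: "a \<in> {a \<in> carrier R. rc 1 a \<in> B}" 
    show "\<ominus>\<^bsub>R\<^esub> a \<in> {a \<in> carrier R. rc 1 a \<in> B}"
      using a subringE(5)[OF B] by (simp add: rc_minus)
    assume b: "b \<in> {a \<in> carrier R. rc 1 a \<in> B}"
    show "a \<oplus>\<^bsub>R\<^esub> b \<in> {a \<in> carrier R. rc 1 a \<in> B}"
      using a b subringE(7)[OF B] by (simp add: rg.hcomp_add)
    have "rc 0 a \<in> B" "rc 0 b \<in> B" using a b rg.hcomp_in B0 by auto
    then show "a \<otimes>\<^bsub>R\<^esub> b \<in> {a \<in> carrier R. rc 1 a \<in> B}"
      using a b subringE(6,7)[OF B] hcomp_mult_0_1[of a b] by simp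
  qed auto
  moreover have "rcomp R 0 \<union> S \<subseteq> {a \<in> carrier R. rc 1 a \<in> B}"
  proof
    fix a assume "a \<in> rcomp R 0 \<union> S"
    then show "a \<in> {a \<in> carrier R. rc 1 a \<in> B}"
    proof
      assume "a \<in> rcomp R 0"
      then show ?thesis
        using rg.hcomp_homogeneous[of a 0 1] subringE(2)[OF B] rg.comp_carrier by simp
    next
      assume "a \<in> S"
      then show ?thesis using S(2) B0 unfolding T_def by auto
    qed
  qed
  moreover have "rcomp R 0 \<union> S \<subseteq> carrier R" using S rg.comp_carrier by blast
  ultimately have "carrier R \<subseteq> {a \<in> carrier R. rc 1 a \<in> B}"
    using generate_ring_min_subring1[of "rcomp R 0 \<union> S"] S(3) by blast
  then have "rcomp R 1 \<subseteq> B"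
    using rg.hcomp_homogeneous[of _ 1 1] rg.comp_carrier by fastforce
  then have "generate_ring R (rcomp R 0 \<union> rcomp R 1) \<subseteq> B"
    using B B0 rg.comp_carrier by (intro generate_ring_min_subring1) auto
  then have gen: "generate_ring R (rcomp R 0 \<union> T) = carrier R"
    using R01 subringE(1)[OF B] unfolding B_def by auto
  have "irrelevant_ideal R \<subseteq> I" if I: "ideal I R" and TI: "T \<subseteq> I" for I
  proof -
    interpret I: ideal I R by fact
    let ?Q = "{a \<in> carrier R. a \<ominus>\<^bsub>R\<^esub> rc 0 a \<in> I}"
    have c: "rc 0 a \<in> carrier R" if "a \<in> carrier R" for a using that by (rule rg.hcomp_carrier)
    have "subring ?Q R"
    proof (rule subringI)
      show "\<one>\<^bsub>R\<^esub> \<in> ?Q" using rg.hcomp_homogeneous[OF one_degree_zero, of 0] by (simp add: r_neg minus_eq)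
      fix a b assume a: "a \<in> ?Q"
      have "\<ominus>\<^bsub>R\<^esub> a \<ominus>\<^bsub>R\<^esub> rc 0 (\<ominus>\<^bsub>R\<^esub> a) = \<ominus>\<^bsub>R\<^esub> (a \<ominus>\<^bsub>R\<^esub> rc 0 a)"
        using a c by (simp add: rc_minus minus_eq minus_add)
      then show "\<ominus>\<^bsub>R\<^esub> a \<in> ?Q" using a I.a_inv_closed by simp
      assume b: "b \<in> ?Q"
      have "(a \<oplus>\<^bsub>R\<^esub> b) \<ominus>\<^bsub>R\<^esub> rc 0 (a \<oplus>\<^bsub>R\<^esub> b) = (a \<ominus>\<^bsub>R\<^esub> rc 0 a) \<oplus>\<^bsub>R\<^esub> (b \<ominus>\<^bsub>R\<^esub> rc 0 b)"
        using a b c by (simp add: rg.hcomp_add minus_eq minus_add a_ac)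
      then show "a \<oplus>\<^bsub>R\<^esub> b \<in> ?Q" using a b I.a_closed by simp
      have "a \<otimes>\<^bsub>R\<^esub> b \<ominus>\<^bsub>R\<^esub> rc 0 (a \<otimes>\<^bsub>R\<^esub> b) =
          (a \<ominus>\<^bsub>R\<^esub> rc 0 a) \<otimes>\<^bsub>R\<^esub> b \<oplus>\<^bsub>R\<^esub> rc 0 a \<otimes>\<^bsub>R\<^esub> (b \<ominus>\<^bsub>R\<^esub> rc 0 b)"
      proof -
        have "a \<in> carrier R" "b \<in> carrier R" "rc 0 a \<in> carrier R" "rc 0 b \<in> carrier R"
          using a b c by auto
        then show ?thesis by (simp add: hcomp_mult_0_1, algebra)
      qed
      then show "a \<otimes>\<^bsub>R\<^esub> b \<in> ?Q"
        using a b c I.a_closed I.I_l_closed[of "b \<ominus>\<^bsub>R\<^esub> rc 0 b" "rc 0 a"] I.I_r_closed[of "a \<ominus>\<^bsub>R\<^esub> rc 0 a" b]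
        by simp
    qed auto
    moreover have "rcomp R 0 \<union> T \<subseteq> ?Q"
    proof
      fix a assume "a \<in> rcomp R 0 \<union> T"
      then show "a \<in> ?Q"
      proof
        assume "a \<in> rcomp R 0"
        then show ?thesis
          using rg.hcomp_homogeneous[of a 0 0] rg.comp_carrier[of a 0] by (simp add: r_neg minus_eq)
      next
        assume "a \<in> T"
        show ?thesis
        proof -
          have "a \<in> rcomp R 1" using \<open>a \<in> T\<close> T1 by blast
          from rg.hcomp_homogeneous[OF this, of 0] rg.comp_carrier[OF this] show ?thesis
            using \<open>a \<in> T\<close> TI by (auto simp: minus_eq)
        qed
      qed
    qed
    ultimately have Q: "carrier R \<subseteq> ?Q"
      using generate_ring_min_subring1[OF TR] gen by blast
    show ?thesis
    proof
      fix a assume a: "a \<in> irrelevant_ideal R"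
      then have "a \<ominus>\<^bsub>R\<^esub> rc 0 a \<in> I" using Q irrelevant_hcomp_zero(1) by blast
      then show "a \<in> I" using irrelevant_hcomp_zero[OF a] by (simp add: minus_eq)
    qed
  qed
  then show thesis using that[of T] T1 gen S(1) unfolding T_def by blast
qed

text \<open>The sequence is total with all values of degree 1, so that it can index the operators of
  a complex. Generation of \<open>R_+\<close> by the first \<open>r\<close> values is phrased as a
  test on ideals, the form in which it is applied.\<close>

locale module_over_generated = graded_module R M
  for R :: "'r graded_ring" (structure) and M :: "('r, 'm) graded_module" (structure) +
  fixes x :: "nat \<Rightarrow> 'r" and r :: nat
  assumes x1: "x i \<in> rcomp R 1"
    and irrelevant_gen: "ideal I R \<Longrightarrow> x ` {..<r} \<subseteq> I \<Longrightarrow> irrelevant_ideal R \<subseteq> I"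
begin

lemma xR [simp]: "x i \<in> carrier R"
  using x1 rg.comp_carrier by blast

abbreviation "Rplus \<equiv> irrelevant_ideal R"

lemma x_in_Rplus: "x i \<in> Rplus"
  using homogeneous_in_irrelevant[OF x1] by simp

lemma ideal_power_Suc: "ideal_power R Rplus (Suc k) = ideal_prod R Rplus (ideal_power R Rplus k)"
  by (simp add: ideal_power_def)

lemma ideal_power_carrier: "a \<in> ideal_power R Rplus k \<Longrightarrow> a \<in> carrier R"
proof (induction k arbitrary: a)
  case 0
  then show ?case by (simp add: ideal_power_def)
next
  case (Suc k)
  from Suc.prems show ?case
    unfolding ideal_power_Suc
    by (induction rule: ideal_prod.induct) (auto simp: Suc.IH irrelevant_hcomp_zero)
qed

lemma x_pow_in: "x i [^] k \<in> ideal_power R Rplus k"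
proof (induction k)
  case 0
  then show ?case by (simp add: ideal_power_def)
next
  case (Suc k)
  have "x i \<otimes> x i [^] k \<in> ideal_power R Rplus (Suc k)"
    unfolding ideal_power_Suc by (rule ideal_prod.prod[OF x_in_Rplus Suc])
  then show ?case by (simp add: m_comm)
qed

section \<open>Torsion tested on the generators of the irrelevant ideal\<close>

definition kills :: "nat \<Rightarrow> 'm \<Rightarrow> bool" where
  "kills k y \<longleftrightarrow> (\<forall>a \<in> ideal_power R Rplus k. a \<odot>\<^bsub>M\<^esub> y = \<zero>\<^bsub>M\<^esub>)"

text \<open>The ideal \<open>R_+^(k+1)\<close> is \<open>R_+ R_+^k\<close>, and by commutativity the
  factor from \<open>R_+\<close> may act first.\<close>

lemma kills_SucI:
  assumes y: "y \<in> carrier M" and h: "\<And>a. a \<in> Rplus \<Longrightarrow> kills k (a \<odot>\<^bsub>M\<^esub> y)"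
  shows "kills (Suc k) y"
  unfolding kills_def ideal_power_Suc
proof
  fix a assume "a \<in> ideal_prod R Rplus (ideal_power R Rplus k)"
  then have "a \<in> carrier R \<and> a \<odot>\<^bsub>M\<^esub> y = \<zero>\<^bsub>M\<^esub>"
  proof (induction rule: ideal_prod.induct)
    case (prod i j)
    then have c: "i \<in> carrier R" "j \<in> carrier R" using irrelevant_hcomp_zero ideal_power_carrier by auto
    have "(i \<otimes> j) \<odot>\<^bsub>M\<^esub> y = j \<odot>\<^bsub>M\<^esub> (i \<odot>\<^bsub>M\<^esub> y)"
      using c y by (simp add: m_comm[of i] smult_assoc1)
    then show ?case using h[OF prod(1)] prod(2) c unfolding kills_def by simp
  next
    case (sum s1 s2)
    then show ?case using y by (simp add: smult_l_distr)
  qed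
  then show "a \<odot>\<^bsub>M\<^esub> y = \<zero>\<^bsub>M\<^esub>" by simp
qed

lemma kills_smult:
  assumes y: "y \<in> carrier M" and c: "c \<in> carrier R" and k: "kills k y"
  shows "kills k (c \<odot>\<^bsub>M\<^esub> y)"
  unfolding kills_def
proof
  fix a assume a: "a \<in> ideal_power R Rplus k"
  then have aR: "a \<in> carrier R" by (rule ideal_power_carrier)
  have "a \<odot>\<^bsub>M\<^esub> (c \<odot>\<^bsub>M\<^esub> y) = c \<odot>\<^bsub>M\<^esub> (a \<odot>\<^bsub>M\<^esub> y)"
    using aR c y by (simp add: smult_assoc1[symmetric] m_comm)
  then show "a \<odot>\<^bsub>M\<^esub> (c \<odot>\<^bsub>M\<^esub> y) = \<zero>\<^bsub>M\<^esub>" using k a c unfolding kills_def by simp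
qed

lemma kills_mono:
  assumes y: "y \<in> carrier M" and "kills k y" "k \<le> l"
  shows "kills l y"
  using \<open>k \<le> l\<close>
proof (induction rule: dec_induct)
  case base
  then show ?case by fact
next
  case (step l)
  show ?case
    by (rule kills_SucI[OF y]) (use kills_smult[OF y] irrelevant_hcomp_zero step.IH in blast)
qed

lemma torsion_kills: "torsion R Rplus M = {y \<in> carrier M. \<exists>k. kills k y}"
  by (simp add: torsion_def kills_def)

text \<open>Induction on the sum of the exponents: passing from \<open>y\<close> to
  \<open>x i \<odot> y\<close> lowers the \<open>i\<close>-th one, so each of these multiples is
  killed by a power of \<open>R_+\<close>, and a common power \<open>L\<close> serves them all. The
  scalars \<open>a\<close> for which \<open>R_+^L\<close> kills \<open>a \<odot> y\<close> form an
  ideal containing the generators.\<close>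

lemma torsion_of_powers:
  assumes "y \<in> carrier M" "\<forall>i<r. (x i [^] (k i :: nat)) \<odot>\<^bsub>M\<^esub> y = \<zero>\<^bsub>M\<^esub>"
  shows "\<exists>l. kills l y"
  using assms
proof (induction "\<Sum>i<r. k i" arbitrary: k y rule: less_induct)
  case less
  show ?case
  proof (cases "\<exists>i<r. k i = 0")
    case True
    \<comment> \<open>An exponent 0 says that 1 kills \<open>y\<close>.\<close>
    then have "y = \<zero>\<^bsub>M\<^esub>" using less.prems by auto
    then show ?thesis
      unfolding kills_def using ideal_power_carrier by auto
  next
    case False
    have "\<exists>l. kills l (x i \<odot>\<^bsub>M\<^esub> y)" if i: "i < r" for i
    proof (rule less.hyps[of "k(i := k i - 1)"])
      have ki: "k i \<noteq> 0" using False i by simp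
      show "(\<Sum>j<r. (k(i := k i - 1)) j) < (\<Sum>j<r. k j)"
        by (rule sum_strict_mono_ex1) (use i ki in auto)
      show "x i \<odot>\<^bsub>M\<^esub> y \<in> carrier M" using less.prems by simp
      show "\<forall>j<r. (x j [^] ((k(i := k i - 1)) j)) \<odot>\<^bsub>M\<^esub> (x i \<odot>\<^bsub>M\<^esub> y) = \<zero>\<^bsub>M\<^esub>"
      proof (intro allI impI)
        fix j assume j: "j < r"
        show "(x j [^] ((k(i := k i - 1)) j)) \<odot>\<^bsub>M\<^esub> (x i \<odot>\<^bsub>M\<^esub> y) = \<zero>\<^bsub>M\<^esub>"
        proof (cases "j = i")
          case True
          have "x i [^] (k i - 1) \<otimes> x i = x i [^] k i"
            using ki nat_pow_Suc[of "x i" "k i - 1"] by simp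
          then show ?thesis
            using True less.prems i by (simp add: smult_assoc1[symmetric])
        next
          case False
          have "(x j [^] k j) \<odot>\<^bsub>M\<^esub> (x i \<odot>\<^bsub>M\<^esub> y) = x i \<odot>\<^bsub>M\<^esub> ((x j [^] k j) \<odot>\<^bsub>M\<^esub> y)"
            using less.prems(1) by (simp add: smult_assoc1[symmetric] m_comm)
          then show ?thesis using False less.prems j by simp
        qed
      qed
    qed
    then obtain l where l: "\<And>i. i < r \<Longrightarrow> kills (l i) (x i \<odot>\<^bsub>M\<^esub> y)" by metis
    define L where "L = Max (insert 0 (l ` {..<r}))"
    have L: "kills L (x i \<odot>\<^bsub>M\<^esub> y)" if "i < r" for i
      using kills_mono[OF _ l[OF that], of L] less.prems(1) that by (simp add: L_def)
    let ?I = "{a \<in> carrier R. kills L (a \<odot>\<^bsub>M\<^esub> y)}"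
    have "ideal ?I R"
    proof (rule ideal_of_closed)
      show "\<zero> \<in> ?I" using less.prems(1) ideal_power_carrier unfolding kills_def by auto
      show "a \<oplus> b \<in> ?I" if "a \<in> ?I" "b \<in> ?I" for a b
        using that less.prems(1) ideal_power_carrier unfolding kills_def
        by (auto simp: smult_l_distr smult_r_distr)
      fix a c assume a: "a \<in> ?I" and c: "c \<in> carrier R"
      have "kills L (c \<odot>\<^bsub>M\<^esub> (a \<odot>\<^bsub>M\<^esub> y))" by (rule kills_smult) (use a c less.prems(1) in auto)
      then show "c \<otimes> a \<in> ?I" using a c less.prems(1) by (simp add: smult_assoc1)
    qed auto
    moreover have "x ` {..<r} \<subseteq> ?I" using L by auto
    ultimately have "Rplus \<subseteq> ?I" by (rule irrelevant_gen)
    then have "kills (Suc L) y" using less.prems(1) by (intro kills_SucI) auto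
    then show ?thesis by blast
  qed
qed

text \<open>Powers of the ideal give way to powers of single generators, so that torsion can be
  imposed one generator at a time.\<close>

lemma torsion_iff:
  "y \<in> torsion R Rplus M \<longleftrightarrow> y \<in> carrier M \<and> (\<forall>i<r. \<exists>k::nat. (x i [^] k) \<odot>\<^bsub>M\<^esub> y = \<zero>\<^bsub>M\<^esub>)"
proof
  assume "y \<in> torsion R Rplus M"
  then obtain k where "y \<in> carrier M" "kills k y" unfolding torsion_kills by blast
  then show "y \<in> carrier M \<and> (\<forall>i<r. \<exists>k::nat. (x i [^] k) \<odot>\<^bsub>M\<^esub> y = \<zero>\<^bsub>M\<^esub>)"
    using x_pow_in unfolding kills_def by blast
next
  assume y: "y \<in> carrier M \<and> (\<forall>i<r. \<exists>k::nat. (x i [^] k) \<odot>\<^bsub>M\<^esub> y = \<zero>\<^bsub>M\<^esub>)"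
  then obtain k where "\<forall>i<r. (x i [^] (k i :: nat)) \<odot>\<^bsub>M\<^esub> y = \<zero>\<^bsub>M\<^esub>" by metis
  then show "y \<in> torsion R Rplus M" using y torsion_of_powers unfolding torsion_kills by blast
qed

section \<open>Degree parts of the submodule generated by the irrelevant ideal\<close>

abbreviation "mc \<equiv> hcomp M (mcomp M)"

text \<open>Degree \<open>n\<close> part of \<open>x_0 M + ... + x_(s-1) M\<close>. The recursion
  follows the cones of the Koszul complex, each of which contributes one generator.\<close>

fun xspan :: "int \<Rightarrow> nat \<Rightarrow> 'm set" where
  "xspan n 0 = {\<zero>\<^bsub>M\<^esub>}"
| "xspan n (Suc s) = {y \<oplus>\<^bsub>M\<^esub> x s \<odot>\<^bsub>M\<^esub> m | y m. y \<in> xspan n s \<and> m \<in> mcomp M (n - 1)}"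

declare xspan.simps(2) [simp del]

lemma xspanI: "y \<in> xspan n s \<Longrightarrow> m \<in> mcomp M (n - 1) \<Longrightarrow> z = y \<oplus>\<^bsub>M\<^esub> x s \<odot>\<^bsub>M\<^esub> m \<Longrightarrow> z \<in> xspan n (Suc s)"
  by (auto simp: xspan.simps)

lemma xspanE:
  assumes "z \<in> xspan n (Suc s)"
  obtains y m where "y \<in> xspan n s" "m \<in> mcomp M (n - 1)" "z = y \<oplus>\<^bsub>M\<^esub> x s \<odot>\<^bsub>M\<^esub> m"
  using assms by (auto simp: xspan.simps)

lemma xspan_carrier: "y \<in> xspan n s \<Longrightarrow> y \<in> carrier M"
  by (induction s arbitrary: y) (auto elim!: xspanE dest: mg.comp_carrier)

lemma xspan_zero: "\<zero>\<^bsub>M\<^esub> \<in> xspan n s"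
proof (induction s)
  case (Suc s)
  then show ?case by (rule xspanI[OF _ mg.comp_zero]) simp
qed simp

lemma xspan_add: "y \<in> xspan n s \<Longrightarrow> z \<in> xspan n s \<Longrightarrow> y \<oplus>\<^bsub>M\<^esub> z \<in> xspan n s"
proof (induction s arbitrary: y z)
  case (Suc s)
  obtain y' m where y: "y' \<in> xspan n s" "m \<in> mcomp M (n - 1)" "y = y' \<oplus>\<^bsub>M\<^esub> x s \<odot>\<^bsub>M\<^esub> m"
    using Suc.prems(1) by (rule xspanE)
  obtain z' l where z: "z' \<in> xspan n s" "l \<in> mcomp M (n - 1)" "z = z' \<oplus>\<^bsub>M\<^esub> x s \<odot>\<^bsub>M\<^esub> l"
    using Suc.prems(2) by (rule xspanE)
  have "y \<oplus>\<^bsub>M\<^esub> z = (y' \<oplus>\<^bsub>M\<^esub> z') \<oplus>\<^bsub>M\<^esub> x s \<odot>\<^bsub>M\<^esub> (m \<oplus>\<^bsub>M\<^esub> l)"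
    using y z mg.comp_carrier xspan_carrier by (simp add: smult_r_distr M.a_ac)
  then show ?case using Suc.IH y z mg.comp_add by (blast intro: xspanI)
qed auto

lemma xspan_smult:
  assumes a: "a \<in> rcomp R j"
  shows "y \<in> xspan n s \<Longrightarrow> a \<odot>\<^bsub>M\<^esub> y \<in> xspan (int j + n) s"
proof (induction s arbitrary: y)
  case 0
  then show ?case using rg.comp_carrier[OF a] by simp
next
  case (Suc s)
  obtain y' m where y: "y' \<in> xspan n s" "m \<in> mcomp M (n - 1)" "y = y' \<oplus>\<^bsub>M\<^esub> x s \<odot>\<^bsub>M\<^esub> m"
    using Suc.prems(1) by (rule xspanE)
  have aR: "a \<in> carrier R" using a by (rule rg.comp_carrier)
  have "a \<odot>\<^bsub>M\<^esub> y = a \<odot>\<^bsub>M\<^esub> y' \<oplus>\<^bsub>M\<^esub> x s \<odot>\<^bsub>M\<^esub> (a \<odot>\<^bsub>M\<^esub> m)"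
    using y aR mg.comp_carrier xspan_carrier
    by (simp add: smult_r_distr smult_assoc1[symmetric] m_comm)
  moreover have "a \<odot>\<^bsub>M\<^esub> m \<in> mcomp M (int j + n - 1)"
    using smult_comp[OF a y(2)] by (simp add: algebra_simps)
  ultimately show ?case using Suc.IH[OF y(1)] by (blast intro: xspanI)
qed

lemma xspan_gen: "i < s \<Longrightarrow> m \<in> mcomp M (n - 1) \<Longrightarrow> x i \<odot>\<^bsub>M\<^esub> m \<in> xspan n s"
proof (induction s)
  case (Suc s)
  show ?case
  proof (cases "i = s")
    case True
    then show ?thesis
      using Suc.prems xspan_zero[of n s] mg.comp_carrier[OF Suc.prems(2)]
      by (intro xspanI[of "\<zero>\<^bsub>M\<^esub>" n s m]) auto
  next
    case False
    then have "x i \<odot>\<^bsub>M\<^esub> m \<in> xspan n s" using Suc by simp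
    then show ?thesis
      by (rule xspanI[OF _ mg.comp_zero]) (use mg.comp_carrier[OF Suc.prems(2)] in simp)
  qed
qed simp

text \<open>Scalars may be inhomogeneous; additivity reduces closure to homogeneous ones. The set
  \<open>D\<close> allows finitely many degrees to be exempted.\<close>

lemma submodule_degreewise:
  assumes zero: "\<And>n. n \<in> D \<Longrightarrow> \<zero>\<^bsub>M\<^esub> \<in> W n"
    and add: "\<And>n y z. n \<in> D \<Longrightarrow> y \<in> W n \<Longrightarrow> z \<in> W n \<Longrightarrow> y \<oplus>\<^bsub>M\<^esub> z \<in> W n"
    and smult: "\<And>n j a y. n \<in> D \<Longrightarrow> a \<in> rcomp R j \<Longrightarrow> y \<in> carrier M \<Longrightarrow> \<forall>n\<in>D. mc n y \<in> W n \<Longrightarrow> mc n (a \<odot>\<^bsub>M\<^esub> y) \<in> W n"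
  shows "submodule {y \<in> carrier M. \<forall>n\<in>D. mc n y \<in> W n} R M"
proof (rule submoduleI')
  fix a y assume a: "a \<in> carrier R" and "y \<in> {y \<in> carrier M. \<forall>n\<in>D. mc n y \<in> W n}"
  then have y: "y \<in> carrier M" "\<forall>n\<in>D. mc n y \<in> W n" by auto
  have "\<forall>n\<in>D. mc n (a \<odot>\<^bsub>M\<^esub> y) \<in> W n" using a
  proof (induction rule: rg.homogeneous_induct)
    case zero
    then show ?case using assms(1) y by (simp add: mg.hcomp_zero)
  next
    case (homogeneous n a)
    then show ?case using smult y by blast
  next
    case (add b c)
    then show ?case using assms(2) y by (simp add: smult_l_distr mg.hcomp_add)
  qed
  then show "a \<odot>\<^bsub>M\<^esub> y \<in> {y \<in> carrier M. \<forall>n\<in>D. mc n y \<in> W n}" using a y by simp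
qed (use zero add in \<open>auto simp: mg.hcomp_zero mg.hcomp_add\<close>)

lemma mc_smult: "a \<in> rcomp R j \<Longrightarrow> y \<in> carrier M \<Longrightarrow> mc n (a \<odot>\<^bsub>M\<^esub> y) = a \<odot>\<^bsub>M\<^esub> mc (n - int j) y"
  using hcomp_smult[of a j y "n - int j"] by simp

lemma xspan_submodule: "submodule {y \<in> carrier M. \<forall>n\<in>UNIV. mc n y \<in> xspan n r} R M"
proof (rule submodule_degreewise)
  fix n j a y
  assume a: "a \<in> rcomp R j" and y: "y \<in> carrier M" "\<forall>n\<in>UNIV. mc n y \<in> xspan n r"
  then show "mc n (a \<odot>\<^bsub>M\<^esub> y) \<in> xspan n r"
    using xspan_smult[OF a, of "mc (n - int j) y" "n - int j" r] by (simp add: mc_smult)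
qed (auto intro: xspan_zero xspan_add)

text \<open>The scalars carrying all of \<open>M\<close> into the span form an ideal that contains
  every \<open>x i\<close> with \<open>i < r\<close>.\<close>

lemma irrelevant_smult_xspan:
  assumes a: "a \<in> Rplus" and y: "y \<in> carrier M"
  shows "mc n (a \<odot>\<^bsub>M\<^esub> y) \<in> xspan n r"
proof -
  let ?N = "{y \<in> carrier M. \<forall>n\<in>UNIV. mc n y \<in> xspan n r}"
  note N = submoduleE[OF xspan_submodule]
  let ?I = "{a \<in> carrier R. \<forall>y \<in> carrier M. a \<odot>\<^bsub>M\<^esub> y \<in> ?N}"
  have "ideal ?I R"
  proof (rule ideal_of_closed)
    show "\<zero> \<in> ?I" by (auto simp: mg.hcomp_zero xspan_zero)
    show "a \<oplus> b \<in> ?I" if "a \<in> ?I" "b \<in> ?I" for a b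
    proof -
      have "(a \<oplus> b) \<odot>\<^bsub>M\<^esub> y \<in> ?N" if y: "y \<in> carrier M" for y
        using N(5)[of "a \<odot>\<^bsub>M\<^esub> y" "b \<odot>\<^bsub>M\<^esub> y"] \<open>a \<in> ?I\<close> \<open>b \<in> ?I\<close> y by (simp add: smult_l_distr)
      then show ?thesis using that by blast
    qed
    fix a c assume a: "a \<in> ?I" and c: "c \<in> carrier R"
    have "(c \<otimes> a) \<odot>\<^bsub>M\<^esub> y \<in> ?N" if y: "y \<in> carrier M" for y
      using a c y m_comm[of c a] by (simp add: smult_assoc1)
    then show "c \<otimes> a \<in> ?I" using a c by blast
  qed auto
  moreover have "x ` {..<r} \<subseteq> ?I"
  proof clarify
    fix i assume i: "i < r"
    have "mc n (x i \<odot>\<^bsub>M\<^esub> y) \<in> xspan n r" if "y \<in> carrier M" for y n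
      using that i xspan_gen mg.hcomp_in[of y "n - 1"] by (simp add: mc_smult[OF x1])
    then show "x i \<in> carrier R \<and> (\<forall>y\<in>carrier M. x i \<odot>\<^bsub>M\<^esub> y \<in> ?N)" by simp
  qed
  ultimately have "Rplus \<subseteq> ?I" by (rule irrelevant_gen)
  then show ?thesis using a y by blast
qed

lemma span_submodule: "S \<subseteq> carrier M \<Longrightarrow> submodule (submodule_span R M S) R M"
proof (rule submoduleI')
  assume "S \<subseteq> carrier M"
  then show "submodule_span R M S \<subseteq> carrier M"
    using carrier_is_submodule unfolding submodule_span_def by blast
  show "\<zero>\<^bsub>M\<^esub> \<in> submodule_span R M S"
    using subgroup.one_closed[OF submodule.axioms(1)] unfolding submodule_span_def by fastforce
next
  show "a \<oplus>\<^bsub>M\<^esub> b \<in> submodule_span R M S" if "a \<in> submodule_span R M S" "b \<in> submodule_span R M S" for a b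
    using that submoduleE(5) unfolding submodule_span_def by blast
  show "a \<odot>\<^bsub>M\<^esub> y \<in> submodule_span R M S" if "a \<in> carrier R" "y \<in> submodule_span R M S" for a y
    using that submoduleE(4) unfolding submodule_span_def by blast
qed

lemma span_incl: "S \<subseteq> submodule_span R M S"
  unfolding submodule_span_def by blast

lemma span_least: "submodule N R M \<Longrightarrow> S \<subseteq> N \<Longrightarrow> submodule_span R M S \<subseteq> N"
  unfolding submodule_span_def by blast

abbreviation "RplusM \<equiv> ideal_smult R Rplus M"

lemma RplusM_submodule: "submodule RplusM R M"
  unfolding ideal_smult_def by (rule span_submodule) (auto dest: irrelevant_hcomp_zero)

lemma RplusM_xspan:
  assumes "y \<in> RplusM" "y \<in> mcomp M n"
  shows "y \<in> xspan n r"
proof -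
  have "{a \<odot>\<^bsub>M\<^esub> y | a y. a \<in> Rplus \<and> y \<in> carrier M} \<subseteq> {y \<in> carrier M. \<forall>n\<in>UNIV. mc n y \<in> xspan n r}"
    using irrelevant_smult_xspan irrelevant_hcomp_zero by auto
  from span_least[OF xspan_submodule this] have "mc n y \<in> xspan n r"
    using assms(1) unfolding ideal_smult_def by blast
  then show ?thesis using mg.hcomp_homogeneous[OF assms(2)] by simp
qed

lemma xspan_RplusM: "s \<le> r \<Longrightarrow> y \<in> xspan n s \<Longrightarrow> y \<in> RplusM"
proof (induction s arbitrary: y)
  case 0
  then show ?case using subgroup.one_closed[OF submodule.axioms(1)[OF RplusM_submodule]] by simp
next
  case (Suc s)
  obtain y' m where y: "y' \<in> xspan n s" "m \<in> mcomp M (n - 1)" "y = y' \<oplus>\<^bsub>M\<^esub> x s \<odot>\<^bsub>M\<^esub> m"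
    using Suc.prems(2) by (rule xspanE)
  have "x s \<odot>\<^bsub>M\<^esub> m \<in> RplusM"
    unfolding ideal_smult_def using x_in_Rplus mg.comp_carrier[OF y(2)] by (intro subsetD[OF span_incl]) blast
  then show ?case using Suc y submoduleE(5)[OF RplusM_submodule] by simp
qed

lemma comp_vanishes_quotient_iff:
  "comp_vanishes (graded_quotient M RplusM) n \<longleftrightarrow> mcomp M n \<subseteq> RplusM"
proof -
  have sub_group: "subgroup RplusM (add_monoid M)" using RplusM_submodule submodule.axioms(1) by blast
  have "RplusM +>\<^bsub>M\<^esub> y = RplusM \<longleftrightarrow> y \<in> RplusM" if "y \<in> mcomp M n" for y
    using a_coset_join1[of RplusM y] a_coset_join2[of y RplusM] sub_group mg.comp_carrier[OF that] by blast
  then show ?thesis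
    using mg.comp_zero[of n] unfolding comp_vanishes_def graded_quotient_def by auto
qed

text \<open>\<open>Max\<close> in \<open>max_generator_degree\<close> is meaningful on finite sets
  only. Outside the finitely many degrees \<open>D\<close> that occur in the generators, every
  component of \<open>M\<close> lies in \<open>R_+M\<close>: scalars of degree 0 preserve this
  condition and scalars of positive degree produce it.\<close>

lemma generator_degrees_finite:
  assumes "finitely_generated_module R M"
  shows "finite (generator_degrees R M)"
proof -
  obtain S where S: "finite S" "S \<subseteq> carrier M" "submodule_span R M S = carrier M"
    using assms unfolding finitely_generated_module_def by blast
  define D where "D = (\<Union>y\<in>S. {n. mc n y \<noteq> \<zero>\<^bsub>M\<^esub>})"
  have D: "finite D" unfolding D_def using S mg.hcomp_finite by auto
  let ?Q = "{y \<in> carrier M. \<forall>n\<in>-D. mc n y \<in> xspan n r}"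
  have "submodule ?Q R M"
  proof (rule submodule_degreewise)
    fix n j a y
    assume n: "n \<in> - D" and a: "a \<in> rcomp R j" and y: "y \<in> carrier M" "\<forall>n\<in>-D. mc n y \<in> xspan n r"
    show "mc n (a \<odot>\<^bsub>M\<^esub> y) \<in> xspan n r"
    proof (cases "j = 0")
      case True
      then show ?thesis using xspan_smult[OF a, of "mc n y" n r] y n mc_smult[OF a y(1), of n] by simp
    next
      case False
      then show ?thesis using irrelevant_smult_xspan homogeneous_in_irrelevant[OF a] y by simp
    qed
  qed (auto intro: xspan_zero xspan_add)
  moreover have "S \<subseteq> ?Q" using S(2) xspan_zero unfolding D_def by auto
  ultimately have Q: "carrier M \<subseteq> ?Q" using S(3) span_least by blast
  have "generator_degrees R M \<subseteq> D"
  proof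
    fix n assume "n \<in> generator_degrees R M"
    then have "\<not> mcomp M n \<subseteq> RplusM"
      unfolding generator_degrees_def comp_vanishes_quotient_iff by simp
    then obtain y where y: "y \<in> mcomp M n" "y \<notin> RplusM" by blast
    then have "mc n y \<notin> xspan n r" using xspan_RplusM[of r y n] mg.hcomp_homogeneous[of y n n] by auto
    then show "n \<in> D" using Q mg.comp_carrier[OF y(1)] by blast
  qed
  then show ?thesis using D finite_subset by blast
qed

lemma comp_eq_xspan:
  assumes "finitely_generated_module R M" "max_generator_degree R M \<le> ereal (of_int t)" "n > t"
  shows "mcomp M n \<subseteq> xspan n r"
proof -
  have "n \<notin> generator_degrees R M"
  proof
    assume n: "n \<in> generator_degrees R M"
    then have "n \<le> Max (generator_degrees R M)" using generator_degrees_finite assms(1) by simp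
    moreover have "Max (generator_degrees R M) \<le> t"
      using assms(2) n unfolding max_generator_degree_def by (auto split: if_splits)
    ultimately show False using assms(3) by simp
  qed
  then have "mcomp M n \<subseteq> RplusM"
    unfolding generator_degrees_def comp_vanishes_quotient_iff by simp
  then show ?thesis using RplusM_xspan by blast
qed

end

section \<open>The resolution as a complex with operators\<close>

definition leaf_group :: "('a, 'b) ring_scheme \<Rightarrow> 'a cone_tree ring" where
  "leaf_group G = \<lparr>carrier = Leaf ` carrier G, monoid.mult = undefined, one = undefined,
     zero = Leaf \<zero>\<^bsub>G\<^esub>, add = (\<lambda>u v. Leaf (leaf u \<oplus>\<^bsub>G\<^esub> leaf v))\<rparr>"

lemma leaf_group_simps:
  "carrier (leaf_group G) = Leaf ` carrier G" "\<zero>\<^bsub>leaf_group G\<^esub> = Leaf \<zero>\<^bsub>G\<^esub>"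
  "Leaf a \<oplus>\<^bsub>leaf_group G\<^esub> Leaf b = Leaf (a \<oplus>\<^bsub>G\<^esub> b)"
  by (simp_all add: leaf_group_def)

lemma abelian_group_leaf:
  assumes "abelian_group G"
  shows "abelian_group (leaf_group G)"
proof -
  interpret abelian_group G by fact
  show ?thesis
  proof (rule abelian_groupI)
    fix u assume "u \<in> carrier (leaf_group G)"
    then obtain a where a: "u = Leaf a" "a \<in> carrier G" by (auto simp: leaf_group_simps)
    then show "\<exists>v\<in>carrier (leaf_group G). v \<oplus>\<^bsub>leaf_group G\<^esub> u = \<zero>\<^bsub>leaf_group G\<^esub>"
      by (intro bexI[of _ "Leaf (\<ominus>\<^bsub>G\<^esub> a)"]) (auto simp: leaf_group_simps l_neg)
  qed (auto simp: leaf_group_simps a_assoc intro: a_comm)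
qed

lemma leaf_group_minus:
  assumes "abelian_group G" "a \<in> carrier G"
  shows "\<ominus>\<^bsub>leaf_group G\<^esub> Leaf a = Leaf (\<ominus>\<^bsub>G\<^esub> a)"
proof -
  interpret abelian_group G by fact
  interpret L: abelian_group "leaf_group G" by (rule abelian_group_leaf) fact
  show ?thesis by (rule L.minus_equality) (use assms(2) in \<open>auto simp: leaf_group_simps l_neg\<close>)
qed

lemma additive_subgroup_leaf:
  assumes G: "abelian_group G" and N: "additive_subgroup N G"
  shows "additive_subgroup (Leaf ` N) (leaf_group G)"
proof -
  interpret additive_subgroup N G by fact
  show ?thesis
    by (rule additive_subgroupI'[OF abelian_group_leaf[OF G]])
      (use a_Hcarr leaf_group_minus[OF G] in \<open>auto simp: leaf_group_simps\<close>)
qed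

locale generated_resolution =
  fixes R :: "'r graded_ring" and M :: "('r, 'm) graded_module" and \<epsilon> :: "'m \<Rightarrow> 'e"
    and E :: "nat \<Rightarrow> ('r, 'e) graded_module" and d :: "nat \<Rightarrow> 'e \<Rightarrow> 'e"
    and x :: "nat \<Rightarrow> 'r" and r :: nat
  assumes res: "graded_injective_resolution R M \<epsilon> E d"
    and acc: "ideal_acc R (carrier R)"
    and x_deg: "x i \<in> rcomp R 1"
    and x_gen: "ideal I R \<Longrightarrow> x ` {..<r} \<subseteq> I \<Longrightarrow> irrelevant_ideal R \<subseteq> I"
begin

lemma inj: "graded_injective R (E q)"
  using res by (simp add: graded_injective_resolution_def)

sublocale M: module_over_generated R M x r
  using res x_deg x_gen
  by (auto intro!: module_over_generated.intro module_over_generated_axioms.intro simp: graded_injective_resolution_def)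

sublocale E: module_over_generated R "E q" x r for q
  using inj[of q] x_deg x_gen
  by (auto intro!: module_over_generated.intro module_over_generated_axioms.intro simp: graded_injective_def)

lemma d_hom: "d q \<in> graded_hom R (E q) (E (Suc q))"
  and eps_hom: "\<epsilon> \<in> graded_hom R M (E 0)"
  using res by (simp_all add: graded_injective_resolution_def)

lemma d_add: "a \<in> carrier (E q) \<Longrightarrow> b \<in> carrier (E q) \<Longrightarrow> d q (a \<oplus>\<^bsub>E q\<^esub> b) = d q a \<oplus>\<^bsub>E (Suc q)\<^esub> d q b"
  and d_closed: "a \<in> carrier (E q) \<Longrightarrow> d q a \<in> carrier (E (Suc q))"
  and d_smult: "c \<in> carrier R \<Longrightarrow> a \<in> carrier (E q) \<Longrightarrow> d q (c \<odot>\<^bsub>E q\<^esub> a) = c \<odot>\<^bsub>E (Suc q)\<^esub> d q a"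
  and d_deg: "a \<in> mcomp (E q) n \<Longrightarrow> d q a \<in> mcomp (E (Suc q)) n"
  using d_hom[of q] by (auto simp: graded_hom_def hom_def image_subset_iff)

lemma eps_add: "a \<in> carrier M \<Longrightarrow> b \<in> carrier M \<Longrightarrow> \<epsilon> (a \<oplus>\<^bsub>M\<^esub> b) = \<epsilon> a \<oplus>\<^bsub>E 0\<^esub> \<epsilon> b"
  and eps_closed: "a \<in> carrier M \<Longrightarrow> \<epsilon> a \<in> carrier (E 0)"
  and eps_smult: "c \<in> carrier R \<Longrightarrow> a \<in> carrier M \<Longrightarrow> \<epsilon> (c \<odot>\<^bsub>M\<^esub> a) = c \<odot>\<^bsub>E 0\<^esub> \<epsilon> a"
  and eps_deg: "a \<in> mcomp M n \<Longrightarrow> \<epsilon> a \<in> mcomp (E 0) n"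
  using eps_hom by (auto simp: graded_hom_def hom_def image_subset_iff)

lemma d_zero: "d q \<zero>\<^bsub>E q\<^esub> = \<zero>\<^bsub>E (Suc q)\<^esub>"
  using d_smult[of "\<zero>\<^bsub>R\<^esub>" "\<zero>\<^bsub>E q\<^esub>" q] d_closed[of "\<zero>\<^bsub>E q\<^esub>" q] by simp

lemma eps_zero: "\<epsilon> \<zero>\<^bsub>M\<^esub> = \<zero>\<^bsub>E 0\<^esub>"
  using eps_smult[of "\<zero>\<^bsub>R\<^esub>" "\<zero>\<^bsub>M\<^esub>"] eps_closed[of "\<zero>\<^bsub>M\<^esub>"] by simp

lemma d_minus: "a \<in> carrier (E q) \<Longrightarrow> d q (\<ominus>\<^bsub>E q\<^esub> a) = \<ominus>\<^bsub>E (Suc q)\<^esub> d q a"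
  using d_smult[of "\<ominus>\<^bsub>R\<^esub> \<one>\<^bsub>R\<^esub>" a q] d_closed[of a q] by (simp add: E.smult_l_minus)

lemma eps_minus: "a \<in> carrier M \<Longrightarrow> \<epsilon> (\<ominus>\<^bsub>M\<^esub> a) = \<ominus>\<^bsub>E 0\<^esub> \<epsilon> a"
  using eps_smult[of "\<ominus>\<^bsub>R\<^esub> \<one>\<^bsub>R\<^esub>" a] eps_closed[of a] by (simp add: E.smult_l_minus M.smult_l_minus)

lemma exact_0: "e \<in> carrier (E 0) \<Longrightarrow> d 0 e = \<zero>\<^bsub>E 1\<^esub> \<longleftrightarrow> e \<in> \<epsilon> ` carrier M"
  using res by (auto simp: graded_injective_resolution_def a_kernel_def')

lemma exact_Suc: "e \<in> carrier (E (Suc q)) \<Longrightarrow> d (Suc q) e = \<zero>\<^bsub>E (Suc (Suc q))\<^esub> \<longleftrightarrow> e \<in> d q ` carrier (E q)"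
  using res by (auto simp: graded_injective_resolution_def a_kernel_def')

lemma d_d: "a \<in> carrier (E q) \<Longrightarrow> d (Suc q) (d q a) = \<zero>\<^bsub>E (Suc (Suc q))\<^esub>"
  using exact_Suc[of "d q a" q] d_closed by blast

text \<open>Lets a preimage under the differential be replaced by its component of the right
  degree.\<close>

lemma hcomp_d: "a \<in> carrier (E q) \<Longrightarrow>
    hcomp (E (Suc q)) (mcomp (E (Suc q))) n (d q a) = d q (hcomp (E q) (mcomp (E q)) n a)"
  by (rule hcomp_hom[OF E.mg.graded_group_axioms E.mg.graded_group_axioms, where \<sigma> = "\<lambda>n. n"])
    (use d_hom[of q] in \<open>auto simp: graded_hom_def\<close>)

lemma hcomp_eps: "a \<in> carrier M \<Longrightarrow>
    hcomp (E 0) (mcomp (E 0)) n (\<epsilon> a) = \<epsilon> (hcomp M (mcomp M) n a)"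
  by (rule hcomp_hom[OF M.mg.graded_group_axioms E.mg.graded_group_axioms, where \<sigma> = "\<lambda>n. n"])
    (use eps_hom in \<open>auto simp: graded_hom_def\<close>)

text \<open>In negative degrees \<open>nat p = 0\<close>, so the group is a junk copy of \<open>E 0\<close>; the carriers used below are
  zero there.\<close>

definition res_complex :: "'e cone_tree op_complex" where
  "res_complex = \<lparr>grp = (\<lambda>p. leaf_group (E (nat p))),
        diff = (\<lambda>p u. Leaf (if p < 0 then \<zero>\<^bsub>E (nat (p + 1))\<^esub> else d (nat p) (leaf u))),
        oper = (\<lambda>i p u. Leaf (x i \<odot>\<^bsub>E (nat p)\<^esub> leaf u))\<rparr>"

lemma res_complex_simps:
  "grp res_complex p = leaf_group (E (nat p))"
  "diff res_complex p u = Leaf (if p < 0 then \<zero>\<^bsub>E (nat (p + 1))\<^esub> else d (nat p) (leaf u))"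
  "oper res_complex i p u = Leaf (x i \<odot>\<^bsub>E (nat p)\<^esub> leaf u)"
  by (simp_all add: res_complex_def)

lemma nat_Suc: "0 \<le> p \<Longrightarrow> nat (p + 1) = Suc (nat p)" "0 \<le> p \<Longrightarrow> nat (p + 2) = Suc (Suc (nat p))"
  by (simp_all add: nat_add_distrib)

lemma op_complex_res_complex: "op_complex res_complex"
proof (rule op_complex.intro)
  fix p :: int and i j
  note ab = abelian_group_leaf[OF E.M.abelian_group_axioms]
  show "abelian_group_hom (grp res_complex p) (grp res_complex (p + 1)) (diff res_complex p)"
  proof (rule abelian_group_homI')
    fix u v assume "u \<in> carrier (grp res_complex p)" "v \<in> carrier (grp res_complex p)"
    then show "diff res_complex p (u \<oplus>\<^bsub>grp res_complex p\<^esub> v) = diff res_complex p u \<oplus>\<^bsub>grp res_complex (p + 1)\<^esub> diff res_complex p v"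
      by (auto simp: res_complex_simps leaf_group_simps nat_Suc d_add)
  qed (auto simp: res_complex_simps ab leaf_group_simps nat_Suc d_closed)
  show "abelian_group_hom (grp res_complex p) (grp res_complex p) (oper res_complex i p)"
    by (rule abelian_group_homI') (auto simp: res_complex_simps ab leaf_group_simps E.smult_r_distr)
  fix u assume "u \<in> carrier (grp res_complex p)"
  then obtain a where u: "u = Leaf a" "a \<in> carrier (E (nat p))" by (auto simp: res_complex_simps leaf_group_simps)
  show "diff res_complex (p + 1) (diff res_complex p u) = \<zero>\<^bsub>grp res_complex (p + 2)\<^esub>"
  proof (cases "p < 0")
    case True
    then show ?thesis
    proof (cases "p = -1")
      case True
      \<comment> \<open>At \<open>p = -1\<close> the second differential is the genuine
        \<open>d 0\<close>, applied to zero.\<close>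
      then show ?thesis using d_zero[of 0] by (simp add: res_complex_simps leaf_group_simps)
    qed (simp add: res_complex_simps leaf_group_simps add.assoc)
  next
    case False
    then show ?thesis using u d_d[of a "nat p"] by (simp add: res_complex_simps leaf_group_simps nat_Suc)
  qed
  show "diff res_complex p (oper res_complex i p u) = oper res_complex i (p + 1) (diff res_complex p u)"
    using u by (auto simp: res_complex_simps nat_Suc d_smult)
  show "oper res_complex i p (oper res_complex j p u) = oper res_complex j p (oper res_complex i p u)"
    using u by (simp add: res_complex_simps E.smult_assoc1[symmetric] M.m_comm)
qed

section \<open>Graded subcomplexes of the resolution\<close>

definition carriers :: "(nat \<Rightarrow> int \<Rightarrow> 'e set) \<Rightarrow> int \<Rightarrow> int \<Rightarrow> 'e cone_tree set" where
  "carriers A p n = (if p < 0 then {Leaf \<zero>\<^bsub>E 0\<^esub>} else Leaf ` A (nat p) n)"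

lemma op_subcomplex_carriers:
  assumes sub_group: "\<And>q n. additive_subgroup (A q n) (E q)"
    and dA: "\<And>q n a. a \<in> A q n \<Longrightarrow> d q a \<in> A (Suc q) n"
    and xA: "\<And>q n i a. a \<in> A q n \<Longrightarrow> x i \<odot>\<^bsub>E q\<^esub> a \<in> A q (n + 1)"
  shows "op_subcomplex res_complex (carriers A)"
  unfolding op_subcomplex_def
proof (intro allI conjI)
  fix p n i
  have z: "\<zero>\<^bsub>E q\<^esub> \<in> A q n" for q n using additive_subgroup.zero_closed[OF sub_group] .
  show "additive_subgroup (carriers A p n) (grp res_complex p)"
  proof (cases "p < 0")
    case True
    have "additive_subgroup {\<zero>\<^bsub>E 0\<^esub>} (E 0)"
      by (rule additive_subgroupI'[OF E.M.abelian_group_axioms]) auto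
    from additive_subgroup_leaf[OF E.M.abelian_group_axioms this] show ?thesis
      using True by (simp add: carriers_def res_complex_simps)
  next
    case False
    then show ?thesis using additive_subgroup_leaf[OF E.M.abelian_group_axioms sub_group] by (simp add: carriers_def res_complex_simps)
  qed
  show "diff res_complex p ` carriers A p n \<subseteq> carriers A (p + 1) n"
    using z dA by (auto simp: carriers_def res_complex_simps nat_Suc)
  show "oper res_complex i p ` carriers A p n \<subseteq> carriers A p (n + 1)"
    using xA by (auto simp: carriers_def res_complex_simps)
qed

text \<open>The stages of the torsion filtration: \<open>s = 0\<close> gives the whole degree
  \<open>n\<close> part of \<open>E q\<close>, and \<open>s = r\<close> that of its torsion
  submodule.\<close>

definition tors :: "nat \<Rightarrow> nat \<Rightarrow> int \<Rightarrow> 'e set" where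
  "tors s q n = {e \<in> mcomp (E q) n. \<forall>i<s. \<exists>k::nat. (x i [^]\<^bsub>R\<^esub> k) \<odot>\<^bsub>E q\<^esub> e = \<zero>\<^bsub>E q\<^esub>}"

text \<open>The image of \<open>M\<close> as a subcomplex concentrated in position 0. The
  quasi-isomorphism from \<open>M\<close> to its resolution thereby becomes acyclicity of a
  quotient.\<close>

definition aug :: "nat \<Rightarrow> int \<Rightarrow> 'e set" where
  "aug q n = (if q = 0 then \<epsilon> ` mcomp M n else {\<zero>\<^bsub>E q\<^esub>})"

lemma pow_mono:
  assumes "e \<in> carrier (E q)" "(x i [^]\<^bsub>R\<^esub> (k::nat)) \<odot>\<^bsub>E q\<^esub> e = \<zero>\<^bsub>E q\<^esub>" "k \<le> l"
  shows "(x i [^]\<^bsub>R\<^esub> l) \<odot>\<^bsub>E q\<^esub> e = \<zero>\<^bsub>E q\<^esub>"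
proof -
  have "x i [^]\<^bsub>R\<^esub> l = x i [^]\<^bsub>R\<^esub> (l - k) \<otimes>\<^bsub>R\<^esub> x i [^]\<^bsub>R\<^esub> k"
    using assms(3) M.nat_pow_mult[of "x i" "l - k" k] by simp
  then show ?thesis using assms by (simp add: E.smult_assoc1)
qed

lemma tors_add:
  assumes a: "a \<in> tors s q n" and b: "b \<in> tors s q n"
  shows "a \<oplus>\<^bsub>E q\<^esub> b \<in> tors s q n"
proof -
  have c: "a \<in> carrier (E q)" "b \<in> carrier (E q)" using a b E.mg.comp_carrier unfolding tors_def by blast+
  have "\<exists>k::nat. (x i [^]\<^bsub>R\<^esub> k) \<odot>\<^bsub>E q\<^esub> (a \<oplus>\<^bsub>E q\<^esub> b) = \<zero>\<^bsub>E q\<^esub>" if i: "i < s" for i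
  proof -
    obtain k l :: nat where "(x i [^]\<^bsub>R\<^esub> k) \<odot>\<^bsub>E q\<^esub> a = \<zero>\<^bsub>E q\<^esub>" "(x i [^]\<^bsub>R\<^esub> l) \<odot>\<^bsub>E q\<^esub> b = \<zero>\<^bsub>E q\<^esub>"
      using a b i unfolding tors_def by blast
    then have "(x i [^]\<^bsub>R\<^esub> max k l) \<odot>\<^bsub>E q\<^esub> a = \<zero>\<^bsub>E q\<^esub>" "(x i [^]\<^bsub>R\<^esub> max k l) \<odot>\<^bsub>E q\<^esub> b = \<zero>\<^bsub>E q\<^esub>"
      using pow_mono c by (meson max.cobounded1 max.cobounded2)+
    then show ?thesis using c by (intro exI[of _ "max k l"]) (simp add: E.smult_r_distr)
  qed
  then show ?thesis using a b E.mg.comp_add unfolding tors_def by blast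
qed

lemma tors_smult:
  assumes c: "c \<in> rcomp R j" and a: "a \<in> tors s q n"
  shows "c \<odot>\<^bsub>E q\<^esub> a \<in> tors s q (int j + n)"
proof -
  have cR: "c \<in> carrier R" and aE: "a \<in> mcomp (E q) n" "a \<in> carrier (E q)"
    using c a M.rg.comp_carrier E.mg.comp_carrier unfolding tors_def by blast+
  have "\<exists>k::nat. (x i [^]\<^bsub>R\<^esub> k) \<odot>\<^bsub>E q\<^esub> (c \<odot>\<^bsub>E q\<^esub> a) = \<zero>\<^bsub>E q\<^esub>" if i: "i < s" for i
  proof -
    obtain k :: nat where k: "(x i [^]\<^bsub>R\<^esub> k) \<odot>\<^bsub>E q\<^esub> a = \<zero>\<^bsub>E q\<^esub>" using a i unfolding tors_def by blast
    have "(x i [^]\<^bsub>R\<^esub> k) \<odot>\<^bsub>E q\<^esub> (c \<odot>\<^bsub>E q\<^esub> a) = c \<odot>\<^bsub>E q\<^esub> ((x i [^]\<^bsub>R\<^esub> k) \<odot>\<^bsub>E q\<^esub> a)"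
      using cR aE by (simp add: E.smult_assoc1[symmetric] M.m_comm)
    then show ?thesis using k cR by (intro exI[of _ k]) simp
  qed
  then show ?thesis using E.smult_comp[OF c aE(1)] unfolding tors_def by blast
qed

lemma op_subcomplex_tors: "op_subcomplex res_complex (carriers (tors s))"
proof (rule op_subcomplex_carriers)
  fix q n
  show "additive_subgroup (tors s q n) (E q)"
  proof (rule additive_subgroupI'[OF E.M.abelian_group_axioms])
    show "tors s q n \<subseteq> carrier (E q)" using E.mg.comp_carrier unfolding tors_def by blast
    show "\<zero>\<^bsub>E q\<^esub> \<in> tors s q n" using E.mg.comp_zero by (auto simp: tors_def)
    fix a assume a: "a \<in> tors s q n"
    then have aE: "a \<in> carrier (E q)" using E.mg.comp_carrier unfolding tors_def by blast
    have "\<ominus>\<^bsub>R\<^esub> \<one>\<^bsub>R\<^esub> \<in> rcomp R 0" using M.one_degree_zero M.rg.comp_minus by blast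
    from tors_smult[OF this a] show "\<ominus>\<^bsub>E q\<^esub> a \<in> tors s q n" using aE by (simp add: E.smult_l_minus)
  qed (rule tors_add)
  show "d q a \<in> tors s (Suc q) n" if a: "a \<in> tors s q n" for a
  proof -
    have aE: "a \<in> mcomp (E q) n" "a \<in> carrier (E q)" using a E.mg.comp_carrier unfolding tors_def by blast+
    have "\<exists>k::nat. (x i [^]\<^bsub>R\<^esub> k) \<odot>\<^bsub>E (Suc q)\<^esub> d q a = \<zero>\<^bsub>E (Suc q)\<^esub>" if i: "i < s" for i
    proof -
      obtain k :: nat where k: "(x i [^]\<^bsub>R\<^esub> k) \<odot>\<^bsub>E q\<^esub> a = \<zero>\<^bsub>E q\<^esub>" using a i unfolding tors_def by blast
      have "(x i [^]\<^bsub>R\<^esub> k) \<odot>\<^bsub>E (Suc q)\<^esub> d q a = d q ((x i [^]\<^bsub>R\<^esub> k) \<odot>\<^bsub>E q\<^esub> a)"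
        using aE by (simp add: d_smult)
      then show ?thesis using k d_zero[of q] by (intro exI[of _ k]) simp
    qed
    then show ?thesis using d_deg[OF aE(1)] unfolding tors_def by blast
  qed
  show "x i \<odot>\<^bsub>E q\<^esub> a \<in> tors s q (n + 1)" if "a \<in> tors s q n" for a i
    using tors_smult[OF x_deg that] by (simp add: add.commute)
qed

lemma op_subcomplex_aug: "op_subcomplex res_complex (carriers aug)"
proof (rule op_subcomplex_carriers)
  fix q n
  show "additive_subgroup (aug q n) (E q)"
  proof (rule additive_subgroupI'[OF E.M.abelian_group_axioms])
    show "aug q n \<subseteq> carrier (E q)"
      using eps_closed M.mg.comp_carrier by (auto simp: aug_def)
    show "\<zero>\<^bsub>E q\<^esub> \<in> aug q n" using eps_zero M.mg.comp_zero[of n] by (auto simp: aug_def image_iff intro: bexI[of _ "\<zero>\<^bsub>M\<^esub>"])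
    show "a \<oplus>\<^bsub>E q\<^esub> b \<in> aug q n" if "a \<in> aug q n" "b \<in> aug q n" for a b
      using that M.mg.comp_add M.mg.comp_carrier
      by (auto simp: aug_def eps_add[symmetric] split: if_splits)
    show "\<ominus>\<^bsub>E q\<^esub> a \<in> aug q n" if "a \<in> aug q n" for a
      using that M.mg.comp_minus M.mg.comp_carrier
      by (auto simp: aug_def eps_minus[symmetric] split: if_splits)
  qed
  show "d q a \<in> aug (Suc q) n" if "a \<in> aug q n" for a
    using that exact_0[OF eps_closed] M.mg.comp_carrier d_zero[of q]
    by (auto simp: aug_def split: if_splits)
  show "x i \<odot>\<^bsub>E q\<^esub> a \<in> aug q (n + 1)" if "a \<in> aug q n" for a i
    using that M.smult_comp[OF x_deg, of _ n i] M.mg.comp_carrier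
    by (auto simp: aug_def eps_smult[symmetric] add.commute split: if_splits)
qed

lemma aug_subset_tors: "carriers aug p n \<subseteq> carriers (tors 0) p n"
  using eps_deg E.mg.comp_zero by (auto simp: carriers_def aug_def tors_def)

text \<open>This is exactness of the augmented resolution, read degree by degree: a cocycle in
  position 0 comes from \<open>M\<close>, and one in a positive position is a boundary.\<close>

lemma rel_acyclic_aug: "rel_acyclic res_complex (carriers (tors 0)) (carriers aug) p n"
  unfolding rel_acyclic_def
proof (intro ballI impI)
  interpret A: complex_with_sub res_complex "carriers aug" by (rule complex_with_subI[OF op_complex_res_complex op_subcomplex_aug])
  interpret G: complex_with_sub res_complex "carriers (tors 0)" by (rule complex_with_subI[OF op_complex_res_complex op_subcomplex_tors])
  fix u assume u: "u \<in> carriers (tors 0) p n" and du: "diff res_complex p u \<in> carriers aug (p + 1) n"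
  show "\<exists>b\<in>carriers (tors 0) (p - 1) n. \<exists>c\<in>carriers aug p n. u = diff res_complex (p - 1) b \<oplus>\<^bsub>grp res_complex p\<^esub> c"
  proof (cases "p \<le> 0")
    case True
    have "u \<in> carriers aug p n"
    proof (cases "p = 0")
      case True
      then obtain e where e: "u = Leaf e" "e \<in> mcomp (E 0) n" using u by (auto simp: carriers_def tors_def)
      have eE: "e \<in> carrier (E 0)" using e E.mg.comp_carrier by blast
      have "d 0 e = \<zero>\<^bsub>E 1\<^esub>" using du True e by (simp add: carriers_def res_complex_simps aug_def)
      then obtain m where m: "m \<in> carrier M" "e = \<epsilon> m" using exact_0[OF eE] by blast
      have "e = hcomp (E 0) (mcomp (E 0)) n e" using E.mg.hcomp_homogeneous[OF e(2)] by simp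
      also have "\<dots> = \<epsilon> (hcomp M (mcomp M) n m)" using m hcomp_eps by simp
      finally show ?thesis using True e M.mg.hcomp_in[OF m(1), of n] by (auto simp: carriers_def aug_def)
    next
      case False
      then show ?thesis using u True by (simp add: carriers_def)
    qed
    moreover have "diff res_complex (p - 1) \<zero>\<^bsub>grp res_complex (p - 1)\<^esub> = \<zero>\<^bsub>grp res_complex p\<^esub>" using A.d_zero[of "p - 1"] by simp
    ultimately show ?thesis
      using G.carr[OF u] by (intro bexI[of _ "\<zero>\<^bsub>grp res_complex (p - 1)\<^esub>"] bexI[of _ u]) simp_all
  next
    case False
    then obtain q where p: "p = int (Suc q)" by (metis not_le zero_less_imp_eq_int gr0_implies_Suc)
    have nat: "nat p = Suc q" "nat (p - 1) = q" "nat (p + 1) = Suc (Suc q)" using p by auto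
    obtain e where e: "u = Leaf e" "e \<in> mcomp (E (Suc q)) n" using u False by (auto simp: carriers_def tors_def nat)
    have eE: "e \<in> carrier (E (Suc q))" using e E.mg.comp_carrier by blast
    have "d (Suc q) e = \<zero>\<^bsub>E (Suc (Suc q))\<^esub>" using du False e by (simp add: carriers_def res_complex_simps aug_def nat)
    then obtain y where y: "y \<in> carrier (E q)" "e = d q y" using exact_Suc[OF eE] by blast
    \<comment> \<open>The preimage \<open>y\<close> need not be homogeneous, but its degree
      \<open>n\<close> part also maps to \<open>e\<close>, since \<open>e\<close> has degree
      \<open>n\<close>.\<close>
    define b where "b = hcomp (E q) (mcomp (E q)) n y"
    have "e = hcomp (E (Suc q)) (mcomp (E (Suc q))) n e" using E.mg.hcomp_homogeneous[OF e(2)] by simp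
    also have "\<dots> = d q b" using y hcomp_d unfolding b_def by simp
    finally have eb: "e = d q b" .
    have b: "b \<in> mcomp (E q) n" unfolding b_def by (rule E.mg.hcomp_in[OF y(1)])
    have "Leaf b \<in> carriers (tors 0) (p - 1) n" using b False by (auto simp: carriers_def tors_def nat)
    moreover have "u = diff res_complex (p - 1) (Leaf b) \<oplus>\<^bsub>grp res_complex p\<^esub> \<zero>\<^bsub>grp res_complex p\<^esub>"
      using False e eb eE by (simp add: res_complex_simps leaf_group_simps nat)
    ultimately show ?thesis using A.C_zero[of p n] by blast
  qed
qed

section \<open>The Koszul complex over the module itself\<close>

fun iota :: "nat \<Rightarrow> 'e \<Rightarrow> 'e cone_tree" where
  "iota 0 e = Leaf e"
| "iota (Suc s) e = Node (iota s e) \<zero>\<^bsub>grp (koszul s res_complex) 1\<^esub>"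

text \<open>Each cone adds a copy moved one position down, so a family concentrated in position 0
  acquires nothing in positive positions.\<close>

lemma koszul_aug_pos: "p > 0 \<Longrightarrow> u \<in> koszul_car s (carriers aug) p n \<Longrightarrow> u = \<zero>\<^bsub>grp (koszul s res_complex) p\<^esub>"
proof (induction s arbitrary: p n u)
  case 0
  then show ?case by (auto simp: carriers_def aug_def res_complex_simps leaf_group_simps)
next
  case (Suc s)
  then obtain a b where "u = Node a b" "a \<in> koszul_car s (carriers aug) p n" "b \<in> koszul_car s (carriers aug) (p + 1) (n - 1)"
    by (auto simp: cone_car_def)
  then show ?case using Suc by (simp add: cone_simps)
qed

text \<open>In position 0 the second entry of each cone comes from position 1, where only zero is
  left.\<close>

lemma koszul_aug_zero: "koszul_car s (carriers aug) 0 n = iota s ` \<epsilon> ` mcomp M n"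
proof (induction s arbitrary: n)
  case 0
  then show ?case by (auto simp: carriers_def aug_def)
next
  case (Suc s)
  interpret K: complex_with_sub "koszul s res_complex" "koszul_car s (carriers aug)"
    by (rule complex_with_subI[OF op_complex_koszul[OF op_complex_res_complex] op_subcomplex_koszul[OF op_complex_res_complex op_subcomplex_aug]])
  have "b \<in> koszul_car s (carriers aug) 1 (n - 1) \<longleftrightarrow> b = \<zero>\<^bsub>grp (koszul s res_complex) 1\<^esub>" for b
    using koszul_aug_pos[of 1 b s "n - 1"] K.C_zero[of 1 "n - 1"] by auto
  then show ?case using Suc[of n] by (auto simp: cone_car_def)
qed

lemma iota_add:
  "a \<in> carrier (E 0) \<Longrightarrow> b \<in> carrier (E 0) \<Longrightarrow> iota s (a \<oplus>\<^bsub>E 0\<^esub> b) = iota s a \<oplus>\<^bsub>grp (koszul s res_complex) 0\<^esub> iota s b"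
proof (induction s)
  case 0
  then show ?case by (simp add: res_complex_simps leaf_group_simps)
next
  case (Suc s)
  interpret K: op_complex "koszul s res_complex" by (rule op_complex_koszul[OF op_complex_res_complex])
  show ?case using Suc by (simp add: cone_simps)
qed

lemma iota_smult: "iota s (x i \<odot>\<^bsub>E 0\<^esub> a) = oper (koszul s res_complex) i 0 (iota s a)"
proof (induction s)
  case 0
  then show ?case by (simp add: res_complex_simps)
next
  case (Suc s)
  interpret K: op_complex "koszul s res_complex" by (rule op_complex_koszul[OF op_complex_res_complex])
  show ?case using Suc by (simp add: cone_simps)
qed

text \<open>The last Koszul differential sends \<open>(m_0, ..., m_(s-1))\<close> to the sum of the
  \<open>x_i m_i\<close>. Each cone appends one entry \<open>m\<close>, and its differential adds
  \<open>x_s m\<close> to the boundary built so far.\<close>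

lemma iota_boundary:
  "y \<in> M.xspan n s \<Longrightarrow> \<exists>b \<in> koszul_car s (carriers aug) (-1) n. diff (koszul s res_complex) (-1) b = iota s (\<epsilon> y)"
proof (induction s arbitrary: y)
  case 0
  then show ?case by (simp add: carriers_def res_complex_simps eps_zero)
next
  case (Suc s)
  interpret K: complex_with_sub "koszul s res_complex" "koszul_car s (carriers aug)"
    by (rule complex_with_subI[OF op_complex_koszul[OF op_complex_res_complex] op_subcomplex_koszul[OF op_complex_res_complex op_subcomplex_aug]])
  obtain y' m where y: "y' \<in> M.xspan n s" "m \<in> mcomp M (n - 1)" "y = y' \<oplus>\<^bsub>M\<^esub> x s \<odot>\<^bsub>M\<^esub> m"
    using Suc.prems by (rule M.xspanE)
  obtain b where b: "b \<in> koszul_car s (carriers aug) (-1) n" "diff (koszul s res_complex) (-1) b = iota s (\<epsilon> y')"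
    using Suc.IH[OF y(1)] by blast
  have c: "y' \<in> carrier M" "m \<in> carrier M" using y M.xspan_carrier M.mg.comp_carrier by blast+
  have im: "iota s (\<epsilon> m) \<in> koszul_car s (carriers aug) 0 (n - 1)" using y(2) koszul_aug_zero by blast
  \<comment> \<open>The appended entry is a cocycle because position 1 of this family is
    zero.\<close>
  have "diff (koszul s res_complex) 0 (iota s (\<epsilon> m)) = \<zero>\<^bsub>grp (koszul s res_complex) 1\<^esub>"
    using koszul_aug_pos[of 1 _ s "n - 1"] K.C_d[OF im] by simp
  moreover have "iota s (\<epsilon> y) = iota s (\<epsilon> y') \<oplus>\<^bsub>grp (koszul s res_complex) 0\<^esub> oper (koszul s res_complex) s 0 (iota s (\<epsilon> m))"
    using c by (simp add: y(3) eps_add eps_smult eps_closed iota_add iota_smult)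
  ultimately have "diff (koszul (Suc s) res_complex) (-1) (Node b (iota s (\<epsilon> m))) = iota (Suc s) (\<epsilon> y)"
    using b(2) by (simp add: cone_simps)
  moreover have "Node b (iota s (\<epsilon> m)) \<in> koszul_car (Suc s) (carriers aug) (-1) n"
    using b(1) im by (simp add: cone_car_def)
  ultimately show ?case by blast
qed

lemma acyclic_koszul_aug:
  assumes "p \<ge> 0" and "p = 0 \<Longrightarrow> mcomp M n \<subseteq> M.xspan n r"
  shows "acyclic_at (koszul r res_complex) (koszul_car r (carriers aug)) p n"
proof -
  interpret K: complex_with_sub "koszul r res_complex" "koszul_car r (carriers aug)"
    by (rule complex_with_subI[OF op_complex_koszul[OF op_complex_res_complex] op_subcomplex_koszul[OF op_complex_res_complex op_subcomplex_aug]])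
  show ?thesis
    unfolding K.acyclic_at_iff
  proof (intro ballI impI)
    fix u assume u: "u \<in> koszul_car r (carriers aug) p n"
    show "\<exists>b\<in>koszul_car r (carriers aug) (p - 1) n. u = diff (koszul r res_complex) (p - 1) b"
    proof (cases "p = 0")
      case True
      then obtain y where "y \<in> mcomp M n" "u = iota r (\<epsilon> y)" using u koszul_aug_zero by blast
      then obtain b where "b \<in> koszul_car r (carriers aug) (- 1) n" "diff (koszul r res_complex) (- 1) b = u"
        using iota_boundary[of y n r] assms(2) True by auto
      then show ?thesis using True by auto
    next
      case False
      then have "u = \<zero>\<^bsub>grp (koszul r res_complex) p\<^esub>" using koszul_aug_pos[OF _ u] assms(1) by simp
      then show ?thesis using K.d_zero[of "p - 1"] by (intro bexI[of _ "\<zero>\<^bsub>grp (koszul r res_complex) (p - 1)\<^esub>"]) simp_all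
    qed
  qed
qed

section \<open>Bijectivity of a generator on the torsion filtration\<close>

lemma tors_mono: "carriers (tors (Suc s)) p n \<subseteq> carriers (tors s) p n"
  by (auto simp: carriers_def tors_def)

text \<open>If a power of \<open>x_s\<close> kills \<open>x_s e\<close>, the next power kills
  \<open>e\<close>; this is injectivity on the quotient. For surjectivity,
  \<open>injective_divide\<close> gives \<open>e'\<close> with
  \<open>x_s^m (e - x_s e') = 0\<close>, so the defect belongs to the smaller stage.\<close>

lemma op_bij_tors: "op_bij res_complex (carriers (tors s)) (carriers (tors (Suc s))) s"
  unfolding op_bij_def
proof (intro allI conjI ballI impI)
  fix p n u assume u: "u \<in> carriers (tors s) p n"
  interpret G: complex_with_sub res_complex "carriers (tors s)" by (rule complex_with_subI[OF op_complex_res_complex op_subcomplex_tors])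
  interpret G': complex_with_sub res_complex "carriers (tors (Suc s))" by (rule complex_with_subI[OF op_complex_res_complex op_subcomplex_tors])
  show "u \<in> carriers (tors (Suc s)) p n" if xu: "oper res_complex s p u \<in> carriers (tors (Suc s)) p (n + 1)"
  proof (cases "p < 0")
    case True
    then show ?thesis using u by (simp add: carriers_def)
  next
    case False
    then obtain e where e: "u = Leaf e" "e \<in> tors s (nat p) n" using u by (auto simp: carriers_def)
    then have eE: "e \<in> carrier (E (nat p))" using E.mg.comp_carrier unfolding tors_def by blast
    obtain k :: nat where "(x s [^]\<^bsub>R\<^esub> k) \<odot>\<^bsub>E (nat p)\<^esub> (x s \<odot>\<^bsub>E (nat p)\<^esub> e) = \<zero>\<^bsub>E (nat p)\<^esub>"
      using xu False e by (auto simp: carriers_def res_complex_simps tors_def)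
    then have "(x s [^]\<^bsub>R\<^esub> Suc k) \<odot>\<^bsub>E (nat p)\<^esub> e = \<zero>\<^bsub>E (nat p)\<^esub>" using eE by (simp add: E.smult_assoc1)
    then have "e \<in> tors (Suc s) (nat p) n" using e(2) unfolding tors_def less_Suc_eq by blast
    then show ?thesis using False e by (simp add: carriers_def)
  qed
  show "\<exists>b\<in>carriers (tors s) p (n - 1). \<exists>c\<in>carriers (tors (Suc s)) p n. u = oper res_complex s p b \<oplus>\<^bsub>grp res_complex p\<^esub> c"
  proof (cases "p < 0")
    case True
    then have "u = \<zero>\<^bsub>grp res_complex p\<^esub>" using u by (simp add: carriers_def res_complex_simps leaf_group_simps)
    then show ?thesis
      using G.C_zero[of p "n - 1"] G'.C_zero[of p n]
      by (intro bexI[of _ "\<zero>\<^bsub>grp res_complex p\<^esub>"]) simp_all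
  next
    case False
    let ?E = "E (nat p)"
    obtain e where e: "u = Leaf e" "e \<in> tors s (nat p) n" using u False by (auto simp: carriers_def)
    then have en: "e \<in> mcomp ?E n" unfolding tors_def by blast
    then have eE: "e \<in> carrier ?E" by (rule E.mg.comp_carrier)
    obtain e' m where e': "e' \<in> mcomp ?E (n - 1)"
      and pow: "(x s [^]\<^bsub>R\<^esub> Suc m) \<odot>\<^bsub>?E\<^esub> e' = (x s [^]\<^bsub>R\<^esub> (m::nat)) \<odot>\<^bsub>?E\<^esub> e"
      and ann: "\<And>a. a \<in> carrier R \<Longrightarrow> a \<odot>\<^bsub>?E\<^esub> e = \<zero>\<^bsub>?E\<^esub> \<Longrightarrow> a \<odot>\<^bsub>?E\<^esub> e' = \<zero>\<^bsub>?E\<^esub>"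
      using injective_divide[OF M.graded_ring_axioms acc inj x_deg en] by blast
    have e'E: "e' \<in> carrier ?E" using e' by (rule E.mg.comp_carrier)
    \<comment> \<open>The powers of earlier generators that kill \<open>e\<close> also kill
      \<open>e'\<close>, by the annihilator clause of the division.\<close>
    have e'G: "e' \<in> tors s (nat p) (n - 1)" using e(2) e' ann unfolding tors_def by (blast intro: M.nat_pow_closed M.xR)
    define c where "c = e \<oplus>\<^bsub>?E\<^esub> \<ominus>\<^bsub>?E\<^esub> (x s \<odot>\<^bsub>?E\<^esub> e')"
    have cG: "c \<in> tors s (nat p) n"
    proof -
      have "Leaf e \<in> carriers (tors s) p n" "oper res_complex s p (Leaf e') \<in> carriers (tors s) p n"
        using e e'G False G.C_x'[of "Leaf e'" p n s] by (auto simp: carriers_def)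
      from G.C_add[OF this(1) G.C_minus[OF this(2)]] have "Leaf c \<in> carriers (tors s) p n"
        using e'E leaf_group_minus[OF E.M.abelian_group_axioms, of "x s \<odot>\<^bsub>?E\<^esub> e'" "nat p"]
        by (simp add: c_def res_complex_simps leaf_group_simps)
      then show ?thesis using False by (auto simp: carriers_def)
    qed
    have "(x s [^]\<^bsub>R\<^esub> m) \<odot>\<^bsub>?E\<^esub> c = (x s [^]\<^bsub>R\<^esub> m) \<odot>\<^bsub>?E\<^esub> e \<oplus>\<^bsub>?E\<^esub> \<ominus>\<^bsub>?E\<^esub> ((x s [^]\<^bsub>R\<^esub> Suc m) \<odot>\<^bsub>?E\<^esub> e')"
      using eE e'E by (simp add: c_def E.smult_r_distr E.smult_r_minus E.smult_assoc1)
    also have "\<dots> = \<zero>\<^bsub>?E\<^esub>" unfolding pow using eE by (simp add: E.M.r_neg)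
    finally have "c \<in> tors (Suc s) (nat p) n" using cG unfolding tors_def less_Suc_eq by blast
    moreover have "e = x s \<odot>\<^bsub>?E\<^esub> e' \<oplus>\<^bsub>?E\<^esub> c"
      using eE e'E by (simp add: c_def E.M.a_lcomm[of "x s \<odot>\<^bsub>?E\<^esub> e'"] E.M.r_neg)
    ultimately show ?thesis
      using False e e'G by (intro bexI[of _ "Leaf e'"] bexI[of _ "Leaf c"]) (auto simp: carriers_def res_complex_simps leaf_group_simps)
  qed
qed

lemma acyclic_koszul_tors:
  assumes "p \<ge> 0" and "p = 0 \<Longrightarrow> mcomp M n \<subseteq> M.xspan n r"
  shows "s \<le> r \<Longrightarrow> acyclic_at (koszul r res_complex) (koszul_car r (carriers (tors s))) p n"
proof (induction s)
  case 0
  show ?case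
    by (rule acyclic_super[OF op_complex_koszul[OF op_complex_res_complex] op_subcomplex_koszul[OF op_complex_res_complex op_subcomplex_tors]
          op_subcomplex_koszul[OF op_complex_res_complex op_subcomplex_aug] koszul_car_mono[OF aug_subset_tors]
          rel_acyclic_koszul[OF op_complex_res_complex op_subcomplex_tors op_subcomplex_aug aug_subset_tors, of 0]
          acyclic_koszul_aug[OF assms]])
      (simp_all add: rel_acyclic_aug)
next
  case (Suc s)
  show ?case
    by (rule acyclic_koszul_sub[OF op_complex_res_complex op_subcomplex_tors op_subcomplex_tors tors_mono op_bij_tors])
      (use Suc in auto)
qed

text \<open>Generators of \<open>M\<close> matter in position 0 alone, which on the antidiagonal
  \<open>n + 1\<close> has internal degree \<open>n + 1\<close>; hence the condition on this one
  component.\<close>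

lemma acyclic_tors_step:
  assumes "\<And>p. p \<ge> 0 \<Longrightarrow> acyclic_at res_complex (carriers (tors r)) p (n - p)"
    and "mcomp M (n + 1) \<subseteq> M.xspan (n + 1) r" and "p \<ge> 0"
  shows "acyclic_at res_complex (carriers (tors r)) p (n + 1 - p)"
proof (rule acyclic_of_koszul[OF op_complex_res_complex op_subcomplex_tors assms(1) _ assms(3)])
  show "acyclic_at (koszul r res_complex) (koszul_car r (carriers (tors r))) p (n + 1 - p)" if "0 \<le> p" for p
    by (rule acyclic_koszul_tors[OF that]) (use assms(2) in auto)
qed

text \<open>Coboundaries are images of arbitrary torsion elements, while acyclicity uses homogeneous
  ones. Components of torsion elements are torsion, so a homogeneous coboundary has a homogeneous
  torsion preimage and the two conditions agree.\<close>

lemma comp_vanishes_iff: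
  "comp_vanishes (local_cohomology R E d q) n \<longleftrightarrow> acyclic_at res_complex (carriers (tors r)) (int q) n"
proof -
  interpret G: complex_with_sub res_complex "carriers (tors r)" by (rule complex_with_subI[OF op_complex_res_complex op_subcomplex_tors])
  let ?B = "coboundaries R E d q"
  have is_torsion_iff: "e \<in> torsion R (irrelevant_ideal R) (E q) \<longleftrightarrow>
      e \<in> carrier (E q) \<and> (\<forall>i<r. \<exists>k::nat. (x i [^]\<^bsub>R\<^esub> k) \<odot>\<^bsub>E q\<^esub> e = \<zero>\<^bsub>E q\<^esub>)" for e q
    by (rule E.torsion_iff)
  have Z: "e \<in> cocycles R E d q \<inter> mcomp (E q) n \<longleftrightarrow> e \<in> tors r q n \<and> d q e = \<zero>\<^bsub>E (Suc q)\<^esub>" for e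
    using E.mg.comp_carrier[of e q n] by (auto simp: cocycles_def is_torsion_iff tors_def a_kernel_def')
  have B: "e \<in> ?B \<longleftrightarrow> (\<exists>b \<in> carriers (tors r) (int q - 1) n. Leaf e = diff res_complex (int q - 1) b)" if e: "e \<in> mcomp (E q) n" for e
  proof (cases q)
    case 0
    \<comment> \<open>Position -1 holds only zero, mapped to the zero of \<open>E 0\<close>, in
      agreement with the zero coboundaries there.\<close>
    then show ?thesis by (simp add: carriers_def res_complex_simps)
  next
    case (Suc q')
    have "e \<in> ?B \<longleftrightarrow> (\<exists>b \<in> tors r q' n. e = d q' b)"
    proof
      assume "e \<in> ?B"
      then obtain y where y: "y \<in> torsion R (irrelevant_ideal R) (E q')" "e = d q' y" using Suc by auto
      then have yE: "y \<in> carrier (E q')" using is_torsion_iff by blast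
      let ?b = "hcomp (E q') (mcomp (E q')) n y"
      have "e = hcomp (E q) (mcomp (E q)) n e" using E.mg.hcomp_homogeneous[OF e] by simp
      also have "\<dots> = d q' ?b" using y hcomp_d[OF yE] Suc by simp
      finally have "e = d q' ?b" .
      moreover have "?b \<in> tors r q' n"
        unfolding tors_def
      proof (intro CollectI conjI allI impI)
        show "?b \<in> mcomp (E q') n" by (rule E.mg.hcomp_in[OF yE])
        fix i assume "i < r"
        then obtain k :: nat where k: "(x i [^]\<^bsub>R\<^esub> k) \<odot>\<^bsub>E q'\<^esub> y = \<zero>\<^bsub>E q'\<^esub>" using y is_torsion_iff by blast
        \<comment> \<open>The power of \<open>x i\<close> is homogeneous of degree \<open>k\<close>,
          so it acts on each component separately.\<close>
        have "(x i [^]\<^bsub>R\<^esub> k) \<odot>\<^bsub>E q'\<^esub> ?b = \<zero>\<^bsub>E q'\<^esub>"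
          using E.hcomp_smult[OF M.pow_degree[OF x_deg[of i]] yE, of k n] k E.mg.hcomp_zero by simp
        then show "\<exists>k::nat. (x i [^]\<^bsub>R\<^esub> k) \<odot>\<^bsub>E q'\<^esub> ?b = \<zero>\<^bsub>E q'\<^esub>" by blast
      qed
      ultimately show "\<exists>b \<in> tors r q' n. e = d q' b" by blast
    next
      assume "\<exists>b \<in> tors r q' n. e = d q' b"
      then obtain b where b: "b \<in> tors r q' n" "e = d q' b" by blast
      then have "b \<in> torsion R (irrelevant_ideal R) (E q')"
        using E.mg.comp_carrier unfolding tors_def is_torsion_iff by blast
      then show "e \<in> ?B" using Suc b by simp
    qed
    then show ?thesis using Suc by (auto simp: carriers_def res_complex_simps)
  qed
  have sgB: "subgroup ?B (add_monoid (E q))"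
  proof (cases q)
    case 0
    have "additive_subgroup {\<zero>\<^bsub>E 0\<^esub>} (E 0)"
      by (rule additive_subgroupI'[OF E.M.abelian_group_axioms]) auto
    then show ?thesis using 0 additive_subgroup.a_subgroup by simp
  next
    case (Suc q')
    let ?T = "torsion R (irrelevant_ideal R) (E q')"
    have T: "y \<in> carrier (E q')" if "y \<in> ?T" for y using that is_torsion_iff by blast
    have Tadd: "y \<oplus>\<^bsub>E q'\<^esub> z \<in> ?T" if yz: "y \<in> ?T" "z \<in> ?T" for y z
      unfolding is_torsion_iff
    proof (intro conjI allI impI)
      show "y \<oplus>\<^bsub>E q'\<^esub> z \<in> carrier (E q')" using yz T by simp
      fix i assume "i < r"
      then obtain k l :: nat where "(x i [^]\<^bsub>R\<^esub> k) \<odot>\<^bsub>E q'\<^esub> y = \<zero>\<^bsub>E q'\<^esub>" "(x i [^]\<^bsub>R\<^esub> l) \<odot>\<^bsub>E q'\<^esub> z = \<zero>\<^bsub>E q'\<^esub>"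
        using yz unfolding is_torsion_iff by blast
      then have "(x i [^]\<^bsub>R\<^esub> max k l) \<odot>\<^bsub>E q'\<^esub> y = \<zero>\<^bsub>E q'\<^esub>" "(x i [^]\<^bsub>R\<^esub> max k l) \<odot>\<^bsub>E q'\<^esub> z = \<zero>\<^bsub>E q'\<^esub>"
        using pow_mono T yz by (meson max.cobounded1 max.cobounded2)+
      then show "\<exists>k::nat. (x i [^]\<^bsub>R\<^esub> k) \<odot>\<^bsub>E q'\<^esub> (y \<oplus>\<^bsub>E q'\<^esub> z) = \<zero>\<^bsub>E q'\<^esub>"
        using T yz by (intro exI[of _ "max k l"]) (simp add: E.smult_r_distr)
    qed
    have Tminus: "\<ominus>\<^bsub>E q'\<^esub> y \<in> ?T" if "y \<in> ?T" for y
      using that unfolding is_torsion_iff by (auto simp: E.smult_r_minus)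
    have T0: "\<zero>\<^bsub>E q'\<^esub> \<in> ?T" unfolding is_torsion_iff by simp
    have "additive_subgroup (d q' ` ?T) (E (Suc q'))"
    proof (rule additive_subgroupI'[OF E.M.abelian_group_axioms])
      show "\<zero>\<^bsub>E (Suc q')\<^esub> \<in> d q' ` ?T" using T0 d_zero[of q'] by force
    qed (use T d_closed Tadd Tminus in \<open>auto simp: d_add[symmetric] d_minus[symmetric]\<close>)
    then show ?thesis using Suc additive_subgroup.a_subgroup by simp
  qed
  have coset: "?B +>\<^bsub>graded_restrict (E q) (cocycles R E d q)\<^esub> e = ?B \<longleftrightarrow> e \<in> ?B" if "e \<in> mcomp (E q) n" for e
  proof -
    have "?B +>\<^bsub>graded_restrict (E q) (cocycles R E d q)\<^esub> e = ?B +>\<^bsub>E q\<^esub> e"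
      by (simp add: a_r_coset_def r_coset_def graded_restrict_def)
    then show ?thesis
      using E.M.a_coset_join1[where H = ?B and x = e] E.M.a_coset_join2[where H = ?B and x = e] sgB E.mg.comp_carrier[OF that] by auto
  qed
  have z: "\<zero>\<^bsub>E q\<^esub> \<in> tors r q n \<and> d q \<zero>\<^bsub>E q\<^esub> = \<zero>\<^bsub>E (Suc q)\<^esub>"
    using d_zero E.mg.comp_zero by (auto simp: tors_def)
  have "comp_vanishes (local_cohomology R E d q) n \<longleftrightarrow>
      (\<lambda>e. ?B +>\<^bsub>graded_restrict (E q) (cocycles R E d q)\<^esub> e) ` (cocycles R E d q \<inter> mcomp (E q) n) = {?B}"
    by (simp add: comp_vanishes_def local_cohomology_def graded_quotient_def) (simp add: graded_restrict_def)
  also have "\<dots> \<longleftrightarrow> (\<forall>e \<in> cocycles R E d q \<inter> mcomp (E q) n. e \<in> ?B)"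
  proof -
    \<comment> \<open>The image of the empty set would not be \<open>{?B}\<close>; the zero element
      rules this out.\<close>
    have ne: "cocycles R E d q \<inter> mcomp (E q) n \<noteq> {}" using z unfolding Z[symmetric] by blast
    have "f ` A = {b} \<longleftrightarrow> (\<forall>a\<in>A. f a = b)" if "A \<noteq> {}" for f :: "'e \<Rightarrow> 'e set" and A b
      using that by auto
    from this[OF ne] show ?thesis using coset by simp
  qed
  also have "\<dots> \<longleftrightarrow> (\<forall>e \<in> tors r q n. d q e = \<zero>\<^bsub>E (Suc q)\<^esub> \<longrightarrow>
      (\<exists>b \<in> carriers (tors r) (int q - 1) n. Leaf e = diff res_complex (int q - 1) b))"
  proof -
    have "e \<in> mcomp (E q) n" if "e \<in> tors r q n" for e using that unfolding tors_def by blast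
    then show ?thesis using B unfolding Ball_def Z by blast
  qed
  also have "\<dots> \<longleftrightarrow> acyclic_at res_complex (carriers (tors r)) (int q) n"
  proof -
    have 1: "carriers (tors r) (int q) n = Leaf ` tors r q n" by (simp add: carriers_def)
    have 2: "diff res_complex (int q) (Leaf e) = \<zero>\<^bsub>grp res_complex (int q + 1)\<^esub> \<longleftrightarrow> d q e = \<zero>\<^bsub>E (Suc q)\<^esub>" for e
      using nat_Suc(1)[of "int q"] by (simp add: res_complex_simps leaf_group_simps)
    show ?thesis unfolding G.acyclic_at_iff 1 using 2 by blast
  qed
  finally show ?thesis .
qed

end

theorem theorem3p1:
  fixes R :: "'r graded_ring"
    and M :: "('r, 'm) graded_module"
    and \<epsilon> :: "'m \<Rightarrow> 'e"
    and E :: "nat \<Rightarrow> ('r, 'e) graded_module"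
    and d :: "nat \<Rightarrow> 'e \<Rightarrow> 'e"
    and t :: int
  assumes "standard_graded R"
    and "finitely_generated_algebra R"
    and "noetherian_ring (degree_zero_ring R)"
    and "graded_module R M"
    and "finitely_generated_module R M"
    and "graded_injective_resolution R M \<epsilon> E d"
    and "max_generator_degree R M \<le> ereal (of_int t)"
    and "weakly_t_regular (local_cohomology R E d) t"
  shows "t_regular (local_cohomology R E d) t"
proof -
  interpret graded_ring R using assms(1) by (simp add: standard_graded_def)
  obtain S where S: "finite S" "S \<subseteq> rcomp R 1" "generate_ring R (rcomp R 0 \<union> S) = carrier R"
    "\<And>I. ideal I R \<Longrightarrow> S \<subseteq> I \<Longrightarrow> irrelevant_ideal R \<subseteq> I"
    using degree_one_generators[OF assms(1,2)] by metis
  obtain r :: nat and y where y: "S = y ` {i. i < r}"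
    using S(1) unfolding finite_conv_nat_seg_image by blast
  \<comment> \<open>Extending by 0 keeps every \<open>x i\<close> in degree 1, as 0 lies in each
    component.\<close>
  define x where "x i = (if i < r then y i else \<zero>\<^bsub>R\<^esub>)" for i
  have xS: "x ` {..<r} = S" unfolding y x_def by auto
  have x1: "x i \<in> rcomp R 1" for i
    using S(2) rg.comp_zero[of 1] unfolding y x_def by auto
  have acc: "ideal_acc R (carrier R)"
  proof (rule ideal_acc_generate[OF rcomp0_subring _ S(1) _ S(3)])
    show "ideal_acc R (rcomp R 0)"
      using noetherian_imp_ideal_acc[OF cring_axioms rcomp0_subring] assms(3)
      by (simp add: degree_zero_ring_def)
    show "S \<subseteq> carrier R" using S(2) rg.comp_carrier by blast
  qed
  interpret generated_resolution R M \<epsilon> E d x r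
    by unfold_locales (use assms(6) acc x1 S(4) in \<open>auto simp: xS\<close>)
  \<comment> \<open>For each \<open>n\<close> this says that H^p vanishes in degree
    \<open>n - p + 1\<close> for all \<open>p\<close>; the case \<open>n = t\<close> is weak
    regularity.\<close>
  have "acyclic_at res_complex (carriers (tors r)) p (n + 1 - p)" if "t \<le> n" "p \<ge> 0" for n p
    using that
  proof (induction n arbitrary: p rule: int_ge_induct)
    case base
    then show ?case
      using assms(8)[unfolded weakly_t_regular_def, rule_format, of "nat p"]
        comp_vanishes_iff[of "nat p" "t + 1 - p"]
      by (simp add: algebra_simps)
  next
    case (step n)
    \<comment> \<open>Passing from \<open>n\<close> to \<open>n + 1\<close> means reaching the
      antidiagonal \<open>n + 2\<close>, whose point in position 0 has degree
      \<open>n + 2 > t\<close>, beyond all generator degrees.\<close>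
    have "mcomp M (n + 1 + 1) \<subseteq> M.xspan (n + 1 + 1) r"
      by (rule M.comp_eq_xspan[OF assms(5,7)]) (use step.hyps in simp)
    then show ?case using acyclic_tors_step[OF step.IH _ step.prems] by blast
  qed
  then show ?thesis
    unfolding t_regular_def comp_vanishes_iff by (simp add: algebra_simps)
qed

end
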